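(* Assume: (a) $\sum_{i=1}^p\alpha_{0i}<1$, and for every $t\in\mathbb Z$, $X_t$ is conditionally sub-Poissonian: $\mathrm E[\exp(uX_t)|\mathcal F_{t-1}]\le\exp(\mu_{t-1}(e^u-1))$ for all $u>0$, where $\mu_{t-1}=\mathrm E[X_t|\mathcal F_{t-1}]=\boldsymbol\theta_0^\top\boldsymbol Y_{t-1}$; (b) there is a constant $f_\infty>0$ with $F_\infty(T_0,\boldsymbol V)>f_\infty$, where $\boldsymbol V=\mathrm E[\boldsymbol Y_0\boldsymbol Y_0^\top]$; (c) the matrices $\boldsymbol V_{T_0,T_0}=\mathrm E[\boldsymbol Y_{0T_0}\boldsymbol Y_{0T_0}^\top]$ and $\mathrm E\big[\boldsymbol Y_{0T_0}\boldsymbol Y_{0T_0}^\top/(\boldsymbol h_{0T_0}^\top\boldsymbol Y_{0T_0})\big]$ are invertible; (d) as $n\to\infty$, $s=O(n^\zeta)$, $ps\log p=o(n)$ and $\frac1{\lambda_n}\sqrt{\frac{ps\log p}{n}}=o(1)$, where $\zeta\in[0,\frac2{11}\wedge\frac\gamma{1+\gamma})$ is a constant. Let $K_X$ be the constant $K_X=\dfrac{2\mu_{0\epsilon}+1}{2(1-\sum_{i=1}^p\alpha_{0i})}$, where $\mu_{0\epsilon}$ is the true value of $\mu_\epsilon$. Then: (i) For every $q\ge1$, $\|X_t\|_{L^q}\le qK_X$, $t\in\mathbb Z$. Moreover, $$\mathrm P(\|\psi_n^{(1)}(\boldsymbol\theta_0)\|_\infty>\lambda_n)\le\frac{12\sqrt6\,\|\boldsymbol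 h_0\|_\infty^{1/2}K_X^{3/2}}{\lambda_n}\sqrt{\frac{ps\log(1+p)}n}.$$ (ii) $\displaystyle\sup_{\boldsymbol v\in C_{T_0}\cap\mathbb S}\ \sup_{q\ge1}\frac{\mathrm E[|\boldsymbol v^\top\boldsymbol Y_{t-1}|^q]^{1/q}}q\le K_s$ for $t\in\mathbb Z$, where $K_s=2\sqrt s(1+K_X)$ and $\mathbb S\subset\mathbb R^{p+1}$ is the Euclidean unit sphere centered at $\boldsymbol0$. (iii) For every $0<\eta<f_\infty/2$, $\mathrm P\big(F_\infty(T_0,\boldsymbol V_n^{(1)})>f_\infty-2\eta\big)\to1$ as $n\to\infty$.
   Context: INAR($p$) model: $X_t=\sum_{i=1}^p\alpha_i\circ X_{t-i}+\epsilon_t$, $t\in\mathbb Z$, with $\alpha_i\ge0$, where for a non-negative integer-valued $X$, $\alpha_i\circ X=\sum_{j=1}^{X}\xi_j^{(i,t)}$ if $X>0$ and $0$ if $X=0$; $\{\xi_j^{(i,t)}\}_{j\in\mathbb N}$ are i.i.d. non-negative integer-valued, independent over $i$ and $t$, with mean $\alpha_i$ and variance $\beta_i$; $\{\epsilon_t\}$ is i.i.d. non-negative integer-valued, $\epsilon_t$ independent of $X_s,s<t$, with mean $\mu_\epsilon$ and variance $\sigma_\epsilon^2$. $\{X_t\}$ is the strictly stationary ergodic solution (existing when $\sum_i\alpha_i<1$). $\mathcal F_t=\sigma(X_s;s\le t)$, $\boldsymbol\theta=(\mu_\epsilon,\alpha_1,\dots,\alpha_p)^\top$, $\boldsymbol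 h=(\sigma_\epsilon^2,\beta_1,\dots,\beta_p)^\top$, with true values $\boldsymbol\theta_0,\boldsymbol h_0$; $\boldsymbol Y_{t-1}=(1,X_{t-1},\dots,X_{t-p})^\top\in\mathbb R^{p+1}$. Then $X_t=\boldsymbol\theta_0^\top\boldsymbol Y_{t-1}+u_t$ with $\mathrm E[u_t|\mathcal F_{t-1}]=0$, $\mathrm E[u_t^2|\mathcal F_{t-1}]=\sigma_\epsilon^2+\sum_{i=1}^p\beta_iX_{t-i}=\boldsymbol h_0^\top\boldsymbol Y_{t-1}$. The first $s$ components of $\boldsymbol\theta_0$ are nonzero and the remaining ones are zero, for some $s>1$; $T_0=\{j:\theta_{0j}\ne0\}$ (so $\{j:h_{0j}\neq0\}\subset T_0$). $p$ and $s$ may depend on $n$. $\lambda_n$ is a tuning parameter. $\psi_n^{(1)}(\boldsymbol\theta)=\frac1n\sum_{t=1}^n\boldsymbol Y_{t-1}\{X_t-\boldsymbol\theta^\top\boldsymbol Y_{t-1}\}$, $\boldsymbol V_n^{(1)}=-\frac1n\sum_{t=1}^n\boldsymbol Y_{t-1}\boldsymbol Y_{t-1}^\top$. $\boldsymbol v_T$ is the sub-vector of $\boldsymbol v$ with indices in $T$; $C_{T_0}=\{\boldsymbol v\in\mathbb R^{p+1}:\|\boldsymbol v_{T_0^c}\|_1\le\|\boldsymbol v_{T_0}\|_1\}$; $F_\infty(T_0,\boldsymbol M)=\inf_{\boldsymbol v\in C_{T_0}\setminus\{\boldsymbol0\}}\frac{|\boldsymbol v^\top\boldsymbol M\boldsymbol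 v|}{\|\boldsymbol v_{T_0}\|_1\|\boldsymbol v\|_\infty}$; $\|X\|_{L^q}=\mathrm E[|X|^q]^{1/q}$. The constant $\gamma$: $\gamma=(1/\gamma_1+2)^{-1}$, where $a,c,\gamma_1>0$ are constants with $\tau(l)\le a\exp(-cl^{\gamma_1})$ and $\beta(l)\le as\exp(-cl^{\gamma_1})$ for all $l\in\mathbb N$ (under (a) such constants exist by known results on integer-valued time series). Here the $\tau$-mixing coefficients of $\{X_t\}$ are $\tau(i)=\sup_{k\ge0}\max_{1\le l\le k}\sup\{\tau(\mathcal M_j,(X_{j_1},\dots,X_{j_l})):j+i\le j_1\le\dots\le j_l\}$, $\mathcal M_j=\sigma(X_t,t\le j)$, with $\tau(\mathcal M,X)=\big\|\sup_f\{\int f\,d\mathrm P_{X|\mathcal M}-\int f\,d\mathrm P_X\}\big\|_{L^1}$, the supremum over functions $f$ on $\mathbb R^d$ that are 1-Lipschitz for $\|\cdot\|_1$; and $\beta(l)=\sup\frac12\sum_{i=1}^I\sum_{j=1}^J|\mathrm P(A_i\cap B_j)-\mathrm P(A_i)\mathrm P(B_j)|$, the supremum over pairs of finite partitions $\{A_i\}\subset\sigma(X_u,u\le t)$, $\{B_j\}\subset\sigma(X_u,u\ge t+l)$. *)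

theory Defs
  imports "HOL-Probability.Probability" "HOL-Library.Landau_Symbols"
begin

section \<open>Processes indexed by the integers\<close>

definition sigma_of :: "'a measure \<Rightarrow> ('i \<Rightarrow> 'a \<Rightarrow> nat) \<Rightarrow> 'i set \<Rightarrow> 'a measure" where
  "sigma_of M Z I = sigma (space M) {Z i -` A \<inter> space M |i A. i \<in> I}"

abbreviation path_space :: "(int \<Rightarrow> nat) measure" where
  "path_space \<equiv> PiM UNIV (\<lambda>_. count_space UNIV)"

definition path_law :: "'a measure \<Rightarrow> (int \<Rightarrow> 'a \<Rightarrow> nat) \<Rightarrow> (int \<Rightarrow> nat) measure" where
  "path_law M X = distr M path_space (\<lambda>\<omega> t. X t \<omega>)"

definition strictly_stationary :: "'a measure \<Rightarrow> (int \<Rightarrow> 'a \<Rightarrow> nat) \<Rightarrow> bool" where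
  "strictly_stationary M X \<longleftrightarrow> (\<forall>k. path_law M (\<lambda>t. X (t + k)) = path_law M X)"

definition ergodic_process :: "'a measure \<Rightarrow> (int \<Rightarrow> 'a \<Rightarrow> nat) \<Rightarrow> bool" where
  "ergodic_process M X \<longleftrightarrow>
     (\<forall>A\<in>sets path_space. (\<lambda>x t. x (t + 1)) -` A = A \<longrightarrow> measure (path_law M X) A \<in> {0, 1})"

text \<open>Valued in \<open>ennreal\<close>, so that a finite bound entails integrability.\<close>

definition Lq_norm :: "'a measure \<Rightarrow> real \<Rightarrow> ('a \<Rightarrow> real) \<Rightarrow> ennreal" where
  "Lq_norm M q f =
     (let I = (\<integral>\<^sup>+\<omega>. ennreal (\<bar>f \<omega>\<bar> powr q) \<partial>M)
      in if I = \<infinity> then \<infinity> else ennreal (enn2real I powr (1 / q)))"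

section \<open>Mixing coefficients\<close>

text \<open>\<open>\<kappa>\<close> is a regular conditional distribution of \<open>Z\<close> given \<open>F\<close>.\<close>

definition cond_distr ::
    "'a measure \<Rightarrow> 'a measure \<Rightarrow> 'b measure \<Rightarrow> ('a \<Rightarrow> 'b) \<Rightarrow> ('a \<Rightarrow> 'b measure) \<Rightarrow> bool" where
  "cond_distr M F N Z \<kappa> \<longleftrightarrow>
     \<kappa> \<in> F \<rightarrow>\<^sub>M prob_algebra N \<and>
     (\<forall>B\<in>sets N. AE \<omega> in M.
        measure (\<kappa> \<omega>) B = real_cond_exp M F (indicator (Z -` B \<inter> space M)) \<omega>)"

text \<open>\<open>\<real>\<^sup>l\<close> is represented by the extensional functions on \<open>{..<l}\<close>.\<close>

abbreviation vec_space :: "nat \<Rightarrow> (nat \<Rightarrow> real) measure" where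
  "vec_space l \<equiv> PiM {..<l} (\<lambda>_. borel)"

definition lip1 :: "nat \<Rightarrow> ((nat \<Rightarrow> real) \<Rightarrow> real) set" where
  "lip1 l = {f. \<forall>x\<in>space (vec_space l). \<forall>y\<in>space (vec_space l).
                  \<bar>f x - f y\<bar> \<le> (\<Sum>r<l. \<bar>x r - y r\<bar>)}"

text \<open>
  The \<open>L\<^sup>1\<close> norm of the supremum of \<open>\<integral>f dP\<^bsub>Z|F\<^esub> - \<integral>f dP\<^bsub>Z\<^esub>\<close> over 1-Lipschitz \<open>f\<close>.
  It does not depend on the version \<open>\<kappa>\<close> of the conditional distribution; the infimum
  merely selects the common value. The supremum is nonnegative because \<open>f = 0\<close> is
  admitted, so the cast to \<open>ennreal\<close> loses nothing.
\<close>

definition tau_dep :: "'a measure \<Rightarrow> 'a measure \<Rightarrow> nat \<Rightarrow> ('a \<Rightarrow> nat \<Rightarrow> real) \<Rightarrow> ennreal" where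
  "tau_dep M F l Z =
     (INF \<kappa> \<in> {\<kappa>. cond_distr M F (vec_space l) Z \<kappa>}.
        \<integral>\<^sup>+\<omega>. (SUP f\<in>lip1 l.
           ennreal ((\<integral>x. f x \<partial>\<kappa> \<omega>) - (\<integral>x. f x \<partial>distr M (vec_space l) Z))) \<partial>M)"

text \<open>
  The factor \<open>1/l\<close> is the normalisation of Dedecker and Prieur. Without it, repeated
  indices \<open>j\<^sub>1 = \<dots> = j\<^sub>l\<close> would make the coefficient infinite whenever it is nonzero.
\<close>

definition tau_mix :: "'a measure \<Rightarrow> (int \<Rightarrow> 'a \<Rightarrow> nat) \<Rightarrow> nat \<Rightarrow> ennreal" where
  "tau_mix M X i =
     (SUP k. SUP l\<in>{1..k}. ennreal (1 / real l) *
        (SUP (j, js) \<in> {(j :: int, js :: int list).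
              length js = l \<and> sorted js \<and> (\<forall>r\<in>set js. j + int i \<le> r)}.
           tau_dep M (sigma_of M X {..j}) l (\<lambda>\<omega>. \<lambda>r\<in>{..<l}. real (X (js ! r) \<omega>))))"

definition beta_mix :: "'a measure \<Rightarrow> (int \<Rightarrow> 'a \<Rightarrow> nat) \<Rightarrow> nat \<Rightarrow> ennreal" where
  "beta_mix M X l =
     (SUP (t, \<A>, \<B>) \<in> {(t :: int, \<A>, \<B>).
          finite \<A> \<and> partition_on (space M) \<A> \<and> \<A> \<subseteq> sets (sigma_of M X {..t}) \<and>
          finite \<B> \<and> partition_on (space M) \<B> \<and> \<B> \<subseteq> sets (sigma_of M X {t + int l..})}.
        ennreal (1/2 * (\<Sum>A\<in>\<A>. \<Sum>B\<in>\<B>.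
          \<bar>measure M (A \<inter> B) - measure M A * measure M B\<bar>)))"

section \<open>The INAR(p) model\<close>

text \<open>
  Vectors of \<open>\<real>\<^bsup>p+1\<^esup>\<close> are functions on \<open>nat\<close> of which only the components \<open>0, \<dots>, p\<close> matter:
  \<open>\<theta> = (\<mu>\<^sub>\<epsilon>, \<alpha>\<^sub>1, \<dots>, \<alpha>\<^sub>p)\<close> and \<open>h = (\<sigma>\<^sub>\<epsilon>\<^sup>2, \<beta>\<^sub>1, \<dots>, \<beta>\<^sub>p)\<close>. The counting variable
  \<open>\<xi>\<^sub>j\<^bsup>(i,t)\<^esup>\<close> is \<open>\<xi> i t j\<close>, with \<open>j \<ge> 1\<close>.
\<close>

definition innovations ::
    "(nat \<Rightarrow> int \<Rightarrow> nat \<Rightarrow> 'a \<Rightarrow> nat) \<Rightarrow> (int \<Rightarrow> 'a \<Rightarrow> nat) \<Rightarrow> (nat \<times> int \<times> nat) + int \<Rightarrow> 'a \<Rightarrow> nat"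
  where "innovations \<xi> \<epsilon> = case_sum (\<lambda>(i, t, j). \<xi> i t j) \<epsilon>"

definition thinning :: "(nat \<Rightarrow> 'a \<Rightarrow> nat) \<Rightarrow> ('a \<Rightarrow> nat) \<Rightarrow> 'a \<Rightarrow> nat" where
  "thinning \<zeta> X \<omega> = (\<Sum>j = 1..X \<omega>. \<zeta> j \<omega>)"

text \<open>
  \<open>innov_indep_past\<close> is the usual causality requirement: the innovation and the counting
  variables of time \<open>t\<close> are independent of the past of the process. It is what yields
  \<open>E[X\<^sub>t | F\<^bsub>t-1\<^esub>] = \<theta>\<^sup>T Y\<^bsub>t-1\<^esub>\<close> and \<open>Var[X\<^sub>t | F\<^bsub>t-1\<^esub>] = h\<^sup>T Y\<^bsub>t-1\<^esub>\<close>.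
\<close>

locale inar = prob_space M for M :: "'a measure" +
  fixes p :: nat and \<theta> h :: "nat \<Rightarrow> real"
    and \<xi> :: "nat \<Rightarrow> int \<Rightarrow> nat \<Rightarrow> 'a \<Rightarrow> nat" and \<epsilon> X :: "int \<Rightarrow> 'a \<Rightarrow> nat"
  assumes alpha_nonneg: "\<And>i. i \<in> {1..p} \<Longrightarrow> 0 \<le> \<theta> i"
    and innov_indep: "indep_vars (\<lambda>_. count_space UNIV) (innovations \<xi> \<epsilon>)
          (({1..p} \<times> UNIV \<times> {1..}) <+> UNIV)"
    and xi_ident: "\<And>i t j. i \<in> {1..p} \<Longrightarrow> 1 \<le> j \<Longrightarrow>
          distr M (count_space UNIV) (\<xi> i t j) = distr M (count_space UNIV) (\<xi> i t 1)"
    and xi_square_integrable: "\<And>i t j. i \<in> {1..p} \<Longrightarrow> 1 \<le> j \<Longrightarrow>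
          integrable M (\<lambda>\<omega>. (real (\<xi> i t j \<omega>))\<^sup>2)"
    and xi_mean: "\<And>i t j. i \<in> {1..p} \<Longrightarrow> 1 \<le> j \<Longrightarrow> expectation (\<lambda>\<omega>. real (\<xi> i t j \<omega>)) = \<theta> i"
    and xi_variance: "\<And>i t j. i \<in> {1..p} \<Longrightarrow> 1 \<le> j \<Longrightarrow> variance (\<lambda>\<omega>. real (\<xi> i t j \<omega>)) = h i"
    and eps_ident: "\<And>t. distr M (count_space UNIV) (\<epsilon> t) = distr M (count_space UNIV) (\<epsilon> 0)"
    and eps_square_integrable: "\<And>t. integrable M (\<lambda>\<omega>. (real (\<epsilon> t \<omega>))\<^sup>2)"
    and eps_mean: "\<And>t. expectation (\<lambda>\<omega>. real (\<epsilon> t \<omega>)) = \<theta> 0"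
    and eps_variance: "\<And>t. variance (\<lambda>\<omega>. real (\<epsilon> t \<omega>)) = h 0"
    and X_measurable: "\<And>t. X t \<in> M \<rightarrow>\<^sub>M count_space UNIV"
    and innov_indep_past: "\<And>t. indep_set
          (sets (sigma_of M (innovations \<xi> \<epsilon>) (({1..p} \<times> {t} \<times> {1..}) <+> {t})))
          (sets (sigma_of M X {..<t}))"
    and recursion: "\<And>t. AE \<omega> in M.
          X t \<omega> = (\<Sum>i = 1..p. thinning (\<xi> i t) (X (t - int i)) \<omega>) + \<epsilon> t \<omega>"
    and stationary: "strictly_stationary M X"
    and ergodic: "ergodic_process M X"

text \<open>\<open>regressor X t \<omega>\<close> is \<open>Y\<^sub>t = (1, X\<^sub>t, \<dots>, X\<^bsub>t-p+1\<^esub>)\<close>.\<close>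

definition regressor :: "(int \<Rightarrow> 'a \<Rightarrow> nat) \<Rightarrow> int \<Rightarrow> 'a \<Rightarrow> nat \<Rightarrow> real" where
  "regressor X t \<omega> j = (if j = 0 then 1 else real (X (t + 1 - int j) \<omega>))"

definition dotp :: "nat \<Rightarrow> (nat \<Rightarrow> real) \<Rightarrow> (nat \<Rightarrow> real) \<Rightarrow> real" where
  "dotp p v w = (\<Sum>j\<le>p. v j * w j)"

text \<open>Sub-Poissonian in the sense of conditional Laplace transforms; \<open>nn_cond_exp\<close> needs no
  prior integrability of \<open>exp (u X\<^sub>t)\<close>.\<close>

definition cond_sub_poissonian ::
    "'a measure \<Rightarrow> nat \<Rightarrow> (nat \<Rightarrow> real) \<Rightarrow> (int \<Rightarrow> 'a \<Rightarrow> nat) \<Rightarrow> bool" where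
  "cond_sub_poissonian M p \<theta> X \<longleftrightarrow> (\<forall>t. \<forall>u>0. AE \<omega> in M.
     nn_cond_exp M (sigma_of M X {..t - 1}) (\<lambda>\<omega>. ennreal (exp (u * real (X t \<omega>)))) \<omega>
       \<le> ennreal (exp (dotp p \<theta> (regressor X (t - 1) \<omega>) * (exp u - 1))))"

definition K_X :: "nat \<Rightarrow> (nat \<Rightarrow> real) \<Rightarrow> real" where
  "K_X p \<theta> = (2 * \<theta> 0 + 1) / (2 * (1 - (\<Sum>i = 1..p. \<theta> i)))"

definition psi1 :: "nat \<Rightarrow> nat \<Rightarrow> (int \<Rightarrow> 'a \<Rightarrow> nat) \<Rightarrow> (nat \<Rightarrow> real) \<Rightarrow> 'a \<Rightarrow> nat \<Rightarrow> real" where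
  "psi1 p n X \<theta> \<omega> j = 1 / real n * (\<Sum>t = 1..n.
     regressor X (int t - 1) \<omega> j *
       (real (X (int t) \<omega>) - dotp p \<theta> (regressor X (int t - 1) \<omega>)))"

definition V1 :: "nat \<Rightarrow> (int \<Rightarrow> 'a \<Rightarrow> nat) \<Rightarrow> 'a \<Rightarrow> nat \<Rightarrow> nat \<Rightarrow> real" where
  "V1 n X \<omega> j k = - (1 / real n * (\<Sum>t = 1..n.
     regressor X (int t - 1) \<omega> j * regressor X (int t - 1) \<omega> k))"

definition Vmat :: "'a measure \<Rightarrow> (int \<Rightarrow> 'a \<Rightarrow> nat) \<Rightarrow> nat \<Rightarrow> nat \<Rightarrow> real" where
  "Vmat M X j k = (\<integral>\<omega>. regressor X 0 \<omega> j * regressor X 0 \<omega> k \<partial>M)"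

definition cond_var_on :: "nat set \<Rightarrow> (nat \<Rightarrow> real) \<Rightarrow> (int \<Rightarrow> 'a \<Rightarrow> nat) \<Rightarrow> 'a \<Rightarrow> real" where
  "cond_var_on T h X \<omega> = (\<Sum>l\<in>T. h l * regressor X 0 \<omega> l)"

definition Wmat ::
    "'a measure \<Rightarrow> nat set \<Rightarrow> (nat \<Rightarrow> real) \<Rightarrow> (int \<Rightarrow> 'a \<Rightarrow> nat) \<Rightarrow> nat \<Rightarrow> nat \<Rightarrow> real" where
  "Wmat M T h X j k =
     (\<integral>\<omega>. regressor X 0 \<omega> j * regressor X 0 \<omega> k / cond_var_on T h X \<omega> \<partial>M)"

text \<open>The entries of \<open>Wmat\<close> are genuine expectations (division by zero is 0 in HOL and a
  non-integrable function has integral 0).\<close>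

definition Wmat_well_defined ::
    "'a measure \<Rightarrow> nat set \<Rightarrow> (nat \<Rightarrow> real) \<Rightarrow> (int \<Rightarrow> 'a \<Rightarrow> nat) \<Rightarrow> bool" where
  "Wmat_well_defined M T h X \<longleftrightarrow>
     (AE \<omega> in M. cond_var_on T h X \<omega> \<noteq> 0) \<and>
     (\<forall>j\<in>T. \<forall>k\<in>T.
        integrable M (\<lambda>\<omega>. regressor X 0 \<omega> j * regressor X 0 \<omega> k / cond_var_on T h X \<omega>))"

section \<open>Vectors, cones and matrices in dimension \<open>p + 1\<close>\<close>

definition invertible_on :: "'i set \<Rightarrow> ('i \<Rightarrow> 'i \<Rightarrow> real) \<Rightarrow> bool" where
  "invertible_on T A \<longleftrightarrow> (\<exists>B. \<forall>j\<in>T. \<forall>k\<in>T.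
     (\<Sum>l\<in>T. A j l * B l k) = (if j = k then 1 else 0) \<and>
     (\<Sum>l\<in>T. B j l * A l k) = (if j = k then 1 else 0))"

definition Rvec :: "nat \<Rightarrow> (nat \<Rightarrow> real) set" where
  "Rvec p = {v. \<forall>j>p. v j = 0}"

definition unit_sphere :: "nat \<Rightarrow> (nat \<Rightarrow> real) set" where
  "unit_sphere p = {v \<in> Rvec p. dotp p v v = 1}"

definition norm1_on :: "nat set \<Rightarrow> (nat \<Rightarrow> real) \<Rightarrow> real" where
  "norm1_on T v = (\<Sum>j\<in>T. \<bar>v j\<bar>)"

definition norm_inf :: "nat \<Rightarrow> (nat \<Rightarrow> real) \<Rightarrow> real" where
  "norm_inf p v = Max ((\<lambda>j. \<bar>v j\<bar>) ` {..p})"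

definition quad_form :: "nat \<Rightarrow> (nat \<Rightarrow> nat \<Rightarrow> real) \<Rightarrow> (nat \<Rightarrow> real) \<Rightarrow> real" where
  "quad_form p A v = (\<Sum>j\<le>p. \<Sum>k\<le>p. v j * A j k * v k)"

definition supp_set :: "nat \<Rightarrow> (nat \<Rightarrow> real) \<Rightarrow> nat set" where
  "supp_set p \<theta> = {j. j \<le> p \<and> \<theta> j \<noteq> 0}"

definition sparse_cone :: "nat \<Rightarrow> nat set \<Rightarrow> (nat \<Rightarrow> real) set" where
  "sparse_cone p T = {v \<in> Rvec p. norm1_on ({..p} - T) v \<le> norm1_on T v}"

definition F_inf :: "nat \<Rightarrow> nat set \<Rightarrow> (nat \<Rightarrow> nat \<Rightarrow> real) \<Rightarrow> real" where
  "F_inf p T A = (INF v \<in> sparse_cone p T - {\<lambda>_. 0}. \<bar>quad_form p A v\<bar> / (norm1_on T v * norm_inf p v))"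

end

theory Submission
  imports Defs "HOL-Real_Asymp.Real_Asymp"
begin

text \<open>
  Part (i). Given the past, \<open>X\<^sub>t\<close> has Poisson-like Laplace transforms, whence
  \<open>E[X\<^sub>t\<^sup>q | F] \<le> (\<mu> + q / 2)\<^sup>q\<close> with \<open>\<mu>\<close> the conditional mean. By Minkowski's inequality the
  \<open>L\<^sup>q\<close> norms of the process obey a linear recursion with total weight \<open>\<Sum>\<alpha>\<^sub>i < 1\<close>. As finiteness of
  the moments is not known beforehand, the recursion is run on the event that \<open>p\<close> consecutive
  values are bounded, and stationarity removes the event in the limit. The score is a martingale
  sum, so Chebyshev's inequality and a union bound suffice; \<open>P \<le> R\<^sup>2\<close> gives \<open>P \<le> R\<close> for a
  probability \<open>P\<close>. Part (ii) is Minkowski's inequality and \<open>\<parallel>v\<parallel>\<^sub>1 \<le> 2 \<parallel>v\<^bsub>T\<^esub>\<parallel>\<^sub>1 \<le> 2 \<surd>s\<close>.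

  Part (iii). On the cone, entrywise errors \<open>\<delta>\<close> of the Gram matrix change \<open>F\<^sub>\<infinity>\<close> by at most
  \<open>4 s \<delta>\<close>. The entries are averages of products of two lagged values, which are truncated at a
  small power of \<open>n\<close>. Lags below the mixing gap \<open>l\<close> are treated as one variable; for longer lags
  one centres the later factor. In both cases \<open>\<beta>\<close>-mixing decorrelates each summand from the
  partial sum \<open>2 l\<close> steps earlier, which yields an exponential inequality.
\<close>

section \<open>Analytic preliminaries\<close>

text \<open>Part (iii) is shaped by one crude estimate. Decorrelating a summand from the exponential
  of an earlier partial sum uses only the sup norm of that exponential, at most exp (u n L^2) for
  summands bounded by L^2, so mixing has to beat an exponential loss and not merely a power of n.
  With truncation at n^e, gap n^\<kappa> and precision of order n^(-\<zeta>), the loss is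
  exponential in n^(3 e + \<zeta>), the gain from mixing is exponential in n^(\<kappa> \<gamma>1),
  and the variance term stays bounded if \<kappa> + 6 e + 2 \<zeta> < 1. As e tends to 0 this leaves
  \<zeta> / \<gamma>1 < \<kappa> < 1 - 2 \<zeta>, a nonempty range exactly when \<zeta> (1 /
  \<gamma>1 + 2) < 1, that is, \<zeta> < \<gamma>.

  Integer values are exploited throughout: a finite vector of them ranges over a countable type,
  every function of it is measurable, and conditioning on it is a sum over its values. This replaces
  disintegration, lets the Chernoff exponent depend on the random conditional mean, and settles the
  measurability of an infimum over an uncountable cone.\<close>

lemma convex_on_powr_nonneg:
  assumes "1 \<le> (q::real)"
  shows "convex_on {0..} (\<lambda>x. x powr q)"
proof (rule convex_onI)
  \<comment> \<open>The endpoint 0 needs its own argument: there the convexity inequality reduces to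
    \<open>v powr q \<le> v\<close> for a weight v below 1.\<close>
  have half: "(v * y) powr q \<le> v * y powr q" if "0 < v" "v < 1" "0 \<le> y" for v y :: real
  proof -
    have "v powr q \<le> v powr 1"
      using that assms by (intro powr_mono') auto
    then show ?thesis
      using that by (auto simp: powr_mult intro: mult_right_mono)
  qed
  fix t x y :: real assume t: "0 < t" "t < 1" and x: "x \<in> {0..}" and y: "y \<in> {0..}"
  show "((1 - t) *\<^sub>R x + t *\<^sub>R y) powr q \<le> (1 - t) * x powr q + t * y powr q"
  proof (cases "x = 0 \<or> y = 0")
    case True
    then show ?thesis using half[of t y] half[of "1 - t" x] t x y by auto
  next
    case False
    then show ?thesis
      using convex_onD[OF powr_convex[OF assms], of t x y] t x y by auto
  qed
qed auto

text \<open>Minkowski's inequality in terms of upper bounds \<open>b i\<close> for the norms.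
  Jensen's inequality is applied with the weights \<open>w i * b i / S\<close> to the normalised
  functions \<open>f i / b i\<close>, each of which has a q-th moment of at most 1. Working in
  \<open>ennreal\<close> avoids any integrability condition, and strict positivity of
  \<open>b i\<close> makes the normalisation possible.\<close>

lemma nn_integral_powr_sum_le:
  fixes f :: "'i \<Rightarrow> 'a \<Rightarrow> real"
  assumes fin: "finite I" and q: "1 \<le> q"
    and w: "\<And>i. i \<in> I \<Longrightarrow> 0 \<le> w i" and b: "\<And>i. i \<in> I \<Longrightarrow> 0 < b i"
    and meas: "\<And>i. i \<in> I \<Longrightarrow> f i \<in> borel_measurable M"
    and f: "\<And>i \<omega>. i \<in> I \<Longrightarrow> 0 \<le> f i \<omega>"
    and bound: "\<And>i. i \<in> I \<Longrightarrow> (\<integral>\<^sup>+\<omega>. ennreal (f i \<omega> powr q) \<partial>M) \<le> ennreal (b i powr q)"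
  shows "(\<integral>\<^sup>+\<omega>. ennreal ((\<Sum>i\<in>I. w i * f i \<omega>) powr q) \<partial>M) \<le> ennreal ((\<Sum>i\<in>I. w i * b i) powr q)"
proof -
  define S where "S = (\<Sum>i\<in>I. w i * b i)"
  have nn: "0 \<le> w i * b i" if "i \<in> I" for i
    using w[OF that] b[OF that] by simp
  have "0 \<le> S" unfolding S_def by (intro sum_nonneg nn)
  show ?thesis
  proof (cases "S = 0")
    case True
    then have "w i * b i = 0" if "i \<in> I" for i
      using that nn fin unfolding S_def by (subst (asm) sum_nonneg_eq_0_iff) auto
    then have "w i = 0" if "i \<in> I" for i using b that by fastforce
    then show ?thesis by simp
  next
    case False
    with \<open>0 \<le> S\<close> have S: "0 < S" by simp
    define v where "v i = w i * b i / S" for i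
    have v0: "0 \<le> v i" if "i \<in> I" for i using nn[OF that] S by (simp add: v_def)
    have v1: "(\<Sum>i\<in>I. v i) = 1"
      using S by (simp add: v_def S_def flip: sum_divide_distrib)
    have ne: "I \<noteq> {}" using v1 by auto
    have pw: "(\<Sum>i\<in>I. w i * f i \<omega>) powr q \<le> S powr q * (\<Sum>i\<in>I. v i * (f i \<omega> powr q / b i powr q))" for \<omega>
    proof -
      have "(\<Sum>i\<in>I. w i * f i \<omega>) = S * (\<Sum>i\<in>I. v i *\<^sub>R (f i \<omega> / b i))"
        unfolding sum_distrib_left
      proof (rule sum.cong)
        fix i assume "i \<in> I"
        then show "w i * f i \<omega> = S * (v i *\<^sub>R (f i \<omega> / b i))"
          using b[of i] S by (simp add: v_def)
      qed simp
      moreover have "0 \<le> (\<Sum>i\<in>I. v i *\<^sub>R (f i \<omega> / b i))"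
        using v0 f b by (intro sum_nonneg) (auto intro!: mult_nonneg_nonneg divide_nonneg_pos)
      ultimately have "(\<Sum>i\<in>I. w i * f i \<omega>) powr q = S powr q * (\<Sum>i\<in>I. v i *\<^sub>R (f i \<omega> / b i)) powr q"
        using S by (simp add: powr_mult)
      also have "(\<Sum>i\<in>I. v i *\<^sub>R (f i \<omega> / b i)) powr q \<le> (\<Sum>i\<in>I. v i * (f i \<omega> / b i) powr q)"
        using f b by (intro convex_on_sum[OF fin ne convex_on_powr_nonneg[OF q] v1 v0])
          (auto intro!: divide_nonneg_pos)
      also have "\<dots> = (\<Sum>i\<in>I. v i * (f i \<omega> powr q / b i powr q))"
        using f b by (intro sum.cong) (auto simp: powr_divide less_imp_le)
      finally show ?thesis using S by (simp add: mult_left_mono)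
    qed
    have "(\<integral>\<^sup>+\<omega>. ennreal ((\<Sum>i\<in>I. w i * f i \<omega>) powr q) \<partial>M)
        \<le> (\<integral>\<^sup>+\<omega>. (\<Sum>i\<in>I. ennreal (S powr q * v i / b i powr q) * ennreal (f i \<omega> powr q)) \<partial>M)"
    proof (rule nn_integral_mono)
      fix \<omega>
      have "(\<Sum>i\<in>I. ennreal (S powr q * v i / b i powr q) * ennreal (f i \<omega> powr q))
          = ennreal (\<Sum>i\<in>I. S powr q * v i / b i powr q * (f i \<omega> powr q))"
        using v0 b by (subst sum_ennreal[symmetric])
          (auto intro!: sum.cong simp: ennreal_mult[symmetric] less_imp_le)
      also have "(\<Sum>i\<in>I. S powr q * v i / b i powr q * (f i \<omega> powr q))
          = S powr q * (\<Sum>i\<in>I. v i * (f i \<omega> powr q / b i powr q))"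
        by (simp add: sum_distrib_left algebra_simps)
      finally show "ennreal ((\<Sum>i\<in>I. w i * f i \<omega>) powr q) \<le>
          (\<Sum>i\<in>I. ennreal (S powr q * v i / b i powr q) * ennreal (f i \<omega> powr q))"
        using pw[of \<omega>] by (simp add: ennreal_leI)
    qed
    also have "\<dots> = (\<Sum>i\<in>I. ennreal (S powr q * v i / b i powr q) * (\<integral>\<^sup>+\<omega>. ennreal (f i \<omega> powr q) \<partial>M))"
      using meas by (simp add: nn_integral_sum nn_integral_cmult)
    also have "\<dots> \<le> (\<Sum>i\<in>I. ennreal (S powr q * v i / b i powr q) * ennreal (b i powr q))"
      by (intro sum_mono mult_left_mono bound) auto
    also have "\<dots> = (\<Sum>i\<in>I. ennreal (S powr q * v i))"
    proof (rule sum.cong)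
      fix i assume i: "i \<in> I"
      have "ennreal (S powr q * v i / b i powr q) * ennreal (b i powr q)
          = ennreal (S powr q * v i / b i powr q * b i powr q)"
        using v0[OF i] by (subst ennreal_mult[symmetric]) auto
      also have "S powr q * v i / b i powr q * b i powr q = S powr q * v i"
        using b[OF i] by simp
      finally show "ennreal (S powr q * v i / b i powr q) * ennreal (b i powr q) = ennreal (S powr q * v i)" .
    qed simp
    also have "\<dots> = ennreal (S powr q)"
      using v0 v1 by (subst sum_ennreal) (auto simp flip: sum_distrib_left)
    finally show ?thesis unfolding S_def .
  qed
qed

lemma Lq_norm_leI:
  assumes "0 < q" "0 \<le> B" "(\<integral>\<^sup>+\<omega>. ennreal (\<bar>f \<omega>\<bar> powr q) \<partial>M) \<le> ennreal (B powr q)"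
  shows "Lq_norm M q f \<le> ennreal B"
proof -
  let ?I = "\<integral>\<^sup>+\<omega>. ennreal (\<bar>f \<omega>\<bar> powr q) \<partial>M"
  have "?I < \<infinity>" using assms(3) using ennreal_less_top le_less_trans by fastforce
  moreover have "enn2real ?I \<le> B powr q"
    using assms by (simp add: enn2real_leI)
  then have "enn2real ?I powr (1 / q) \<le> (B powr q) powr (1 / q)"
    using assms by (intro powr_mono2) auto
  moreover have "(B powr q) powr (1 / q) = B" using assms by (simp add: powr_powr)
  ultimately show ?thesis by (auto simp: Lq_norm_def Let_def intro!: ennreal_leI)
qed

text \<open>The difference of the two sides vanishes at 0 and has derivative y^2 / ((1 + y) (2 +
  y)^2). At x = q / m the left side equals q / (m + q / 2), which is where the summand q / 2 of the
  moment bound, and hence the 1 in the numerator of \<open>K_X\<close>, comes from.\<close>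

lemma two_mult_divide_le_ln:
  assumes "0 \<le> (x::real)"
  shows "2 * x / (2 + x) \<le> ln (1 + x)"
proof -
  have "(\<lambda>x. ln (1 + x) - 2 * x / (2 + x)) 0 \<le> (\<lambda>x. ln (1 + x) - 2 * x / (2 + x)) x"
  proof (rule DERIV_nonneg_imp_nondecreasing[OF assms])
    fix y :: real assume y: "0 \<le> y" "y \<le> x"
    have "((\<lambda>x. ln (1 + x) - 2 * x / (2 + x)) has_real_derivative
        (1 / (1 + y) - (2 * (2 + y) - 2 * y) / ((2 + y) * (2 + y)))) (at y)"
      using y by (auto intro!: derivative_eq_intros)
    moreover have "1 / (1 + y) - (2 * (2 + y) - 2 * y) / ((2 + y) * (2 + y)) = y\<^sup>2 / ((1 + y) * (2 + y)\<^sup>2)"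
      using y by (simp add: divide_simps) (simp add: algebra_simps power2_eq_square)
    then have "0 \<le> 1 / (1 + y) - (2 * (2 + y) - 2 * y) / ((2 + y) * (2 + y))"
      using y by simp
    ultimately show "\<exists>z. ((\<lambda>x. ln (1 + x) - 2 * x / (2 + x)) has_real_derivative z) (at y) \<and> 0 \<le> z"
      by blast
  qed
  then show ?thesis by simp
qed

text \<open>The function x^q exp (- u x) is largest at x = q / u, and the factor on the right is its
  value there. The proof is the inequality ln z \<le> z - 1 at z = u x / q.\<close>

lemma powr_le_exp:
  assumes "0 \<le> (x::real)" "0 < u" "0 < q"
  shows "x powr q \<le> (q / (exp 1 * u)) powr q * exp (u * x)"
proof (cases "x = 0")
  case True
  then show ?thesis by simp
next
  case False
  with assms have x: "0 < x" by simp
  have "ln (u * x / q) \<le> u * x / q - 1" using x assms by (intro ln_le_minus_one) auto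
  then have "q * ln (u * x / q) \<le> u * x - q"
    using assms(3) by (simp add: field_simps)
  then have "q * ln x \<le> q * ln (q / (exp 1 * u)) + u * x"
    using x assms by (simp add: ln_mult ln_div algebra_simps)
  then have "exp (q * ln x) \<le> exp (q * ln (q / (exp 1 * u)) + u * x)" by simp
  then show ?thesis using x assms by (simp add: powr_def exp_add)
qed

text \<open>The exponent \<open>u = ln (1 + q / m)\<close> nearly optimises the Chernoff bound for the
  \<open>q\<close>-th moment of a Poisson variable of mean \<open>m\<close>.\<close>

lemma exists_chernoff_exponent:
  assumes "0 \<le> (m::real)" "1 \<le> q"
  shows "\<exists>u>0. (q / (exp 1 * u)) powr q * exp (m * (exp u - 1)) \<le> (m + q / 2) powr q"
proof (cases "m = 0")
  case True
  \<comment> \<open>For m = 0 the exponent ln (1 + q / m) is meaningless. The exponential factor is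
    then 1, and u = 1 suffices because e is at least 2.\<close>
  have e2: "2 \<le> exp (1::real)" using exp_ge_add_one_self[of 1] by simp
  have "q / (exp 1 * 1) \<le> q / 2" using assms e2 by (intro divide_left_mono) auto
  then have "(q / (exp 1 * 1)) powr q \<le> (q / 2) powr q" using assms by (intro powr_mono2) auto
  then show ?thesis using True by (intro exI[of _ 1]) auto
next
  case False
  with assms have m: "0 < m" by simp
  define u where "u = ln (1 + q / m)"
  have qm: "0 < q / m" using m assms by simp
  have u: "0 < u" unfolding u_def using qm by (intro ln_gt_zero) simp
  have "exp u = 1 + q / m" unfolding u_def using qm by (intro exp_ln) simp
  then have "m * (exp u - 1) = q" using m by simp
  then have "(q / (exp 1 * u)) powr q * exp (m * (exp u - 1)) = (q / (exp 1 * u)) powr q * (exp 1) powr q"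
    by (simp add: powr_def)
  also have "\<dots> = (q / (exp 1 * u) * exp 1) powr q"
    using u assms by (subst powr_mult[symmetric]) auto
  also have "q / (exp 1 * u) * exp 1 = q / u" by simp
  also have "q / u \<le> m + q / 2"
  proof -
    have "2 * (q / m) / (2 + q / m) \<le> u" unfolding u_def using two_mult_divide_le_ln[of "q / m"] qm by simp
    moreover have "2 * (q / m) / (2 + q / m) = q / (m + q / 2)"
      using m assms by (simp add: field_simps)
    ultimately have "q / (m + q / 2) \<le> u" by simp
    then show ?thesis using u m assms by (simp add: field_simps)
  qed
  then have "(q / u) powr q \<le> (m + q / 2) powr q" using u assms by (intro powr_mono2) auto
  finally show ?thesis using u by (intro exI[of _ u]) auto
qed

section \<open>The process and its past\<close>

text \<open>Collecting finitely many discrete variables into one list keeps the value type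
  countable, so the list is measurable for the discrete sigma-algebra. Any function of the list,
  however complicated, is then measurable without further proof.\<close>

lemma measurable_map_count_space:
  fixes f :: "'i \<Rightarrow> 'a \<Rightarrow> 'c::countable"
  assumes "\<And>i. i \<in> set xs \<Longrightarrow> f i \<in> M \<rightarrow>\<^sub>M count_space UNIV"
  shows "(\<lambda>\<omega>. map (\<lambda>i. f i \<omega>) xs) \<in> M \<rightarrow>\<^sub>M count_space UNIV"
  using assms
proof (induction xs)
  case Nil
  then show ?case by simp
next
  case (Cons x xs)
  have 1: "f x \<in> M \<rightarrow>\<^sub>M count_space UNIV" using Cons.prems by simp
  have 2: "(\<lambda>\<omega>. map (\<lambda>i. f i \<omega>) xs) \<in> M \<rightarrow>\<^sub>M count_space UNIV" using Cons by simp
  show ?case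
    unfolding measurable_count_space_eq_countable[OF countableI_type]
  proof safe
    fix ys
    show "(\<lambda>\<omega>. map (\<lambda>i. f i \<omega>) (x # xs)) -` {ys} \<inter> space M \<in> sets M"
    proof (cases ys)
      case Nil
      then have "(\<lambda>\<omega>. map (\<lambda>i. f i \<omega>) (x # xs)) -` {ys} \<inter> space M = {}" by auto
      then show ?thesis by (simp only: sets.empty_sets)
    next
      case (Cons z zs)
      then have "(\<lambda>\<omega>. map (\<lambda>i. f i \<omega>) (x # xs)) -` {ys} \<inter> space M
          = (f x -` {z} \<inter> space M) \<inter> ((\<lambda>\<omega>. map (\<lambda>i. f i \<omega>) xs) -` {zs} \<inter> space M)"
        by auto
      also have "\<dots> \<in> sets M"
        using measurable_sets[OF 1, of "{z}"] measurable_sets[OF 2, of "{zs}"] by auto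
      finally show ?thesis .
    qed
  qed auto
qed

text \<open>On each event \<open>Z \<omega> = x\<close> the parameter of the integrand is a
  constant. This is the substitute for disintegration: statements for fixed parameters transfer to a
  random parameter with countably many values.\<close>

lemma nn_integral_countable_partition:
  fixes Z :: "'a \<Rightarrow> 'c::countable"
  assumes Z: "Z \<in> M \<rightarrow>\<^sub>M count_space UNIV" and H: "\<And>x. H x \<in> borel_measurable M"
  shows "(\<integral>\<^sup>+\<omega>. H (Z \<omega>) \<omega> \<partial>M)
    = (\<integral>\<^sup>+x. (\<integral>\<^sup>+\<omega>. indicator {\<omega>\<in>space M. Z \<omega> = x} \<omega> * H x \<omega> \<partial>M) \<partial>count_space UNIV)"
proof -
  have [measurable]: "{\<omega>\<in>space M. Z \<omega> = x} \<in> sets M" for x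
    using measurable_sets[OF Z, of "{x}"] by (simp add: vimage_def Int_def conj_commute)
  have "(\<integral>\<^sup>+\<omega>. H (Z \<omega>) \<omega> \<partial>M)
      = (\<integral>\<^sup>+\<omega>. (\<integral>\<^sup>+x. indicator {\<omega>\<in>space M. Z \<omega> = x} \<omega> * H x \<omega> \<partial>count_space UNIV) \<partial>M)"
  proof (rule nn_integral_cong)
    fix \<omega> assume \<omega>: "\<omega> \<in> space M"
    have "(\<integral>\<^sup>+x. indicator {\<omega>\<in>space M. Z \<omega> = x} \<omega> * H x \<omega> \<partial>count_space UNIV)
        = (\<integral>\<^sup>+x. H x \<omega> * indicator {Z \<omega>} x \<partial>count_space UNIV)"
      using \<omega> by (intro nn_integral_cong) (auto simp: indicator_def)
    then show "H (Z \<omega>) \<omega> = (\<integral>\<^sup>+x. indicator {\<omega>\<in>space M. Z \<omega> = x} \<omega> * H x \<omega> \<partial>count_space UNIV)"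
      by simp
  qed
  also have "\<dots> = (\<integral>\<^sup>+x. (\<integral>\<^sup>+\<omega>. indicator {\<omega>\<in>space M. Z \<omega> = x} \<omega> * H x \<omega> \<partial>M) \<partial>count_space UNIV)"
    using H by (intro nn_integral_count_space_nn_integral) auto
  finally show ?thesis .
qed

lemma space_sigma_of [simp]: "space (sigma_of M Z I) = space M"
  by (simp add: sigma_of_def space_measure_of_conv)

lemma sets_sigma_of:
  "sets (sigma_of M Z I) = sigma_sets (space M) {Z i -` A \<inter> space M |i A. i \<in> I}"
  unfolding sigma_of_def by (rule sets_measure_of) auto

lemma measurable_sigma_of: "i \<in> I \<Longrightarrow> Z i \<in> sigma_of M Z I \<rightarrow>\<^sub>M count_space UNIV"
  by (rule measurableI) (auto simp: sets_sigma_of intro!: sigma_sets.Basic)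

lemma sets_sigma_of_mono:
  assumes "I \<subseteq> J"
  shows "sets (sigma_of M Z I) \<subseteq> sets (sigma_of M Z J)"
  unfolding sets_sigma_of using assms by (intro sigma_sets_mono') auto

lemma subalgebra_sigma_of:
  assumes "\<And>i. i \<in> I \<Longrightarrow> Z i \<in> M \<rightarrow>\<^sub>M count_space UNIV"
  shows "subalgebra M (sigma_of M Z I)"
  unfolding subalgebra_def sets_sigma_of
  using assms by (auto intro!: sets.sigma_sets_subset measurable_sets)

text \<open>The random part of the regressor as a single variable with values in a countable type.
  The list starts with the most recent value, so coordinate j of the regressor sits at position j -
  1, and coordinate 0 is the constant 1 restored by \<open>list_regressor\<close>.\<close>

definition lags :: "nat \<Rightarrow> (int \<Rightarrow> 'a \<Rightarrow> nat) \<Rightarrow> int \<Rightarrow> 'a \<Rightarrow> nat list" where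
  "lags p X t \<omega> = map (\<lambda>j. X (t + 1 - int j) \<omega>) [1..<Suc p]"

definition list_regressor :: "nat list \<Rightarrow> nat \<Rightarrow> real" where
  "list_regressor x j = (if j = 0 then 1 else real (x ! (j - 1)))"

lemma regressor_lags: "j \<le> p \<Longrightarrow> regressor X t \<omega> j = list_regressor (lags p X t \<omega>) j"
  by (auto simp: regressor_def list_regressor_def lags_def simp del: upt_Suc)

lemma dotp_regressor_lags:
  "dotp p v (regressor X t \<omega>) = dotp p v (list_regressor (lags p X t \<omega>))"
  unfolding dotp_def by (intro sum.cong) (auto simp: regressor_lags)

lemma regressor_nonneg: "0 \<le> regressor X t \<omega> j"
  by (simp add: regressor_def)

lemma lags_measurable:
  assumes "\<And>j. 1 \<le> j \<Longrightarrow> j \<le> p \<Longrightarrow> X (t + 1 - int j) \<in> N \<rightarrow>\<^sub>M count_space UNIV"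
  shows "lags p X t \<in> N \<rightarrow>\<^sub>M count_space UNIV"
  unfolding lags_def using assms by (intro measurable_map_count_space) auto

context inar
begin

lemma subalgebra_X: "subalgebra M (sigma_of M X I)"
  by (intro subalgebra_sigma_of X_measurable)

lemma finite_measure_subalgebra_X: "finite_measure_subalgebra M (sigma_of M X I)"
  by (intro finite_measure_subalgebra.intro finite_measure_subalgebra_axioms.intro subalgebra_X)
     unfold_locales

lemma lags_sigma_of: "lags p X (t - 1) \<in> sigma_of M X {..t - 1} \<rightarrow>\<^sub>M count_space UNIV"
  by (intro lags_measurable measurable_sigma_of) auto

lemma dotp_regressor_sigma_of [measurable]:
  "(\<lambda>\<omega>. dotp p v (regressor X (t - 1) \<omega>)) \<in> borel_measurable (sigma_of M X {..t - 1})"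
  unfolding dotp_regressor_lags
  by (rule measurable_compose[OF lags_sigma_of]) simp

lemma X_borel [measurable]: "(\<lambda>\<omega>. real (X t \<omega>)) \<in> borel_measurable M"
  by (rule measurable_compose[OF X_measurable]) simp

lemma X_measurable' [measurable]: "X t \<in> M \<rightarrow>\<^sub>M count_space UNIV"
  by (rule X_measurable)

lemma regressor_borel [measurable]: "(\<lambda>\<omega>. regressor X t \<omega> j) \<in> borel_measurable M"
  unfolding regressor_def by measurable

lemma dotp_regressor_borel [measurable]:
  "(\<lambda>\<omega>. dotp p v (regressor X t \<omega>)) \<in> borel_measurable M"
  unfolding dotp_def by measurable

lemma path_measurable: "(\<lambda>\<omega> t. X (t + k) \<omega>) \<in> M \<rightarrow>\<^sub>M path_space"
proof (rule measurable_PiM_single')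
  show "X (i + k) \<in> M \<rightarrow>\<^sub>M count_space UNIV" for i by (rule X_measurable)
qed auto

lemma distr_shift: "distr M path_space (\<lambda>\<omega> t. X (t + k) \<omega>) = distr M path_space (\<lambda>\<omega> t. X t \<omega>)"
  using stationary unfolding strictly_stationary_def path_law_def by simp

lemma nn_integral_shift:
  assumes "f \<in> borel_measurable path_space"
  shows "(\<integral>\<^sup>+\<omega>. f (\<lambda>t. X (t + k) \<omega>) \<partial>M) = (\<integral>\<^sup>+\<omega>. f (\<lambda>t. X t \<omega>) \<partial>M)"
  using nn_integral_distr[OF path_measurable[of k], of f] nn_integral_distr[OF path_measurable[of 0], of f]
    assms distr_shift[of k] by simp

lemma integral_shift:
  fixes f :: "(int \<Rightarrow> nat) \<Rightarrow> real"
  assumes "f \<in> borel_measurable path_space"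
  shows "(\<integral>\<omega>. f (\<lambda>t. X (t + k) \<omega>) \<partial>M) = (\<integral>\<omega>. f (\<lambda>t. X t \<omega>) \<partial>M)"
  using integral_distr[OF path_measurable[of k], of f] integral_distr[OF path_measurable[of 0], of f]
    assms distr_shift[of k] by simp

lemma nn_integral_X_shift: "(\<integral>\<^sup>+\<omega>. g (X t \<omega>) \<partial>M) = (\<integral>\<^sup>+\<omega>. g (X 0 \<omega>) \<partial>M)"
proof -
  have "(\<lambda>x. g (x 0)) \<in> borel_measurable path_space"
    by (rule measurable_compose[OF measurable_component_singleton[of 0]]) auto
  from nn_integral_shift[OF this, of t] show ?thesis by simp
qed

lemma integral_X2_shift:
  fixes g :: "nat \<Rightarrow> nat \<Rightarrow> real"
  shows "(\<integral>\<omega>. g (X (a + t) \<omega>) (X (b + t) \<omega>) \<partial>M) = (\<integral>\<omega>. g (X a \<omega>) (X b \<omega>) \<partial>M)"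
proof -
  have 1: "(\<lambda>x. x i) \<in> path_space \<rightarrow>\<^sub>M count_space (UNIV::nat set)" for i
    by (rule measurable_component_singleton) simp
  have "(\<lambda>x. map (\<lambda>i. x i) [a, b]) \<in> path_space \<rightarrow>\<^sub>M count_space UNIV"
    using 1 by (intro measurable_map_count_space) auto
  then have "(\<lambda>x. (\<lambda>l. g (l ! 0) (l ! 1)) (map (\<lambda>i. x i) [a, b])) \<in> borel_measurable path_space"
    by (rule measurable_compose) simp
  from integral_shift[OF this, of t] show ?thesis by simp
qed

lemma theta0_nonneg: "0 \<le> \<theta> 0"
proof -
  have "0 \<le> expectation (\<lambda>\<omega>. real (\<epsilon> 0 \<omega>))" by (rule integral_nonneg_AE) simp
  then show ?thesis by (simp add: eps_mean)
qed

lemma theta_nonneg: "i \<le> p \<Longrightarrow> 0 \<le> \<theta> i"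
  using alpha_nonneg[of i] theta0_nonneg by (cases "i = 0") auto

lemma dotp_theta_nonneg: "0 \<le> dotp p \<theta> (regressor X t \<omega>)"
  unfolding dotp_def using theta_nonneg by (intro sum_nonneg mult_nonneg_nonneg regressor_nonneg) auto

end

section \<open>Moments\<close>

locale sub_poissonian_inar = inar +
  assumes sum_alpha_less: "(\<Sum>i = 1..p. \<theta> i) < 1"
    and sub_poissonian: "cond_sub_poissonian M p \<theta> X"
begin

text \<open>The good Chernoff exponent depends on the conditional mean, which is random, whereas
  sub-Poissonity holds almost surely for each fixed exponent only. The mean is a function of the
  lags, so countably many exponents \<open>u x\<close> are enough. The bounds hold almost surely for
  all x at once, and x is then set to the observed lags.\<close>

lemma nn_cond_moment_le:
  assumes q: "1 \<le> q"
  shows "AE \<omega> in M. nn_cond_exp M (sigma_of M X {..t - 1}) (\<lambda>\<omega>. ennreal (real (X t \<omega>) powr q)) \<omega>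
           \<le> ennreal ((dotp p \<theta> (regressor X (t - 1) \<omega>) + q / 2) powr q)"
proof -
  interpret F: finite_measure_subalgebra M "sigma_of M X {..t - 1}"
    by (rule finite_measure_subalgebra_X)
  let ?E = "nn_cond_exp M (sigma_of M X {..t - 1})"
  let ?m = "\<lambda>x. dotp p \<theta> (list_regressor x)"
  have "\<forall>x. \<exists>u. 0 \<le> ?m x \<longrightarrow>
      0 < u \<and> (q / (exp 1 * u)) powr q * exp (?m x * (exp u - 1)) \<le> (?m x + q / 2) powr q"
    using exists_chernoff_exponent[OF _ q] by blast
  then obtain u where u: "\<And>x. 0 \<le> ?m x \<Longrightarrow>
      0 < u x \<and> (q / (exp 1 * u x)) powr q * exp (?m x * (exp (u x) - 1)) \<le> (?m x + q / 2) powr q"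
    by metis
  have "AE \<omega> in M. \<forall>x. 0 \<le> ?m x \<longrightarrow> ?E (\<lambda>\<omega>. ennreal (real (X t \<omega>) powr q)) \<omega>
      \<le> ennreal ((q / (exp 1 * u x)) powr q) *
        ennreal (exp (dotp p \<theta> (regressor X (t - 1) \<omega>) * (exp (u x) - 1)))"
    unfolding AE_all_countable
  proof
    fix x :: "nat list"
    show "AE \<omega> in M. 0 \<le> ?m x \<longrightarrow> ?E (\<lambda>\<omega>. ennreal (real (X t \<omega>) powr q)) \<omega>
      \<le> ennreal ((q / (exp 1 * u x)) powr q) *
        ennreal (exp (dotp p \<theta> (regressor X (t - 1) \<omega>) * (exp (u x) - 1)))"
    proof (cases "0 \<le> ?m x")
      case False
      then show ?thesis by simp
    next
      case True
      let ?c = "ennreal ((q / (exp 1 * u x)) powr q)"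
      let ?g = "\<lambda>\<omega>. ennreal (exp (u x * real (X t \<omega>)))"
      have ux: "0 < u x" using u[OF True] by simp
      have "ennreal (real (X t \<omega>) powr q) \<le> ?c * ?g \<omega>" for \<omega>
        using powr_le_exp[of "real (X t \<omega>)" "u x" q] ux q
        by (subst ennreal_mult[symmetric]) (auto intro: ennreal_leI)
      then have "AE \<omega> in M. ?E (\<lambda>\<omega>. ennreal (real (X t \<omega>) powr q)) \<omega> \<le> ?E (\<lambda>\<omega>. ?c * ?g \<omega>) \<omega>"
        by (intro F.nn_cond_exp_mono) auto
      moreover have "AE \<omega> in M. ?c * ?E ?g \<omega> = ?E (\<lambda>\<omega>. ?c * ?g \<omega>) \<omega>"
        by (intro F.nn_cond_exp_prod) auto
      moreover have "AE \<omega> in M. ?E ?g \<omega> \<le> ennreal (exp (dotp p \<theta> (regressor X (t - 1) \<omega>) * (exp (u x) - 1)))"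
        using sub_poissonian ux unfolding cond_sub_poissonian_def by blast
      ultimately show ?thesis
      proof eventually_elim
        case (elim \<omega>)
        have "?E (\<lambda>\<omega>. ennreal (real (X t \<omega>) powr q)) \<omega> \<le> ?c * ?E ?g \<omega>"
          using elim(1,2) by simp
        also have "\<dots> \<le> ?c * ennreal (exp (dotp p \<theta> (regressor X (t - 1) \<omega>) * (exp (u x) - 1)))"
          by (intro mult_left_mono elim(3)) auto
        finally show ?case by simp
      qed
    qed
  qed
  then show ?thesis
  proof eventually_elim
    case (elim \<omega>)
    let ?x = "lags p X (t - 1) \<omega>"
    have m: "dotp p \<theta> (regressor X (t - 1) \<omega>) = ?m ?x" by (rule dotp_regressor_lags)
    have nn: "0 \<le> ?m ?x" using dotp_theta_nonneg[of "t - 1" \<omega>] m by simp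
    from elim nn have "?E (\<lambda>\<omega>. ennreal (real (X t \<omega>) powr q)) \<omega>
      \<le> ennreal ((q / (exp 1 * u ?x)) powr q) * ennreal (exp (?m ?x * (exp (u ?x) - 1)))"
      using m by simp
    also have "\<dots> \<le> ennreal ((?m ?x + q / 2) powr q)"
      using u[OF nn] by (subst ennreal_mult[symmetric]) (auto intro: ennreal_leI)
    finally show ?case using m by simp
  qed
qed

lemma nn_integral_restricted_moment_le:
  assumes q: "1 \<le> q" and G: "G \<in> sets (sigma_of M X {..t - 1})"
  shows "(\<integral>\<^sup>+\<omega>. indicator G \<omega> * ennreal (real (X t \<omega>) powr q) \<partial>M)
    \<le> (\<integral>\<^sup>+\<omega>. indicator G \<omega> * ennreal ((dotp p \<theta> (regressor X (t - 1) \<omega>) + q / 2) powr q) \<partial>M)"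
proof -
  interpret F: finite_measure_subalgebra M "sigma_of M X {..t - 1}"
    by (rule finite_measure_subalgebra_X)
  have "(\<integral>\<^sup>+\<omega>. indicator G \<omega> * ennreal (real (X t \<omega>) powr q) \<partial>M)
     = (\<integral>\<^sup>+\<omega>. indicator G \<omega> * nn_cond_exp M (sigma_of M X {..t - 1}) (\<lambda>\<omega>. ennreal (real (X t \<omega>) powr q)) \<omega> \<partial>M)"
    using G by (intro F.nn_cond_exp_intg[symmetric]) auto
  also have "\<dots> \<le> (\<integral>\<^sup>+\<omega>. indicator G \<omega> * ennreal ((dotp p \<theta> (regressor X (t - 1) \<omega>) + q / 2) powr q) \<partial>M)"
    using nn_cond_moment_le[OF q, of t]
    by (intro nn_integral_mono_AE) (auto intro: mult_left_mono elim!: eventually_mono)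
  finally show ?thesis .
qed

abbreviation alpha_sum where "alpha_sum \<equiv> (\<Sum>i = 1..p. \<theta> i)"

lemma alpha_sum_nonneg: "0 \<le> alpha_sum"
  using alpha_nonneg by (intro sum_nonneg) auto

text \<open>A geometric rate for the moment recursion of order p must satisfy
  \<open>alpha_sum \<le> decay ^ p\<close>, since a step may reach p times back. Bernoulli's
  inequality gives this for 1 - x with p x \<le> 1 - \<open>alpha_sum\<close>. The denominator p + 2
  keeps the rate strictly positive even for p = 0.\<close>

definition decay :: real where "decay = 1 - (1 - alpha_sum) / (real p + 2)"

lemma decay_pos: "0 < decay"
proof -
  have "(1 - alpha_sum) / (real p + 2) < 1"
    using alpha_sum_nonneg by (subst divide_less_eq_1_pos) auto
  then show ?thesis unfolding decay_def by simp
qed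

lemma decay_less_1: "decay < 1"
  unfolding decay_def using sum_alpha_less by simp

lemma alpha_sum_le_decay_power: "alpha_sum \<le> decay ^ p"
proof -
  have "1 + real p * (- ((1 - alpha_sum) / (real p + 2))) \<le> (1 + (- ((1 - alpha_sum) / (real p + 2)))) ^ p"
    using decay_pos unfolding decay_def by (intro Bernoulli_inequality) linarith
  moreover have "alpha_sum \<le> 1 + real p * (- ((1 - alpha_sum) / (real p + 2)))"
  proof -
    have "real p * (1 - alpha_sum) \<le> (1 - alpha_sum) * (real p + 2)"
      using sum_alpha_less by (simp add: algebra_simps)
    then have "real p * ((1 - alpha_sum) / (real p + 2)) \<le> 1 - alpha_sum"
      by (simp add: divide_le_eq)
    then show ?thesis by simp
  qed
  ultimately show ?thesis unfolding decay_def by simp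
qed

end

lemma sum_atMost_split:
  fixes f :: "nat \<Rightarrow> 'b::comm_monoid_add"
  shows "(\<Sum>j\<le>n. f j) = f 0 + (\<Sum>j=1..n. f j)"
  unfolding atMost_atLeast0 by (subst sum.atLeast_Suc_atMost) auto

section \<open>Moment recursion started from a bounded window\<close>

context sub_poissonian_inar
begin

text \<open>The fixed point of the map that sends D to
  \<open>\<theta> 0 + q / 2 + alpha_sum * D\<close>, that is, of the recursion that Minkowski's
  inequality yields for the moment norms.\<close>

definition moment_const :: "real \<Rightarrow> real" where
  "moment_const q = (\<theta> 0 + q / 2) / (1 - alpha_sum)"

lemma moment_const_pos: "1 \<le> q \<Longrightarrow> 0 < moment_const q"
  unfolding moment_const_def using theta0_nonneg sum_alpha_less by (intro divide_pos_pos) auto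

lemma moment_const_le:
  assumes "1 \<le> q"
  shows "moment_const q \<le> q * K_X p \<theta>"
proof -
  have "\<theta> 0 + q / 2 \<le> q * (\<theta> 0 + 1 / 2)"
    using mult_right_mono[OF assms theta0_nonneg] by (simp add: algebra_simps)
  then have "moment_const q \<le> q * (\<theta> 0 + 1 / 2) / (1 - alpha_sum)"
    unfolding moment_const_def using sum_alpha_less by (intro divide_right_mono) auto
  also have "\<dots> = q * K_X p \<theta>"
    unfolding K_X_def using sum_alpha_less by (simp add: field_simps)
  finally show ?thesis .
qed

text \<open>One event serves all later times: it belongs to the past of \<open>X (int k)\<close> for
  every k \<ge> p, so its indicator can be carried through the conditional moment bound at each step
  of the recursion.\<close>

definition window :: "nat \<Rightarrow> 'a set" where
  "window B = {\<omega>\<in>space M. \<forall>i<p. X (int i) \<omega> \<le> B}"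

lemma window_sets:
  assumes "p \<le> k"
  shows "window B \<in> sets (sigma_of M X {..int k - 1})"
proof -
  have "window B = {\<omega>\<in>space (sigma_of M X {..int k - 1}). \<forall>i\<in>{..<p}. X (int i) \<omega> \<in> {..B}}"
    by (auto simp: window_def)
  also have "\<dots> \<in> sets (sigma_of M X {..int k - 1})"
  proof (rule sets.sets_Collect_finite_All)
    fix i assume i: "i \<in> {..<p}"
    have "X (int i) \<in> sigma_of M X {..int k - 1} \<rightarrow>\<^sub>M count_space UNIV"
      using i assms by (intro measurable_sigma_of) auto
    from measurable_sets[OF this, of "{..B}"]
    show "{\<omega> \<in> space (sigma_of M X {..int k - 1}). X (int i) \<omega> \<in> {..B}} \<in> sets (sigma_of M X {..int k - 1})"
      by (simp add: vimage_def Int_def conj_commute)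
  qed auto
  finally show ?thesis .
qed

lemma window_events: "window B \<in> sets M"
  using window_sets[of p B] subalgebra_X by (auto simp: subalgebra_def)

text \<open>On the event that the first \<open>p\<close> values are bounded, the conditional moment bound
  propagates: the \<open>L\<^sup>q\<close> norms satisfy a contracting linear recursion, and their limit does
  not depend on the initial bound.\<close>

lemma window_moment_le:
  assumes q: "1 \<le> q"
  shows "(\<integral>\<^sup>+\<omega>. ennreal ((indicator (window B) \<omega> * real (X (int k) \<omega>)) powr q) \<partial>M)
    \<le> ennreal ((moment_const q + real B / decay ^ p * decay ^ k) powr q)"
proof (induction k rule: less_induct)
  case (less k)
  let ?b = "\<lambda>k. moment_const q + real B / decay ^ p * decay ^ k"
  have D0: "0 < moment_const q" by (rule moment_const_pos[OF q])
  have b0: "0 < ?b k" for k using D0 decay_pos by (intro add_pos_nonneg) auto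
  have G: "window B \<in> sets M" by (rule window_events)
  have ind_le: "(\<integral>\<^sup>+\<omega>. ennreal (indicator (window B) \<omega> powr q) \<partial>M) \<le> 1"
  proof -
    have "(\<integral>\<^sup>+\<omega>. ennreal (indicator (window B) \<omega> powr q) \<partial>M) \<le> (\<integral>\<^sup>+\<omega>. 1 \<partial>M)"
      using q by (intro nn_integral_mono) (auto simp: indicator_def)
    then show ?thesis by (simp add: emeasure_space_1)
  qed
  show ?case
  proof (cases "k < p")
    case True
    have dk: "decay ^ p \<le> decay ^ k"
      using True decay_pos decay_less_1 by (intro power_decreasing) auto
    \<comment> \<open>The initial term is scaled by \<open>1 / decay ^ p\<close> precisely so that
      the bound is still at least B at the initial times k < p.\<close>
    have "real B \<le> ?b k"
    proof -
      have "real B = real B / decay ^ p * decay ^ p" using decay_pos by simp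
      also have "\<dots> \<le> real B / decay ^ p * decay ^ k"
        using dk decay_pos by (intro mult_left_mono) auto
      finally show ?thesis using D0 by simp
    qed
    then have "indicator (window B) \<omega> * real (X (int k) \<omega>) \<le> ?b k" for \<omega>
    proof (cases "\<omega> \<in> window B")
      case in_window: True
      then have "real (X (int k) \<omega>) \<le> real B" using True by (simp add: window_def)
      with in_window \<open>real B \<le> ?b k\<close> show ?thesis by simp
    next
      case False
      then show ?thesis using b0[of k] by simp
    qed
    then have "(\<integral>\<^sup>+\<omega>. ennreal ((indicator (window B) \<omega> * real (X (int k) \<omega>)) powr q) \<partial>M)
        \<le> (\<integral>\<^sup>+\<omega>. ennreal (?b k powr q) \<partial>M)"
      using q by (intro nn_integral_mono ennreal_leI powr_mono2) auto
    then show ?thesis by (simp add: emeasure_space_1)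
  next
    case False
    then have pk: "p \<le> k" by simp
    \<comment> \<open>The additive constant is treated as coordinate 0, with weight
      \<open>\<theta> 0 + q / 2\<close> and the window indicator as its function. Minkowski's
      inequality then applies to all p + 1 terms alike.\<close>
    let ?w = "\<lambda>j. if j = 0 then \<theta> 0 + q / 2 else \<theta> j"
    let ?f = "\<lambda>j \<omega>. if j = 0 then indicator (window B) \<omega>
        else indicator (window B) \<omega> * real (X (int (k - j)) \<omega>)"
    let ?c = "\<lambda>j. if j = 0 then 1 else ?b (k - j)"
    have "(\<integral>\<^sup>+\<omega>. ennreal ((indicator (window B) \<omega> * real (X (int k) \<omega>)) powr q) \<partial>M)
        = (\<integral>\<^sup>+\<omega>. indicator (window B) \<omega> * ennreal (real (X (int k) \<omega>) powr q) \<partial>M)"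
      using q by (intro nn_integral_cong) (auto simp: indicator_def)
    also have "\<dots> \<le> (\<integral>\<^sup>+\<omega>. indicator (window B) \<omega> *
        ennreal ((dotp p \<theta> (regressor X (int k - 1) \<omega>) + q / 2) powr q) \<partial>M)"
      by (intro nn_integral_restricted_moment_le q window_sets pk)
    also have "\<dots> = (\<integral>\<^sup>+\<omega>. ennreal ((\<Sum>j\<le>p. ?w j * ?f j \<omega>) powr q) \<partial>M)"
    proof (rule nn_integral_cong)
      fix \<omega>
      let ?d = "dotp p \<theta> (regressor X (int k - 1) \<omega>) + q / 2"
      have d: "?d = (\<Sum>j\<le>p. ?w j * regressor X (int k - 1) \<omega> j)"
        unfolding dotp_def sum_atMost_split by (simp add: regressor_def)
      have "?f j \<omega> = indicator (window B) \<omega> * regressor X (int k - 1) \<omega> j" if "j \<le> p" for j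
        using that pk by (simp add: regressor_def of_nat_diff)
      then have "(\<Sum>j\<le>p. ?w j * ?f j \<omega>)
          = (\<Sum>j\<le>p. indicator (window B) \<omega> * (?w j * regressor X (int k - 1) \<omega> j))"
        by (intro sum.cong refl) (simp only: atMost_iff mult.left_commute)
      then have "(\<Sum>j\<le>p. ?w j * ?f j \<omega>) = indicator (window B) \<omega> * ?d"
        unfolding d sum_distrib_left .
      then show "indicator (window B) \<omega> * ennreal (?d powr q)
          = ennreal ((\<Sum>j\<le>p. ?w j * ?f j \<omega>) powr q)"
        by (simp only:) (cases "\<omega> \<in> window B", simp_all)
    qed
    also have "\<dots> \<le> ennreal ((\<Sum>j\<le>p. ?w j * ?c j) powr q)"
    proof (rule nn_integral_powr_sum_le[OF _ q])
      fix j assume j: "j \<in> {..p}"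
      show "0 \<le> ?w j" using theta_nonneg[of j] theta_nonneg[of 0] j q by auto
      show "0 < ?c j" using b0 by simp
      show "?f j \<in> borel_measurable M" using G by (cases "j = 0") auto
      show "0 \<le> ?f j \<omega>" for \<omega> by simp
      show "(\<integral>\<^sup>+\<omega>. ennreal (?f j \<omega> powr q) \<partial>M) \<le> ennreal (?c j powr q)"
        using less[of "k - j"] ind_le j pk by (cases "j = 0") auto
    qed simp
    also have "\<dots> \<le> ennreal (?b k powr q)"
    proof (intro ennreal_leI powr_mono2)
      show "0 \<le> (\<Sum>j\<le>p. ?w j * ?c j)"
        using theta_nonneg theta0_nonneg q b0 by (intro sum_nonneg mult_nonneg_nonneg) (auto intro: less_imp_le)
      have split: "(\<Sum>j\<le>p. ?w j * ?c j) = \<theta> 0 + q / 2 + (\<Sum>j=1..p. \<theta> j * ?b (k - j))"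
        unfolding sum_atMost_split by simp
      \<comment> \<open>All lags are replaced by the worst one, \<open>j = p\<close>. This costs a
        factor \<open>1 / decay ^ p\<close>, which \<open>alpha_sum \<le> decay ^ p\<close>
        absorbs.\<close>
      have "(\<Sum>j=1..p. \<theta> j * ?b (k - j)) \<le> (\<Sum>j=1..p. \<theta> j * (moment_const q + real B / decay ^ p * (decay ^ k / decay ^ p)))"
      proof (intro sum_mono mult_left_mono add_left_mono)
        fix j assume j: "j \<in> {1..p}"
        have "decay ^ (k - j) \<le> decay ^ (k - p)"
          using j decay_pos decay_less_1 by (intro power_decreasing) auto
        also have "\<dots> = decay ^ k / decay ^ p"
          using pk decay_pos by (simp add: power_diff)
        finally show "decay ^ (k - j) \<le> decay ^ k / decay ^ p" .
        show "0 \<le> \<theta> j" using j by (intro alpha_nonneg)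
      qed (use decay_pos in auto)
      also have "\<dots> = alpha_sum * (moment_const q + real B / decay ^ p * (decay ^ k / decay ^ p))"
        by (rule sum_distrib_right[symmetric])
      also have "\<dots> = alpha_sum * moment_const q + real B / decay ^ p * decay ^ k * (alpha_sum / decay ^ p)"
      proof -
        have "a * (D + b * (d / e)) = a * D + b * d * (a / e)" for a D b d e :: real
          by (simp add: algebra_simps)
        then show ?thesis .
      qed
      also have "\<dots> \<le> alpha_sum * moment_const q + real B / decay ^ p * decay ^ k * 1"
        using alpha_sum_le_decay_power decay_pos by (intro add_left_mono mult_left_mono) auto
      finally have "(\<Sum>j\<le>p. ?w j * ?c j) \<le> \<theta> 0 + q / 2 + (alpha_sum * moment_const q + real B / decay ^ p * decay ^ k * 1)"
        unfolding split by (rule add_left_mono)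
      moreover have "\<theta> 0 + q / 2 = (1 - alpha_sum) * moment_const q"
        unfolding moment_const_def using sum_alpha_less by simp
      ultimately show "(\<Sum>j\<le>p. ?w j * ?c j) \<le> ?b k"
        by (simp only: left_diff_distrib mult_1_left mult_1_right)
    qed (use q in simp)
    finally show ?thesis .
  qed
qed

lemma window_compl_tendsto: "(\<lambda>B. prob (space M - window B)) \<longlonglongrightarrow> 0"
proof -
  have "(\<lambda>B. prob (space M - window B)) \<longlonglongrightarrow> prob (\<Inter>B. space M - window B)"
  proof (rule finite_Lim_measure_decseq)
    show "range (\<lambda>B. space M - window B) \<subseteq> events" using window_events by auto
    show "decseq (\<lambda>B. space M - window B)"
      by (rule decseq_SucI) (auto simp: window_def le_Suc_eq)
  qed
  moreover have "(\<Inter>B. space M - window B) = {}"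
  proof -
    have "\<omega> \<in> window (\<Sum>i<p. X (int i) \<omega>)" if "\<omega> \<in> space M" for \<omega>
      using that by (auto simp: window_def intro: member_le_sum)
    then show ?thesis by blast
  qed
  ultimately show ?thesis by (metis measure_empty)
qed

text \<open>By stationarity \<open>X 0\<close> may be replaced by \<open>X k\<close> for any large
  k. The window bound applies on the window, and off it the truncated variable is at most N. The
  order of limits matters: for fixed B the initial term dies out as k grows, and only then does B
  tend to infinity to remove the complement of the window.\<close>

lemma truncated_moment_le:
  assumes q: "1 \<le> q"
  shows "(\<integral>\<^sup>+\<omega>. ennreal (min (real (X 0 \<omega>)) (real N) powr q) \<partial>M) \<le> ennreal (moment_const q powr q)"
proof -
  let ?I = "\<integral>\<^sup>+\<omega>. ennreal (min (real (X 0 \<omega>)) (real N) powr q) \<partial>M"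
  have 1: "?I \<le> ennreal ((moment_const q + real B / decay ^ p * decay ^ k) powr q
      + real N powr q * prob (space M - window B))" for B k
  proof -
    have W[measurable]: "window B \<in> sets M" by (rule window_events)
    have "?I = (\<integral>\<^sup>+\<omega>. ennreal (min (real (X (int k) \<omega>)) (real N) powr q) \<partial>M)"
      by (rule nn_integral_X_shift[symmetric])
    also have "\<dots> \<le> (\<integral>\<^sup>+\<omega>. ennreal ((indicator (window B) \<omega> * real (X (int k) \<omega>)) powr q) +
        ennreal (real N powr q) * indicator (space M - window B) \<omega> \<partial>M)"
    proof (rule nn_integral_mono)
      fix \<omega> assume "\<omega> \<in> space M"
      then show "ennreal (min (real (X (int k) \<omega>)) (real N) powr q)
        \<le> ennreal ((indicator (window B) \<omega> * real (X (int k) \<omega>)) powr q) +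
          ennreal (real N powr q) * indicator (space M - window B) \<omega>"
        using q by (cases "\<omega> \<in> window B") (auto intro!: ennreal_leI powr_mono2)
    qed
    also have "\<dots> = (\<integral>\<^sup>+\<omega>. ennreal ((indicator (window B) \<omega> * real (X (int k) \<omega>)) powr q) \<partial>M) +
        ennreal (real N powr q) * emeasure M (space M - window B)"
      by (subst nn_integral_add) (auto simp: nn_integral_cmult_indicator)
    also have "\<dots> \<le> ennreal ((moment_const q + real B / decay ^ p * decay ^ k) powr q) +
        ennreal (real N powr q) * emeasure M (space M - window B)"
      by (intro add_right_mono window_moment_le q)
    also have "\<dots> = ennreal ((moment_const q + real B / decay ^ p * decay ^ k) powr q
      + real N powr q * prob (space M - window B))"
      by (simp add: emeasure_eq_measure ennreal_mult)
    finally show ?thesis .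
  qed
  have D0: "0 < moment_const q" by (rule moment_const_pos[OF q])
  have 2: "?I \<le> ennreal (moment_const q powr q + real N powr q * prob (space M - window B))" for B
  proof (rule LIMSEQ_le_const)
    have "(\<lambda>k. decay ^ k) \<longlonglongrightarrow> 0"
      using decay_pos decay_less_1 by (intro LIMSEQ_power_zero) auto
    then have "(\<lambda>k. (moment_const q + real B / decay ^ p * decay ^ k) powr q
      + real N powr q * prob (space M - window B)) \<longlonglongrightarrow> (moment_const q + real B / decay ^ p * 0) powr q
      + real N powr q * prob (space M - window B)"
      using D0 decay_pos decay_less_1
      by (intro tendsto_add tendsto_powr tendsto_mult tendsto_const) auto
    then show "(\<lambda>k. ennreal ((moment_const q + real B / decay ^ p * decay ^ k) powr q
      + real N powr q * prob (space M - window B))) \<longlonglongrightarrow>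
      ennreal (moment_const q powr q + real N powr q * prob (space M - window B))"
      using tendsto_ennrealI by (simp del: ennreal_plus)
    show "\<exists>n. \<forall>k\<ge>n. ?I \<le> ennreal ((moment_const q + real B / decay ^ p * decay ^ k) powr q
      + real N powr q * prob (space M - window B))" using 1 by blast
  qed
  show ?thesis
  proof (rule LIMSEQ_le_const)
    have "(\<lambda>B. moment_const q powr q + real N powr q * prob (space M - window B)) \<longlonglongrightarrow>
        moment_const q powr q + real N powr q * 0"
      by (intro tendsto_intros window_compl_tendsto)
    then show "(\<lambda>B. ennreal (moment_const q powr q + real N powr q * prob (space M - window B)))
        \<longlonglongrightarrow> ennreal (moment_const q powr q)"
      using tendsto_ennrealI by (simp del: ennreal_plus)
    show "\<exists>n. \<forall>B\<ge>n. ?I \<le> ennreal (moment_const q powr q + real N powr q * prob (space M - window B))"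
      using 2 by blast
  qed
qed

lemma moment_le:
  assumes q: "1 \<le> q"
  shows "(\<integral>\<^sup>+\<omega>. ennreal (real (X t \<omega>) powr q) \<partial>M) \<le> ennreal ((q * K_X p \<theta>) powr q)"
proof -
  have "(\<integral>\<^sup>+\<omega>. ennreal (real (X t \<omega>) powr q) \<partial>M) = (\<integral>\<^sup>+\<omega>. ennreal (real (X 0 \<omega>) powr q) \<partial>M)"
    by (rule nn_integral_X_shift)
  also have "\<dots> = (\<integral>\<^sup>+\<omega>. (SUP N. ennreal (min (real (X 0 \<omega>)) (real N) powr q)) \<partial>M)"
  proof (rule nn_integral_cong)
    fix \<omega>
    show "ennreal (real (X 0 \<omega>) powr q) = (SUP N. ennreal (min (real (X 0 \<omega>)) (real N) powr q))"
    proof (rule SUP_eqI[symmetric])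
      show "ennreal (min (real (X 0 \<omega>)) (real N) powr q) \<le> ennreal (real (X 0 \<omega>) powr q)" for N
        using q by (intro ennreal_leI powr_mono2) auto
      fix y assume "\<And>N. N \<in> UNIV \<Longrightarrow> ennreal (min (real (X 0 \<omega>)) (real N) powr q) \<le> y"
      from this[of "X 0 \<omega>"] show "ennreal (real (X 0 \<omega>) powr q) \<le> y" by simp
    qed
  qed
  also have "\<dots> = (SUP N. \<integral>\<^sup>+\<omega>. ennreal (min (real (X 0 \<omega>)) (real N) powr q) \<partial>M)"
    using q by (intro nn_integral_monotone_convergence_SUP)
      (auto simp: incseq_def le_fun_def intro!: ennreal_leI powr_mono2)
  also have "\<dots> \<le> ennreal (moment_const q powr q)"
    by (intro SUP_least truncated_moment_le q)
  also have "\<dots> \<le> ennreal ((q * K_X p \<theta>) powr q)"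
    using moment_const_le[OF q] moment_const_pos[OF q] q by (intro ennreal_leI powr_mono2) auto
  finally show ?thesis .
qed

text \<open>This lower bound lets moment bounds stated in terms of \<open>K_X\<close> cover the
  constant coordinate 1 of the regressor as well.\<close>

lemma K_X_ge_half: "1 / 2 \<le> K_X p \<theta>"
  unfolding K_X_def using theta0_nonneg sum_alpha_less alpha_sum_nonneg
  by (subst le_divide_eq) auto

lemma Lq_norm_X_le:
  assumes "1 \<le> q"
  shows "Lq_norm M q (\<lambda>\<omega>. real (X t \<omega>)) \<le> ennreal (q * K_X p \<theta>)"
  using assms K_X_ge_half moment_le[OF assms, of t] by (intro Lq_norm_leI) auto

lemma integrable_X_powr: "1 \<le> q \<Longrightarrow> integrable M (\<lambda>\<omega>. real (X t \<omega>) powr q)"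
  using moment_le[of q t] by (intro integrableI_bounded) (auto simp: le_less_trans ennreal_less_top)

lemma expectation_X_powr_le:
  assumes "1 \<le> q"
  shows "expectation (\<lambda>\<omega>. real (X t \<omega>) powr q) \<le> (q * K_X p \<theta>) powr q"
proof -
  have "ennreal (expectation (\<lambda>\<omega>. real (X t \<omega>) powr q)) \<le> ennreal ((q * K_X p \<theta>) powr q)"
    using moment_le[OF assms, of t] integrable_X_powr[OF assms, of t]
    by (subst nn_integral_eq_integral[symmetric]) auto
  then show ?thesis by simp
qed

text \<open>The exponent must be positive because \<open>0 powr 0 = 0\<close> while
  \<open>0 ^ 0 = 1\<close>.\<close>

lemma X_powr_of_nat: "0 < k \<Longrightarrow> real (X t \<omega>) powr real k = real (X t \<omega>) ^ k"
  by (cases "X t \<omega> = 0") (auto simp: powr_realpow)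

lemma integrable_X_power: "integrable M (\<lambda>\<omega>. real (X t \<omega>) ^ k)"
  using integrable_X_powr[of "real k" t] by (cases "k = 0") (auto simp: X_powr_of_nat)

lemma expectation_X_power_le:
  assumes "0 < k"
  shows "expectation (\<lambda>\<omega>. real (X t \<omega>) ^ k) \<le> (real k * K_X p \<theta>) ^ k"
  using expectation_X_powr_le[of "real k" t] assms K_X_ge_half
  by (simp add: X_powr_of_nat powr_realpow)

end

section \<open>Exponential inequalities under mixing\<close>

lemma simple_function_sum_indicator:
  fixes f :: "'a \<Rightarrow> real"
  assumes "finite (f ` space M)" "\<omega> \<in> space M"
  shows "f \<omega> = (\<Sum>v\<in>f ` space M. v * indicator (f -` {v} \<inter> space M) \<omega>)"
proof -
  have "(\<Sum>v\<in>f ` space M. v * indicator (f -` {v} \<inter> space M) \<omega>)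
      = (\<Sum>v\<in>f ` space M. if v = f \<omega> then v else 0)"
    using assms(2) by (intro sum.cong) (auto simp: indicator_def)
  also have "\<dots> = f \<omega>" using assms by simp
  finally show ?thesis by simp
qed

lemma partition_on_level_sets:
  "partition_on S ((\<lambda>v. f -` {v} \<inter> S) ` f ` S)"
  by (rule partition_onI) (auto simp: disjnt_def)

lemma exp_le_quadratic:
  assumes "\<bar>x::real\<bar> \<le> 1"
  shows "exp x \<le> 1 + x + x\<^sup>2"
proof (cases "0 \<le> x")
  case True
  then show ?thesis using exp_bound[of x] assms by simp
next
  case False
  define y where "y = - x"
  have y: "0 \<le> y" "y \<le> 1" using False assms by (auto simp: y_def)
  have a: "1 + y + y\<^sup>2 / 2 \<le> exp y" by (rule exp_lower_Taylor_quadratic[OF y(1)])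
  have b: "0 \<le> 1 - y + y\<^sup>2" using y by simp
  \<comment> \<open>For negative arguments the claim is 1 \<le> (1 - y + y^2) exp y. Already the
    quadratic Taylor polynomial in place of exp y gives a product of at least 1.\<close>
  have "1 \<le> 1 + (y^2 + y^3 + y^4) / 2" using y by simp
  also have "\<dots> = (1 - y + y\<^sup>2) * (1 + y + y\<^sup>2 / 2)"
    by (simp add: field_simps power2_eq_square power3_eq_cube power4_eq_xxxx)
  also have "\<dots> \<le> (1 - y + y\<^sup>2) * exp y" by (intro mult_left_mono a b)
  finally have "exp (- y) * 1 \<le> exp (- y) * ((1 - y + y\<^sup>2) * exp y)"
    by (intro mult_left_mono) auto
  also have "\<dots> = 1 - y + y\<^sup>2" by (simp add: exp_minus field_simps)
  finally show ?thesis by (simp add: y_def)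
qed

lemma abs_one_minus_exp_le:
  assumes "\<bar>x::real\<bar> \<le> 1"
  shows "\<bar>1 - exp x\<bar> \<le> 2 * \<bar>x\<bar>"
proof -
  have "x\<^sup>2 = \<bar>x\<bar> * \<bar>x\<bar>" by (simp add: power2_eq_square)
  also have "\<dots> \<le> \<bar>x\<bar> * 1" using assms by (intro mult_left_mono) auto
  finally have "x\<^sup>2 \<le> \<bar>x\<bar>" by simp
  then show ?thesis using exp_le_quadratic[OF assms] exp_ge_add_one_self[of x] by linarith
qed

section \<open>Covariances and exponential moments of bounded variables\<close>

context prob_space
begin

lemma expectation_simple_function:
  fixes V :: "'a \<Rightarrow> real"
  assumes V: "simple_function M V"
  shows "expectation V = (\<Sum>v\<in>V ` space M. v * prob (V -` {v} \<inter> space M))"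
proof -
  let ?E = "\<lambda>v. V -` {v} \<inter> space M"
  have [simp]: "integrable M (indicat_real (?E v))" for v
    by (intro integrable_real_indicator simple_functionD(2)[OF V]) (simp add: emeasure_eq_measure)
  have "expectation V = expectation (\<lambda>\<omega>. \<Sum>v\<in>V ` space M. v * indicator (?E v) \<omega>)"
    by (intro Bochner_Integration.integral_cong refl simple_function_sum_indicator simple_functionD(1)[OF V])
  also have "\<dots> = (\<Sum>v\<in>V ` space M. v * prob (?E v))"
    by (subst Bochner_Integration.integral_sum) (auto intro!: integrable_mult_right simp: Int_absorb2)
  finally show ?thesis .
qed

text \<open>Expanding both variables over their level sets turns the covariance into a weighted sum
  of the terms P(E \<inter> F) - P(E) P(F). Distinct values have distinct level sets, so the sum can
  be indexed by the sets themselves, which is the form of the partitions in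
  \<open>beta_mix\<close>.\<close>

lemma covariance_le_partition_sum:
  fixes V W :: "'a \<Rightarrow> real"
  assumes V: "simple_function M V" "\<And>\<omega>. \<bar>V \<omega>\<bar> \<le> B" and W: "simple_function M W" "\<And>\<omega>. \<bar>W \<omega>\<bar> \<le> C"
    and B: "0 \<le> B" and C: "0 \<le> C"
  shows "\<bar>expectation (\<lambda>\<omega>. V \<omega> * W \<omega>) - expectation V * expectation W\<bar>
    \<le> B * C * (\<Sum>E\<in>(\<lambda>v. V -` {v} \<inter> space M) ` V ` space M. \<Sum>F\<in>(\<lambda>w. W -` {w} \<inter> space M) ` W ` space M.
         \<bar>prob (E \<inter> F) - prob E * prob F\<bar>)"
proof -
  let ?RV = "V ` space M" and ?RW = "W ` space M"
  let ?E = "\<lambda>v. V -` {v} \<inter> space M" and ?F = "\<lambda>w. W -` {w} \<inter> space M"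
  have fin: "finite ?RV" "finite ?RW" using V(1) W(1) by (auto simp: simple_function_def)
  have meas[measurable]: "?E v \<in> events" "?F w \<in> events" for v w
    using V(1) W(1) by (auto intro: simple_functionD)
  have EV: "expectation V = (\<Sum>v\<in>?RV. v * prob (?E v))" and EW: "expectation W = (\<Sum>w\<in>?RW. w * prob (?F w))"
    by (intro expectation_simple_function V(1) W(1))+
  have EVW: "expectation (\<lambda>\<omega>. V \<omega> * W \<omega>) = (\<Sum>v\<in>?RV. \<Sum>w\<in>?RW. v * w * prob (?E v \<inter> ?F w))"
  proof -
    have "expectation (\<lambda>\<omega>. V \<omega> * W \<omega>)
        = expectation (\<lambda>\<omega>. \<Sum>v\<in>?RV. \<Sum>w\<in>?RW. v * w * indicator (?E v \<inter> ?F w) \<omega>)"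
    proof (rule Bochner_Integration.integral_cong)
      fix \<omega> assume \<omega>: "\<omega> \<in> space M"
      have "V \<omega> * W \<omega> = (\<Sum>v\<in>?RV. v * indicator (?E v) \<omega>) * (\<Sum>w\<in>?RW. w * indicator (?F w) \<omega>)"
        by (rule arg_cong2[where f = "(*)", OF simple_function_sum_indicator[OF fin(1) \<omega>]
              simple_function_sum_indicator[OF fin(2) \<omega>]])
      also have "\<dots> = (\<Sum>v\<in>?RV. \<Sum>w\<in>?RW. v * w * indicator (?E v \<inter> ?F w) \<omega>)"
        unfolding sum_product by (intro sum.cong) (auto simp: indicator_def)
      finally show "V \<omega> * W \<omega> = (\<Sum>v\<in>?RV. \<Sum>w\<in>?RW. v * w * indicator (?E v \<inter> ?F w) \<omega>)" .
    qed simp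
    also have "\<dots> = (\<Sum>v\<in>?RV. \<Sum>w\<in>?RW. v * w * prob (?E v \<inter> ?F w))"
    proof -
      have i: "integrable M (\<lambda>\<omega>. v * w * indicator (?E v \<inter> ?F w) \<omega>)" for v w
        by (intro integrable_real_mult_indicator) auto
      have "?E v \<inter> ?F w \<inter> space M = ?E v \<inter> ?F w" for v w by auto
      then have "expectation (\<lambda>\<omega>. v * w * indicator (?E v \<inter> ?F w) \<omega>) = v * w * prob (?E v \<inter> ?F w)" for v w
        by (subst integral_mult_right_zero) simp
      then show ?thesis
        using i by (simp add: Bochner_Integration.integral_sum)
    qed
    finally show ?thesis .
  qed
  have "\<bar>expectation (\<lambda>\<omega>. V \<omega> * W \<omega>) - expectation V * expectation W\<bar>
      = \<bar>\<Sum>v\<in>?RV. \<Sum>w\<in>?RW. v * w * (prob (?E v \<inter> ?F w) - prob (?E v) * prob (?F w))\<bar>"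
    unfolding EVW EV EW sum_product sum_subtractf[symmetric]
    by (intro arg_cong[where f = abs] sum.cong refl) (simp add: algebra_simps)
  also have "\<dots> \<le> (\<Sum>v\<in>?RV. \<Sum>w\<in>?RW. B * C * \<bar>prob (?E v \<inter> ?F w) - prob (?E v) * prob (?F w)\<bar>)"
  proof (intro order.trans[OF sum_abs] sum_mono)
    fix v w assume "v \<in> ?RV" "w \<in> ?RW"
    then have "\<bar>v\<bar> * \<bar>w\<bar> \<le> B * C" using V(2) W(2) B by (intro mult_mono) auto
    then show "\<bar>v * w * (prob (?E v \<inter> ?F w) - prob (?E v) * prob (?F w))\<bar>
        \<le> B * C * \<bar>prob (?E v \<inter> ?F w) - prob (?E v) * prob (?F w)\<bar>"
      unfolding abs_mult by (intro mult_right_mono) auto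
  qed
  also have "\<dots> = B * C * (\<Sum>v\<in>?RV. \<Sum>w\<in>?RW. \<bar>prob (?E v \<inter> ?F w) - prob (?E v) * prob (?F w)\<bar>)"
    by (simp add: sum_distrib_left)
  also have "(\<Sum>v\<in>?RV. \<Sum>w\<in>?RW. \<bar>prob (?E v \<inter> ?F w) - prob (?E v) * prob (?F w)\<bar>)
      = (\<Sum>E\<in>?E ` ?RV. \<Sum>F\<in>?F ` ?RW. \<bar>prob (E \<inter> F) - prob E * prob F\<bar>)"
  proof -
    have "inj_on ?E ?RV" "inj_on ?F ?RW" by (auto simp: inj_on_def)
    then show ?thesis by (simp add: sum.reindex)
  qed
  finally show ?thesis .
qed

text \<open>Dropping the last \<open>g\<close> summands from the exponent before decorrelating costs a factor
  \<open>2 \<lambda> g b\<close>, of the same order as the quadratic term of the exponential.\<close>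

lemma mgf_sum_le:
  fixes D :: "nat \<Rightarrow> 'a \<Rightarrow> real"
  assumes meas: "\<And>k. D k \<in> borel_measurable M" and bound: "\<And>k \<omega>. \<bar>D k \<omega>\<bar> \<le> b"
    and u: "0 < u" and T: "0 \<le> T" and g: "1 \<le> g" "u * b * real g \<le> 1"
    and corr: "\<And>k. k < n \<Longrightarrow> expectation (\<lambda>\<omega>. exp (u * (\<Sum>i<k - g. D i \<omega>)) * D k \<omega>) \<le> T"
  shows "expectation (\<lambda>\<omega>. exp (u * (\<Sum>i<n. D i \<omega>))) \<le> exp (3 * real g * real n * (u * b)\<^sup>2) * (1 + real n * u * T)"
proof -
  note [measurable] = meas
  have b: "0 \<le> b" using bound[of 0] abs_ge_zero order.trans by blast
  let ?S = "\<lambda>k \<omega>. \<Sum>i<k. D i \<omega>"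
  let ?r = "3 * real g * (u * b)\<^sup>2"
  have ub: "u * b \<le> 1"
  proof -
    have "u * b * 1 \<le> u * b * real g" using g(1) u b by (intro mult_left_mono) auto
    then show ?thesis using g(2) by simp
  qed
  have S_bound: "\<forall>k \<omega>. \<bar>?S k \<omega>\<bar> \<le> real k * b"
  proof (intro allI)
    fix k \<omega>
    have "(\<Sum>i<k. \<bar>D i \<omega>\<bar>) \<le> real (card {..<k}) * b"
      using bound by (intro sum_bounded_above) auto
    then show "\<bar>?S k \<omega>\<bar> \<le> real k * b"
      by (intro order.trans[OF sum_abs]) simp
  qed
  have exp_bound: "\<forall>k \<omega>. \<bar>exp (u * ?S k \<omega>)\<bar> \<le> exp (u * (real k * b))"
    using S_bound u by (auto simp: abs_le_iff)
  have int1: "integrable M (\<lambda>\<omega>. exp (u * ?S k \<omega>))" for k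
    using exp_bound by (intro integrable_const_bound[where B = "exp (u * (real k * b))"]) auto
  have int2: "integrable M (\<lambda>\<omega>. exp (u * ?S j \<omega>) * D k \<omega>)" for j k
  proof (rule integrable_const_bound)
    show "AE \<omega> in M. norm (exp (u * ?S j \<omega>) * D k \<omega>) \<le> exp (u * (real j * b)) * b"
    proof (rule AE_I2)
      fix \<omega>
      have "\<bar>exp (u * ?S j \<omega>)\<bar> * \<bar>D k \<omega>\<bar> \<le> exp (u * (real j * b)) * b"
        by (rule mult_mono) (use exp_bound bound in auto)
      then show "norm (exp (u * ?S j \<omega>) * D k \<omega>) \<le> exp (u * (real j * b)) * b"
        by (simp add: abs_mult)
    qed
  qed auto
  have step: "expectation (\<lambda>\<omega>. exp (u * ?S (Suc k) \<omega>)) \<le> (1 + ?r) * expectation (\<lambda>\<omega>. exp (u * ?S k \<omega>)) + u * T"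
    if k: "k < n" for k
  proof -
    have pw: "exp (u * ?S (Suc k) \<omega>) \<le> (1 + ?r) * exp (u * ?S k \<omega>) + u * (exp (u * ?S (k - g) \<omega>) * D k \<omega>)" for \<omega>
    proof -
      define d where "d = ?S k \<omega> - ?S (k - g) \<omega>"
      define e where "e = exp (u * ?S k \<omega>)"
      define x where "x = D k \<omega>"
      have x: "\<bar>x\<bar> \<le> b" unfolding x_def by (rule bound)
      have "d = (\<Sum>i\<in>{k - g..<k}. D i \<omega>)"
        unfolding d_def by (simp add: lessThan_atLeast0 sum_diff_nat_ivl)
      then have "\<bar>d\<bar> \<le> (\<Sum>i\<in>{k - g..<k}. \<bar>D i \<omega>\<bar>)" by simp
      also have "\<dots> \<le> real (card {k - g..<k}) * b" using bound by (intro sum_bounded_above) auto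
      also have "\<dots> \<le> real g * b" using b by (intro mult_right_mono) auto
      finally have ud: "\<bar>- (u * d)\<bar> \<le> u * b * real g" using u by (simp add: abs_mult algebra_simps)
      have "\<bar>1 - exp (- (u * d))\<bar> \<le> 2 * \<bar>- (u * d)\<bar>"
        using ud g(2) by (intro abs_one_minus_exp_le) simp
      also have "\<dots> \<le> 2 * (u * b * real g)" using ud by simp
      finally have 1: "\<bar>1 - exp (- (u * d))\<bar> * \<bar>x\<bar> \<le> 2 * (u * b * real g) * b"
        using x by (intro mult_mono) (use u b in auto)
      have e0: "0 < e" by (simp add: e_def)
      have es: "exp (u * ?S (k - g) \<omega>) = e * exp (- (u * d))"
        unfolding e_def d_def by (simp add: exp_add[symmetric] algebra_simps)
      have ux: "\<bar>u * x\<bar> \<le> u * b" using x u by (simp add: abs_mult)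
      have "exp (u * ?S (Suc k) \<omega>) = e * exp (u * x)"
        unfolding e_def x_def by (simp add: exp_add[symmetric] algebra_simps)
      also have "\<dots> \<le> e * (1 + u * x + (u * x)\<^sup>2)"
        using ux ub e0 by (intro mult_left_mono exp_le_quadratic) auto
      \<comment> \<open>Here d is the part of the sum contributed by the last g indices before k, so
        \<open>e * exp (- (u * d))\<close> is the exponential stopped at \<open>k - g\<close>, the
        one that \<open>corr\<close> controls. What is left costs 2 g (u b)^2 e, and the quadratic
        term costs (u b)^2 e. Together they give the 3 in \<open>?r\<close>.\<close>
      also have "\<dots> = e + e * (u * x)\<^sup>2 + u * (e * exp (- (u * d)) * x) + u * e * ((1 - exp (- (u * d))) * x)"
        by (simp add: algebra_simps)
      also have "\<dots> \<le> e + e * (u * b)\<^sup>2 + u * (e * exp (- (u * d)) * x) + u * e * (2 * (u * b * real g) * b)"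
      proof -
        have "(u * x)\<^sup>2 \<le> (u * b)\<^sup>2" using ux by (intro power2_le_iff_abs_le[THEN iffD2]) (use u b in auto)
        moreover have "(1 - exp (- (u * d))) * x \<le> 2 * (u * b * real g) * b"
          using 1 by (metis abs_ge_self abs_mult order.trans)
        ultimately show ?thesis using e0 u by (intro add_mono mult_left_mono order.refl) auto
      qed
      also have "\<dots> = (1 + (u * b)\<^sup>2 + 2 * real g * (u * b)\<^sup>2) * e + u * (e * exp (- (u * d)) * x)"
        by (simp add: algebra_simps power2_eq_square)
      also have "\<dots> \<le> (1 + ?r) * e + u * (e * exp (- (u * d)) * x)"
      proof -
        have "1 * (u * b)\<^sup>2 \<le> real g * (u * b)\<^sup>2" using g(1) by (intro mult_right_mono) auto
        then have "1 + (u * b)\<^sup>2 + 2 * real g * (u * b)\<^sup>2 \<le> 1 + ?r" by simp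
        then show ?thesis using e0 by (intro add_right_mono mult_right_mono) auto
      qed
      finally show ?thesis unfolding es[symmetric] by (simp add: e_def x_def)
    qed
    have "expectation (\<lambda>\<omega>. exp (u * ?S (Suc k) \<omega>))
        \<le> expectation (\<lambda>\<omega>. (1 + ?r) * exp (u * ?S k \<omega>) + u * (exp (u * ?S (k - g) \<omega>) * D k \<omega>))"
      by (intro integral_mono int1 pw Bochner_Integration.integrable_add integrable_mult_right int2)
    also have "\<dots> = (1 + ?r) * expectation (\<lambda>\<omega>. exp (u * ?S k \<omega>))
        + u * expectation (\<lambda>\<omega>. exp (u * ?S (k - g) \<omega>) * D k \<omega>)"
      by (subst Bochner_Integration.integral_add) (auto intro!: integrable_mult_right int1 int2)
    also have "\<dots> \<le> (1 + ?r) * expectation (\<lambda>\<omega>. exp (u * ?S k \<omega>)) + u * T"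
      using corr[OF k] u by (intro add_left_mono mult_left_mono) auto
    finally show ?thesis .
  qed
  have r0: "0 \<le> ?r" by simp
  \<comment> \<open>The one-step estimate is an affine recursion. Enlarging each increment
    \<open>u * T\<close> by the full growth factor makes that factor common to all terms.\<close>
  have main: "expectation (\<lambda>\<omega>. exp (u * ?S k \<omega>)) \<le> (1 + ?r) ^ k * (1 + real k * u * T)" if "k \<le> n" for k
    using that
  proof (induction k)
    case 0
    then show ?case by (simp add: prob_space)
  next
    case (Suc k)
    have pge: "1 \<le> (1 + ?r) ^ Suc k" using r0 by (intro one_le_power) simp
    have "expectation (\<lambda>\<omega>. exp (u * ?S (Suc k) \<omega>)) \<le> (1 + ?r) * expectation (\<lambda>\<omega>. exp (u * ?S k \<omega>)) + u * T"
      using Suc by (intro step) simp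
    also have "\<dots> \<le> (1 + ?r) * ((1 + ?r) ^ k * (1 + real k * u * T)) + (1 + ?r) ^ Suc k * (u * T)"
    proof (intro add_mono mult_left_mono)
      show "u * T \<le> (1 + ?r) ^ Suc k * (u * T)"
        using mult_right_mono[OF pge, of "u * T"] u T by simp
    qed (use Suc r0 in auto)
    also have "\<dots> = (1 + ?r) ^ Suc k * (1 + real (Suc k) * u * T)"
      by (simp add: algebra_simps)
    finally show ?case .
  qed
  have "(1 + ?r) ^ n \<le> exp ?r ^ n" using r0 by (intro power_mono exp_ge_add_one_self) simp
  also have "\<dots> = exp (3 * real g * real n * (u * b)\<^sup>2)"
    by (simp add: exp_of_nat_mult[symmetric] algebra_simps)
  finally have "(1 + ?r) ^ n * (1 + real n * u * T) \<le> exp (3 * real g * real n * (u * b)\<^sup>2) * (1 + real n * u * T)"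
    using u T by (intro mult_right_mono) auto
  with main[of n] show ?thesis by simp
qed

lemma tail_le_mgf:
  assumes "integrable M (\<lambda>\<omega>. exp (u * S \<omega>))" "0 < u" "S \<in> borel_measurable M"
  shows "prob {\<omega>\<in>space M. y \<le> S \<omega>} \<le> exp (- (u * y)) * expectation (\<lambda>\<omega>. exp (u * S \<omega>))"
proof -
  have "{\<omega>\<in>space M. y \<le> S \<omega>} = {\<omega>\<in>space M. exp (u * y) \<le> exp (u * S \<omega>)}"
    using assms(2) by auto
  also have "prob \<dots> \<le> expectation (\<lambda>\<omega>. exp (u * S \<omega>)) / exp (u * y)"
    using assms by (intro integral_Markov_inequality_measure[where A = "space M"]) (auto simp: vimage_def)
  also have "\<dots> = exp (- (u * y)) * expectation (\<lambda>\<omega>. exp (u * S \<omega>))"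
    by (simp add: exp_minus field_simps)
  finally show ?thesis .
qed

end

section \<open>Beta mixing for sums of lagged products\<close>

context inar
begin

lemma beta_mix_covariance_le:
  fixes V W :: "'a \<Rightarrow> real"
  assumes V: "simple_function (sigma_of M X {..t}) V" "\<And>\<omega>. \<bar>V \<omega>\<bar> \<le> B"
    and W: "simple_function (sigma_of M X {t + int l..}) W" "\<And>\<omega>. \<bar>W \<omega>\<bar> \<le> C"
    and \<beta>: "beta_mix M X l \<le> ennreal \<beta>" "0 \<le> \<beta>"
  shows "\<bar>expectation (\<lambda>\<omega>. V \<omega> * W \<omega>) - expectation V * expectation W\<bar> \<le> 2 * B * C * \<beta>"
proof -
  let ?P = "(\<lambda>v. V -` {v} \<inter> space M) ` V ` space M" and ?Q = "(\<lambda>w. W -` {w} \<inter> space M) ` W ` space M"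
  let ?s = "\<Sum>E\<in>?P. \<Sum>F\<in>?Q. \<bar>prob (E \<inter> F) - prob E * prob F\<bar>"
  have BC: "0 \<le> B" "0 \<le> C" using V(2) W(2) abs_ge_zero order.trans by blast+
  have sub: "sets (sigma_of M X I) \<subseteq> sets M" for I using subalgebra_X by (simp add: subalgebra_def)
  have P: "finite ?P" "?P \<subseteq> sets (sigma_of M X {..t})"
    using V(1) by (auto simp: simple_function_def)
  have Q: "finite ?Q" "?Q \<subseteq> sets (sigma_of M X {t + int l..})"
    using W(1) by (auto simp: simple_function_def)
  have sfV: "simple_function M V"
    using V(1) sub[of "{..t}"] by (auto simp: simple_function_def)
  have sfW: "simple_function M W"
    using W(1) sub[of "{t + int l..}"] by (auto simp: simple_function_def)
  have "ennreal (1 / 2 * ?s) \<le> beta_mix M X l"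
    unfolding beta_mix_def
    by (rule SUP_upper2[of "(t, ?P, ?Q)"]) (use P Q partition_on_level_sets in auto)
  then have "ennreal (1 / 2 * ?s) \<le> ennreal \<beta>" using \<beta>(1) by (rule order.trans)
  then have "?s \<le> 2 * \<beta>" using \<beta>(2) by (simp add: ennreal_le_iff)
  then have "B * C * ?s \<le> B * C * (2 * \<beta>)" using BC by (intro mult_left_mono) auto
  with covariance_le_partition_sum[OF sfV V(2) sfW W(2) BC] show ?thesis by simp
qed


lemma simple_function_X:
  assumes "t \<in> I" "finite (range \<phi>)"
  shows "simple_function (sigma_of M X I) (\<lambda>\<omega>. \<phi> (X t \<omega>))"
  unfolding simple_function_def
proof (intro conjI ballI)
  show "finite ((\<lambda>\<omega>. \<phi> (X t \<omega>)) ` space (sigma_of M X I))"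
    by (rule finite_subset[OF _ assms(2)]) auto
  fix v
  have "(\<lambda>\<omega>. \<phi> (X t \<omega>)) -` {v} \<inter> space (sigma_of M X I) = X t -` (\<phi> -` {v}) \<inter> space (sigma_of M X I)"
    by auto
  also have "\<dots> \<in> sets (sigma_of M X I)"
    by (rule measurable_sets[OF measurable_sigma_of[where Z = X, OF assms(1)]]) simp
  finally show "(\<lambda>\<omega>. \<phi> (X t \<omega>)) -` {v} \<inter> space (sigma_of M X I) \<in> sets (sigma_of M X I)" .
qed

lemma simple_function_sigma_of_measurable:
  assumes "simple_function (sigma_of M X I) (f :: 'a \<Rightarrow> real)"
  shows "f \<in> borel_measurable M"
  using borel_measurable_simple_function[OF assms] measurable_from_subalg[OF subalgebra_X] by blast

text \<open>Each summand splits into a factor \<open>P k\<close> known at time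
  \<open>\<tau> k\<close> and a centred factor \<open>W k\<close> that starts l steps later. The
  exponential of the sum stopped g terms earlier, multiplied by \<open>P k\<close>, is also known at
  \<open>\<tau> k\<close>. Its product with \<open>W k\<close> therefore has an expectation equal to
  a covariance, bounded by mixing times the sup norm of the exponential; this is the origin of
  \<open>exp (u * (real n * (B * C)))\<close>. Applying the exponential bound to the sum and to its
  negative gives the leading 2.\<close>

lemma mixing_tail:
  fixes P W D :: "nat \<Rightarrow> 'a \<Rightarrow> real" and \<tau> :: "nat \<Rightarrow> int"
  assumes P: "\<And>k. simple_function (sigma_of M X {..\<tau> k}) (P k)" "\<And>k \<omega>. \<bar>P k \<omega>\<bar> \<le> B"
    and W: "\<And>k. simple_function (sigma_of M X {\<tau> k + int l..}) (W k)" "\<And>k \<omega>. \<bar>W k \<omega>\<bar> \<le> C"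
      "\<And>k. expectation (W k) = 0"
    and D: "\<And>k \<omega>. D k \<omega> = P k \<omega> * W k \<omega>"
    and past: "\<And>i k. i < k - g \<Longrightarrow> simple_function (sigma_of M X {..\<tau> k}) (D i)"
    and \<beta>: "beta_mix M X l \<le> ennreal \<beta>" "0 \<le> \<beta>"
    and u: "0 < u" and g: "1 \<le> g" "u * (B * C) * real g \<le> 1"
  shows "prob {\<omega>\<in>space M. y \<le> \<bar>\<Sum>k<n. D k \<omega>\<bar>} \<le> 2 * (exp (- (u * y)) *
    (exp (3 * real g * real n * (u * (B * C))\<^sup>2) *
      (1 + real n * u * (2 * exp (u * (real n * (B * C))) * (B * C) * \<beta>))))"
proof -
  let ?b = "B * C"
  let ?T = "2 * exp (u * (real n * ?b)) * ?b * \<beta>"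
  have BC: "0 \<le> B" "0 \<le> C" using P(2) W(2) abs_ge_zero order.trans by blast+
  have D_bound: "\<bar>D k \<omega>\<bar> \<le> ?b" for k \<omega>
    unfolding D abs_mult using P(2) W(2) BC by (intro mult_mono) auto
  have D_meas[measurable]: "D k \<in> borel_measurable M" for k
  proof -
    have "(\<lambda>\<omega>. P k \<omega> * W k \<omega>) \<in> borel_measurable M"
      using simple_function_sigma_of_measurable[OF P(1)] simple_function_sigma_of_measurable[OF W(1)] by simp
    then show ?thesis unfolding D[abs_def] .
  qed
  have one: "prob {\<omega>\<in>space M. y \<le> (\<Sum>k<n. r * D k \<omega>)} \<le> exp (- (u * y)) *
      (exp (3 * real g * real n * (u * ?b)\<^sup>2) * (1 + real n * u * ?T))" if r: "\<bar>r\<bar> = 1" for r :: real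
  proof -
    have rD: "\<bar>r * D k \<omega>\<bar> \<le> ?b" for k \<omega> using D_bound r by (simp add: abs_mult)
    have sum_le: "\<bar>\<Sum>i<m. r * D i \<omega>\<bar> \<le> real n * ?b" if "m \<le> n" for m \<omega>
    proof -
      have "\<bar>\<Sum>i<m. r * D i \<omega>\<bar> \<le> (\<Sum>i<m. \<bar>r * D i \<omega>\<bar>)" by (rule sum_abs)
      also have "\<dots> \<le> real (card {..<m}) * ?b" using rD by (intro sum_bounded_above) auto
      also have "\<dots> \<le> real n * ?b" using that BC by (intro mult_right_mono) auto
      finally show ?thesis .
    qed
    have corr: "expectation (\<lambda>\<omega>. exp (u * (\<Sum>i<k - g. r * D i \<omega>)) * (r * D k \<omega>)) \<le> ?T" if k: "k < n" for k
    proof -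
      let ?V = "\<lambda>\<omega>. exp (u * (\<Sum>i<k - g. r * D i \<omega>)) * (r * P k \<omega>)"
      have sf: "simple_function (sigma_of M X {..\<tau> k}) ?V"
        using past P(1)
        by (intro simple_function_mult simple_function_compose1[where g = exp] simple_function_sum
            simple_function_const) auto
      have Vb: "\<bar>?V \<omega>\<bar> \<le> exp (u * (real n * ?b)) * B" for \<omega>
      proof -
        have "(\<Sum>i<k - g. r * D i \<omega>) \<le> real n * ?b"
          using sum_le[of "k - g" \<omega>] k by linarith
        then have "exp (u * (\<Sum>i<k - g. r * D i \<omega>)) \<le> exp (u * (real n * ?b))"
          using u by simp
        moreover have "\<bar>r * P k \<omega>\<bar> \<le> B" using P(2) r by (simp add: abs_mult)
        ultimately have "exp (u * (\<Sum>i<k - g. r * D i \<omega>)) * \<bar>r * P k \<omega>\<bar> \<le> exp (u * (real n * ?b)) * B"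
          by (intro mult_mono) auto
        then show ?thesis by (simp only: abs_mult abs_exp_cancel)
      qed
      have "expectation (\<lambda>\<omega>. exp (u * (\<Sum>i<k - g. r * D i \<omega>)) * (r * D k \<omega>)) = expectation (\<lambda>\<omega>. ?V \<omega> * W k \<omega>)"
        unfolding D[of k] by (simp only: mult.assoc)
      also have "\<dots> \<le> \<bar>expectation (\<lambda>\<omega>. ?V \<omega> * W k \<omega>) - expectation ?V * expectation (W k)\<bar>"
        unfolding W(3) by simp
      also have "\<dots> \<le> 2 * (exp (u * (real n * ?b)) * B) * C * \<beta>"
        by (rule beta_mix_covariance_le[OF sf Vb W(1,2) \<beta>])
      also have "\<dots> = ?T" by simp
      finally show ?thesis .
    qed
    have T0: "0 \<le> ?T" using BC \<beta>(2) by simp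
    have "prob {\<omega>\<in>space M. y \<le> (\<Sum>k<n. r * D k \<omega>)}
        \<le> exp (- (u * y)) * expectation (\<lambda>\<omega>. exp (u * (\<Sum>k<n. r * D k \<omega>)))"
    proof (rule tail_le_mgf)
      show "integrable M (\<lambda>\<omega>. exp (u * (\<Sum>k<n. r * D k \<omega>)))"
      proof (rule integrable_const_bound)
        show "AE \<omega> in M. norm (exp (u * (\<Sum>k<n. r * D k \<omega>))) \<le> exp (u * (real n * ?b))"
        proof (rule AE_I2)
          fix \<omega>
          have "(\<Sum>k<n. r * D k \<omega>) \<le> real n * ?b" using sum_le[of n \<omega>] by linarith
          then show "norm (exp (u * (\<Sum>k<n. r * D k \<omega>))) \<le> exp (u * (real n * ?b))" using u by simp
        qed
      qed simp
    qed (use u in auto)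
    also have "\<dots> \<le> exp (- (u * y)) * (exp (3 * real g * real n * (u * ?b)\<^sup>2) * (1 + real n * u * ?T))"
      by (intro mult_left_mono mgf_sum_le[where D = "\<lambda>k \<omega>. r * D k \<omega>"] rD u T0 g corr) auto
    finally show ?thesis .
  qed
  have "prob {\<omega>\<in>space M. y \<le> \<bar>\<Sum>k<n. D k \<omega>\<bar>}
      \<le> prob ({\<omega>\<in>space M. y \<le> (\<Sum>k<n. 1 * D k \<omega>)} \<union> {\<omega>\<in>space M. y \<le> (\<Sum>k<n. (- 1) * D k \<omega>)})"
    by (intro finite_measure_mono) (auto simp: sum_negf abs_if split: if_splits)
  also have "\<dots> \<le> prob {\<omega>\<in>space M. y \<le> (\<Sum>k<n. 1 * D k \<omega>)} + prob {\<omega>\<in>space M. y \<le> (\<Sum>k<n. (- 1) * D k \<omega>)}"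
    by (intro measure_Un_le) auto
  finally show ?thesis using one[of 1] one[of "- 1"] by linarith
qed

text \<open>The one-sided estimate behind \<open>mixing_tail\<close> for summands bounded by L^2 and
  g = 2 l, whence the factor 6 = 3 * 2.\<close>

definition tail_bound :: "nat \<Rightarrow> nat \<Rightarrow> real \<Rightarrow> real \<Rightarrow> real \<Rightarrow> real \<Rightarrow> real" where
  "tail_bound n l L \<beta> u y = exp (- (u * y)) * (exp (6 * real l * real n * (u * L\<^sup>2)\<^sup>2) *
      (1 + real n * u * (2 * exp (u * (real n * L\<^sup>2)) * L\<^sup>2 * \<beta>)))"

text \<open>For a lag below l the whole product occupies fewer than l + 1 consecutive times, so it
  can be centred and used as the late factor, with 1 as the early one. A summand more than 2 l
  positions earlier ends at least l steps before the current product begins: one l is for the extent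
  of the product, the other for the mixing gap.\<close>

lemma short_lag_tail:
  fixes \<phi>\<^sub>1 \<phi>\<^sub>2 :: "nat \<Rightarrow> real" and a :: int and d n :: nat
  assumes fin: "finite (range \<phi>\<^sub>1)" "finite (range \<phi>\<^sub>2)"
    and \<phi>: "\<And>x. 0 \<le> \<phi>\<^sub>1 x \<and> \<phi>\<^sub>1 x \<le> L" "\<And>x. 0 \<le> \<phi>\<^sub>2 x \<and> \<phi>\<^sub>2 x \<le> L"
    and d: "d < l" and \<beta>: "beta_mix M X l \<le> ennreal \<beta>" "0 \<le> \<beta>"
    and u: "0 < u" "u * L\<^sup>2 * (2 * real l) \<le> 1"
  defines "c \<equiv> expectation (\<lambda>\<omega>. \<phi>\<^sub>1 (X a \<omega>) * \<phi>\<^sub>2 (X (a + int d) \<omega>))"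
  shows "prob {\<omega>\<in>space M. y \<le> \<bar>\<Sum>k<n. (\<phi>\<^sub>1 (X (a + int k) \<omega>) * \<phi>\<^sub>2 (X (a + int k + int d) \<omega>) - c)\<bar>}
    \<le> 2 * tail_bound n l L \<beta> u y"
proof -
  let ?D = "\<lambda>k \<omega>. \<phi>\<^sub>1 (X (a + int k) \<omega>) * \<phi>\<^sub>2 (X (a + int k + int d) \<omega>) - c"
  have L: "0 \<le> L" using \<phi>(1)[of 0] by linarith
  have sf: "simple_function (sigma_of M X I) (?D k)" if "a + int k \<in> I" "a + int k + int d \<in> I" for I k
    using that fin by (intro simple_function_diff simple_function_mult simple_function_X simple_function_const) auto
  have prod: "0 \<le> \<phi>\<^sub>1 x * \<phi>\<^sub>2 z \<and> \<phi>\<^sub>1 x * \<phi>\<^sub>2 z \<le> L\<^sup>2" for x z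
    using \<phi> L unfolding power2_eq_square by (auto intro: mult_mono)
  have int: "integrable M (\<lambda>\<omega>. \<phi>\<^sub>1 (X s \<omega>) * \<phi>\<^sub>2 (X t \<omega>))" for s t
    using prod by (intro integrable_const_bound[where B = "L\<^sup>2"])
      (auto intro!: borel_measurable_times measurable_compose[OF X_measurable])
  have c: "0 \<le> c" "c \<le> L\<^sup>2"
    unfolding c_def using prod by (auto intro!: integral_nonneg integral_le_const int)
  have "prob {\<omega>\<in>space M. y \<le> \<bar>\<Sum>k<n. ?D k \<omega>\<bar>} \<le> 2 * (exp (- (u * y)) *
    (exp (3 * real (2 * l) * real n * (u * (1 * L\<^sup>2))\<^sup>2) *
      (1 + real n * u * (2 * exp (u * (real n * (1 * L\<^sup>2))) * (1 * L\<^sup>2) * \<beta>))))"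
  proof (rule mixing_tail[where P = "\<lambda>_ _. 1" and W = ?D and \<tau> = "\<lambda>k. a + int k - int l" and l = l and g = "2 * l"])
    show "simple_function (sigma_of M X {a + int k - int l + int l..}) (?D k)" for k
      by (intro sf) auto
    show "\<bar>?D k \<omega>\<bar> \<le> L\<^sup>2" for k \<omega>
      using prod[of "X (a + int k) \<omega>" "X (a + int k + int d) \<omega>"] c by linarith
    show "expectation (?D k) = 0" for k
    proof -
      have "expectation (?D k) = expectation (\<lambda>\<omega>. \<phi>\<^sub>1 (X (a + int k) \<omega>) * \<phi>\<^sub>2 (X (a + int d + int k) \<omega>)) - c"
        using int by (simp add: prob_space algebra_simps)
      also have "\<dots> = 0" unfolding c_def by (subst integral_X2_shift) simp
      finally show ?thesis .
    qed
    show "simple_function (sigma_of M X {..a + int k - int l}) (?D i)" if "i < k - 2 * l" for i k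
      using that d by (intro sf) auto
    show "1 \<le> 2 * l" using d by simp
    show "u * (1 * L\<^sup>2) * real (2 * l) \<le> 1" using u(2) by simp
  qed (use \<beta> u in \<open>auto simp: simple_function_const\<close>)
  then show ?thesis unfolding tail_bound_def by simp
qed

text \<open>For a long lag the later factors of earlier summands may fall after the current early
  factor, so the whole product cannot be decorrelated from the preceding sum. Centring only the
  later factor cures this. The early factor lies at least l steps before the later one and counts as
  past, as do all summands more than 2 l positions earlier.\<close>

lemma long_lag_tail:
  fixes \<phi>\<^sub>1 \<phi>\<^sub>2 :: "nat \<Rightarrow> real" and a :: int and d n :: nat
  assumes fin: "finite (range \<phi>\<^sub>1)" "finite (range \<phi>\<^sub>2)"
    and \<phi>: "\<And>x. 0 \<le> \<phi>\<^sub>1 x \<and> \<phi>\<^sub>1 x \<le> L" "\<And>x. 0 \<le> \<phi>\<^sub>2 x \<and> \<phi>\<^sub>2 x \<le> L"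
    and d: "1 \<le> l" "l \<le> d" and \<beta>: "beta_mix M X l \<le> ennreal \<beta>" "0 \<le> \<beta>"
    and u: "0 < u" "u * L\<^sup>2 * (2 * real l) \<le> 1"
  defines "m \<equiv> expectation (\<lambda>\<omega>. \<phi>\<^sub>2 (X (a + int d) \<omega>))"
  shows "prob {\<omega>\<in>space M. y \<le> \<bar>\<Sum>k<n. \<phi>\<^sub>1 (X (a + int k) \<omega>) * (\<phi>\<^sub>2 (X (a + int k + int d) \<omega>) - m)\<bar>}
    \<le> 2 * tail_bound n l L \<beta> u y"
proof -
  let ?D = "\<lambda>k \<omega>. \<phi>\<^sub>1 (X (a + int k) \<omega>) * (\<phi>\<^sub>2 (X (a + int k + int d) \<omega>) - m)"
  have int: "integrable M (\<lambda>\<omega>. \<phi>\<^sub>2 (X t \<omega>))" for t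
    using \<phi>(2) by (intro integrable_const_bound[where B = L]) (auto intro!: measurable_compose[OF X_measurable])
  have m: "0 \<le> m" "m \<le> L"
    unfolding m_def using \<phi>(2) by (auto intro!: integral_nonneg integral_le_const int)
  have sf: "simple_function (sigma_of M X I) (?D k)" if "a + int k \<in> I" "a + int k + int d \<in> I" for I k
    using that fin by (intro simple_function_diff simple_function_mult simple_function_X simple_function_const) auto
  have "prob {\<omega>\<in>space M. y \<le> \<bar>\<Sum>k<n. ?D k \<omega>\<bar>} \<le> 2 * (exp (- (u * y)) *
    (exp (3 * real (2 * l) * real n * (u * (L * L))\<^sup>2) *
      (1 + real n * u * (2 * exp (u * (real n * (L * L))) * (L * L) * \<beta>))))"
  proof (rule mixing_tail[where P = "\<lambda>k \<omega>. \<phi>\<^sub>1 (X (a + int k) \<omega>)" and W = "\<lambda>k \<omega>. \<phi>\<^sub>2 (X (a + int k + int d) \<omega>) - m"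
        and \<tau> = "\<lambda>k. a + int k + int d - int l" and l = l and g = "2 * l"])
    show "simple_function (sigma_of M X {..a + int k + int d - int l}) (\<lambda>\<omega>. \<phi>\<^sub>1 (X (a + int k) \<omega>))" for k
      using d fin by (intro simple_function_X) auto
    show "simple_function (sigma_of M X {a + int k + int d - int l + int l..}) (\<lambda>\<omega>. \<phi>\<^sub>2 (X (a + int k + int d) \<omega>) - m)" for k
      using fin by (intro simple_function_diff simple_function_X simple_function_const) auto
    show "\<bar>\<phi>\<^sub>1 (X (a + int k) \<omega>)\<bar> \<le> L" for k \<omega>
      using \<phi>(1)[of "X (a + int k) \<omega>"] by linarith
    show "\<bar>\<phi>\<^sub>2 (X (a + int k + int d) \<omega>) - m\<bar> \<le> L" for k \<omega>
      using \<phi>(2)[of "X (a + int k + int d) \<omega>"] m by linarith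
    show "expectation (\<lambda>\<omega>. \<phi>\<^sub>2 (X (a + int k + int d) \<omega>) - m) = 0" for k
    proof -
      have "expectation (\<lambda>\<omega>. \<phi>\<^sub>2 (X (a + int k + int d) \<omega>) - m) = expectation (\<lambda>\<omega>. \<phi>\<^sub>2 (X (a + int d + int k) \<omega>)) - m"
        using int by (simp add: prob_space algebra_simps)
      also have "\<dots> = 0" unfolding m_def by (subst integral_X2_shift[where g = "\<lambda>x z. \<phi>\<^sub>2 x"]) simp
      finally show ?thesis .
    qed
    show "simple_function (sigma_of M X {..a + int k + int d - int l}) (?D i)" if "i < k - 2 * l" for i k
      using that d by (intro sf) auto
    show "1 \<le> 2 * l" using d by simp
    show "u * (L * L) * real (2 * l) \<le> 1" using u(2) by (simp add: power2_eq_square)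
  qed (use \<beta> u in auto)
  then show ?thesis unfolding tail_bound_def by (simp add: power2_eq_square)
qed

text \<open>For a long lag the deviation splits into \<phi>1 (\<phi>2 - m), then \<phi>1 m - e, and
  the bias e - c, where m is the mean of the later factor and e that of \<phi>1 m. The bias is a
  covariance across a gap of at least l, so the hypothesis on y bounds its total by y. Hence the
  threshold 3 y, and two two-sided tails give the factor 4.\<close>

lemma pair_tail:
  fixes \<phi>\<^sub>1 \<phi>\<^sub>2 :: "nat \<Rightarrow> real" and a :: int and d n :: nat
  assumes fin: "finite (range \<phi>\<^sub>1)" "finite (range \<phi>\<^sub>2)"
    and \<phi>: "\<And>x. 0 \<le> \<phi>\<^sub>1 x \<and> \<phi>\<^sub>1 x \<le> L" "\<And>x. 0 \<le> \<phi>\<^sub>2 x \<and> \<phi>\<^sub>2 x \<le> L"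
    and l: "1 \<le> l" and \<beta>: "beta_mix M X l \<le> ennreal \<beta>" "0 \<le> \<beta>"
    and u: "0 < u" "u * L\<^sup>2 * (2 * real l) \<le> 1"
    and y: "0 \<le> y" "real n * (2 * L\<^sup>2 * \<beta>) \<le> y"
  defines "c \<equiv> expectation (\<lambda>\<omega>. \<phi>\<^sub>1 (X a \<omega>) * \<phi>\<^sub>2 (X (a + int d) \<omega>))"
  shows "prob {\<omega>\<in>space M. 3 * y \<le> \<bar>\<Sum>k<n. (\<phi>\<^sub>1 (X (a + int k) \<omega>) * \<phi>\<^sub>2 (X (a + int k + int d) \<omega>) - c)\<bar>}
    \<le> 4 * tail_bound n l L \<beta> u y"
proof -
  let ?E = "{\<omega>\<in>space M. 3 * y \<le> \<bar>\<Sum>k<n. (\<phi>\<^sub>1 (X (a + int k) \<omega>) * \<phi>\<^sub>2 (X (a + int k + int d) \<omega>) - c)\<bar>}"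
  note [measurable] = measurable_compose[OF X_measurable, where g = \<phi>\<^sub>1, simplified]
    measurable_compose[OF X_measurable, where g = \<phi>\<^sub>2, simplified]
  have tb: "0 \<le> tail_bound n l L \<beta> u y" unfolding tail_bound_def using \<beta>(2) u(1) by simp
  have L: "0 \<le> L" using \<phi>(1)[of 0] by linarith
  show ?thesis
  proof (cases "d < l")
    case True
    have "prob ?E \<le> prob {\<omega>\<in>space M. y \<le> \<bar>\<Sum>k<n. (\<phi>\<^sub>1 (X (a + int k) \<omega>) * \<phi>\<^sub>2 (X (a + int k + int d) \<omega>) - c)\<bar>}"
      using y(1) by (intro finite_measure_mono) auto
    also have "\<dots> \<le> 2 * tail_bound n l L \<beta> u y"
      unfolding c_def by (rule short_lag_tail[OF fin \<phi> True \<beta> u])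
    finally show ?thesis using tb by linarith
  next
    case False
    then have d: "l \<le> d" by simp
    define m where "m = expectation (\<lambda>\<omega>. \<phi>\<^sub>2 (X (a + int d) \<omega>))"
    define e where "e = expectation (\<lambda>\<omega>. \<phi>\<^sub>1 (X a \<omega>) * m)"
    have int1: "integrable M (\<lambda>\<omega>. \<phi>\<^sub>1 (X t \<omega>))" for t
      using \<phi>(1) by (intro integrable_const_bound[where B = L]) auto
    have int2: "integrable M (\<lambda>\<omega>. \<phi>\<^sub>2 (X t \<omega>))" for t
      using \<phi>(2) by (intro integrable_const_bound[where B = L]) auto
    have m: "0 \<le> m" "m \<le> L"
      unfolding m_def using \<phi>(2) by (auto intro!: integral_nonneg integral_le_const int2)
    have ec: "\<bar>e - c\<bar> \<le> 2 * L\<^sup>2 * \<beta>"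
    proof -
      have "\<bar>expectation (\<lambda>\<omega>. \<phi>\<^sub>1 (X a \<omega>) * \<phi>\<^sub>2 (X (a + int d) \<omega>))
          - expectation (\<lambda>\<omega>. \<phi>\<^sub>1 (X a \<omega>)) * expectation (\<lambda>\<omega>. \<phi>\<^sub>2 (X (a + int d) \<omega>))\<bar> \<le> 2 * L * L * \<beta>"
      proof (rule beta_mix_covariance_le[OF _ _ _ _ \<beta>, where t = a])
        show "simple_function (sigma_of M X {..a}) (\<lambda>\<omega>. \<phi>\<^sub>1 (X a \<omega>))"
          using fin by (intro simple_function_X) auto
        show "simple_function (sigma_of M X {a + int l..}) (\<lambda>\<omega>. \<phi>\<^sub>2 (X (a + int d) \<omega>))"
          using fin d by (intro simple_function_X) auto
      qed (use \<phi> L in auto)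
      moreover have "expectation (\<lambda>\<omega>. \<phi>\<^sub>1 (X a \<omega>)) * expectation (\<lambda>\<omega>. \<phi>\<^sub>2 (X (a + int d) \<omega>)) = e"
        unfolding e_def m_def[symmetric] by simp
      ultimately show ?thesis unfolding c_def by (simp add: power2_eq_square abs_minus_commute)
    qed
    let ?A = "{\<omega>\<in>space M. y \<le> \<bar>\<Sum>k<n. \<phi>\<^sub>1 (X (a + int k) \<omega>) * (\<phi>\<^sub>2 (X (a + int k + int d) \<omega>) - m)\<bar>}"
    let ?B = "{\<omega>\<in>space M. y \<le> \<bar>\<Sum>k<n. (\<phi>\<^sub>1 (X (a + int k) \<omega>) * m - e)\<bar>}"
    have "?E \<subseteq> ?A \<union> ?B"
    proof
      fix \<omega> assume \<omega>: "\<omega> \<in> ?E"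
      have "(\<Sum>k<n. (\<phi>\<^sub>1 (X (a + int k) \<omega>) * \<phi>\<^sub>2 (X (a + int k + int d) \<omega>) - c))
        = (\<Sum>k<n. \<phi>\<^sub>1 (X (a + int k) \<omega>) * (\<phi>\<^sub>2 (X (a + int k + int d) \<omega>) - m))
          + (\<Sum>k<n. (\<phi>\<^sub>1 (X (a + int k) \<omega>) * m - e)) + (\<Sum>k<n. (e - c))"
        unfolding sum.distrib[symmetric] by (intro sum.cong refl) (simp add: right_diff_distrib)
      moreover have "\<bar>\<Sum>k<n. (e - c)\<bar> \<le> y"
      proof -
        have "\<bar>\<Sum>k<n. (e - c)\<bar> = real n * \<bar>e - c\<bar>" by (simp add: abs_mult)
        also have "\<dots> \<le> real n * (2 * L\<^sup>2 * \<beta>)" using ec by (intro mult_left_mono) auto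
        finally show ?thesis using y(2) by linarith
      qed
      ultimately show "\<omega> \<in> ?A \<union> ?B" using \<omega> y(1) by auto
    qed
    then have "prob ?E \<le> prob (?A \<union> ?B)" by (intro finite_measure_mono) auto
    also have "\<dots> \<le> prob ?A + prob ?B" by (intro measure_Un_le) auto
    also have "\<dots> \<le> 2 * tail_bound n l L \<beta> u y + 2 * tail_bound n l L \<beta> u y"
    proof (rule add_mono)
      show "prob ?A \<le> 2 * tail_bound n l L \<beta> u y"
        unfolding m_def by (rule long_lag_tail[OF fin \<phi> l d \<beta> u])
      have "0 < l" using l by simp
      \<comment> \<open>The remaining one-variable sum is a short-lag sum with lag 0 whose second
        factor is the constant m.\<close>
      from short_lag_tail[OF fin(1) _ \<phi>(1) _ this \<beta> u, where \<phi>\<^sub>2 = "\<lambda>_. m" and a = a and n = n and y = y]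
      show "prob ?B \<le> 2 * tail_bound n l L \<beta> u y"
        unfolding e_def using m by simp
    qed
    finally show ?thesis by simp
  qed
qed

end

section \<open>The score\<close>

context prob_space
begin

text \<open>Integrability is not preserved by products, but variables with all absolute moments form
  an algebra. Membership follows from the shape of an expression, which settles the integrability of
  every polynomial in the process.\<close>

definition all_moments :: "('a \<Rightarrow> real) \<Rightarrow> bool" where
  "all_moments f \<longleftrightarrow> f \<in> borel_measurable M \<and> (\<forall>k::nat. integrable M (\<lambda>\<omega>. \<bar>f \<omega>\<bar> ^ k))"

lemma all_moments_measurable: "all_moments f \<Longrightarrow> f \<in> borel_measurable M"
  by (simp add: all_moments_def)

lemma all_moments_integrable: "all_moments f \<Longrightarrow> integrable M f"
  unfolding all_moments_def
  by (rule integrable_abs_cancel) (auto dest: spec[of _ "1::nat"])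

lemma all_moments_const: "all_moments (\<lambda>_. c)"
  by (simp add: all_moments_def)

lemma all_moments_mult:
  assumes "all_moments f" "all_moments g"
  shows "all_moments (\<lambda>\<omega>. f \<omega> * g \<omega>)"
  unfolding all_moments_def
proof (intro conjI allI)
  have [measurable]: "f \<in> borel_measurable M" "g \<in> borel_measurable M"
    using assms by (auto simp: all_moments_def)
  show "(\<lambda>\<omega>. f \<omega> * g \<omega>) \<in> borel_measurable M" by simp
  fix k :: nat
  show "integrable M (\<lambda>\<omega>. \<bar>f \<omega> * g \<omega>\<bar> ^ k)"
  proof (rule Bochner_Integration.integrable_bound)
    show "integrable M (\<lambda>\<omega>. \<bar>f \<omega>\<bar> ^ (2 * k) + \<bar>g \<omega>\<bar> ^ (2 * k))"
      using assms by (intro Bochner_Integration.integrable_add) (auto simp: all_moments_def)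
    have "x * y \<le> x\<^sup>2 + y\<^sup>2" for x y :: real
      using sum_squares_bound[of x y] zero_le_power2[of x] zero_le_power2[of y] by linarith
    then have "\<bar>f \<omega>\<bar> ^ k * \<bar>g \<omega>\<bar> ^ k \<le> \<bar>f \<omega>\<bar> ^ (2 * k) + \<bar>g \<omega>\<bar> ^ (2 * k)" for \<omega>
      unfolding power_even_eq .
    then show "AE \<omega> in M. norm (\<bar>f \<omega> * g \<omega>\<bar> ^ k) \<le> norm (\<bar>f \<omega>\<bar> ^ (2 * k) + \<bar>g \<omega>\<bar> ^ (2 * k))"
      by (simp add: abs_mult power_mult_distrib)
  qed simp
qed

lemma all_moments_add:
  assumes "all_moments f" "all_moments g"
  shows "all_moments (\<lambda>\<omega>. f \<omega> + g \<omega>)"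
  unfolding all_moments_def
proof (intro conjI allI)
  have [measurable]: "f \<in> borel_measurable M" "g \<in> borel_measurable M"
    using assms by (auto simp: all_moments_def)
  show "(\<lambda>\<omega>. f \<omega> + g \<omega>) \<in> borel_measurable M" by simp
  fix k :: nat
  show "integrable M (\<lambda>\<omega>. \<bar>f \<omega> + g \<omega>\<bar> ^ k)"
  proof (rule Bochner_Integration.integrable_bound)
    show "integrable M (\<lambda>\<omega>. 2 ^ k * (\<bar>f \<omega>\<bar> ^ k + \<bar>g \<omega>\<bar> ^ k))"
      using assms by (intro integrable_mult_right Bochner_Integration.integrable_add) (auto simp: all_moments_def)
    have "\<bar>x + y\<bar> ^ k \<le> 2 ^ k * (\<bar>x\<bar> ^ k + \<bar>y\<bar> ^ k)" for x y :: real
    proof -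
      have "\<bar>x + y\<bar> ^ k \<le> (2 * max \<bar>x\<bar> \<bar>y\<bar>) ^ k" by (intro power_mono) auto
      also have "\<dots> = 2 ^ k * max \<bar>x\<bar> \<bar>y\<bar> ^ k" by (rule power_mult_distrib)
      also have "\<dots> \<le> 2 ^ k * (\<bar>x\<bar> ^ k + \<bar>y\<bar> ^ k)" by (intro mult_left_mono) (auto simp: max_def)
      finally show ?thesis .
    qed
    then show "AE \<omega> in M. norm (\<bar>f \<omega> + g \<omega>\<bar> ^ k) \<le> norm (2 ^ k * (\<bar>f \<omega>\<bar> ^ k + \<bar>g \<omega>\<bar> ^ k))"
      by simp
  qed simp
qed

lemma all_moments_diff:
  assumes "all_moments f" "all_moments g"
  shows "all_moments (\<lambda>\<omega>. f \<omega> - g \<omega>)"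
  using all_moments_add[OF assms(1) all_moments_mult[OF all_moments_const[of "-1"] assms(2)]] by simp

lemma all_moments_sum:
  assumes "\<And>i. i \<in> I \<Longrightarrow> all_moments (f i)"
  shows "all_moments (\<lambda>\<omega>. \<Sum>i\<in>I. f i \<omega>)"
  using assms
  by (induction I rule: infinite_finite_induct) (auto intro: all_moments_const all_moments_add)

lemma expectation_power2_sum_orthogonal:
  fixes Y :: "'i \<Rightarrow> 'a \<Rightarrow> real"
  assumes int: "\<And>i j. i \<in> I \<Longrightarrow> j \<in> I \<Longrightarrow> integrable M (\<lambda>\<omega>. Y i \<omega> * Y j \<omega>)"
    and orth: "\<And>i j. i \<in> I \<Longrightarrow> j \<in> I \<Longrightarrow> i \<noteq> j \<Longrightarrow> expectation (\<lambda>\<omega>. Y i \<omega> * Y j \<omega>) = 0"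
  shows "expectation (\<lambda>\<omega>. (\<Sum>i\<in>I. Y i \<omega>)\<^sup>2) = (\<Sum>i\<in>I. expectation (\<lambda>\<omega>. (Y i \<omega>)\<^sup>2))"
proof (cases "finite I")
  case False
  then show ?thesis by simp
next
  case True
  have "expectation (\<lambda>\<omega>. (\<Sum>i\<in>I. Y i \<omega>)\<^sup>2) = expectation (\<lambda>\<omega>. \<Sum>i\<in>I. \<Sum>j\<in>I. Y i \<omega> * Y j \<omega>)"
    by (simp add: power2_eq_square sum_product)
  also have "\<dots> = (\<Sum>i\<in>I. \<Sum>j\<in>I. expectation (\<lambda>\<omega>. Y i \<omega> * Y j \<omega>))"
    using int by (simp add: Bochner_Integration.integral_sum)
  also have "\<dots> = (\<Sum>i\<in>I. \<Sum>j\<in>I. if j = i then expectation (\<lambda>\<omega>. (Y i \<omega>)\<^sup>2) else 0)"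
    using orth by (intro sum.cong) (auto simp: power2_eq_square)
  also have "\<dots> = (\<Sum>i\<in>I. expectation (\<lambda>\<omega>. (Y i \<omega>)\<^sup>2))" using True by simp
  finally show ?thesis .
qed

text \<open>For an integer-valued variable, independence of an event needs to be known on singletons
  only: the integral is split over the values, and each piece factorises.\<close>

lemma nn_integral_indep_nat:
  fixes R :: "'a \<Rightarrow> nat"
  assumes R: "R \<in> M \<rightarrow>\<^sub>M count_space UNIV" and A[measurable]: "A \<in> events"
    and indep: "\<And>r. prob (A \<inter> {\<omega>\<in>space M. R \<omega> = r}) = prob A * prob {\<omega>\<in>space M. R \<omega> = r}"
  shows "(\<integral>\<^sup>+\<omega>. indicator A \<omega> * g (R \<omega>) \<partial>M) = emeasure M A * (\<integral>\<^sup>+\<omega>. g (R \<omega>) \<partial>M)"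
proof -
  have Rr[measurable]: "{\<omega>\<in>space M. R \<omega> = r} \<in> events" for r
    using measurable_sets[OF R, of "{r}"] by (simp add: vimage_def Int_def conj_commute)
  have "(\<integral>\<^sup>+\<omega>. indicator A \<omega> * g (R \<omega>) \<partial>M)
    = (\<integral>\<^sup>+r. (\<integral>\<^sup>+\<omega>. indicator {\<omega>\<in>space M. R \<omega> = r} \<omega> * (indicator A \<omega> * g r) \<partial>M) \<partial>count_space UNIV)"
    by (rule nn_integral_countable_partition[OF R]) simp
  also have "\<dots> = (\<integral>\<^sup>+r. emeasure M A * (\<integral>\<^sup>+\<omega>. indicator {\<omega>\<in>space M. R \<omega> = r} \<omega> * g r \<partial>M) \<partial>count_space UNIV)"
  proof (rule nn_integral_cong)
    fix r
    have "(\<integral>\<^sup>+\<omega>. indicator {\<omega>\<in>space M. R \<omega> = r} \<omega> * (indicator A \<omega> * g r) \<partial>M)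
        = (\<integral>\<^sup>+\<omega>. g r * indicator (A \<inter> {\<omega>\<in>space M. R \<omega> = r}) \<omega> \<partial>M)"
      by (intro nn_integral_cong) (auto simp: indicator_def)
    also have "\<dots> = g r * emeasure M (A \<inter> {\<omega>\<in>space M. R \<omega> = r})"
      by (rule nn_integral_cmult_indicator) simp
    also have "emeasure M (A \<inter> {\<omega>\<in>space M. R \<omega> = r}) = emeasure M A * emeasure M {\<omega>\<in>space M. R \<omega> = r}"
      using indep[of r] by (simp add: emeasure_eq_measure ennreal_mult)
    also have "g r * (emeasure M A * emeasure M {\<omega>\<in>space M. R \<omega> = r})
        = emeasure M A * (\<integral>\<^sup>+\<omega>. g r * indicator {\<omega>\<in>space M. R \<omega> = r} \<omega> \<partial>M)"
      by (subst nn_integral_cmult_indicator) (simp_all add: mult_ac)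
    finally show "(\<integral>\<^sup>+\<omega>. indicator {\<omega>\<in>space M. R \<omega> = r} \<omega> * (indicator A \<omega> * g r) \<partial>M)
        = emeasure M A * (\<integral>\<^sup>+\<omega>. indicator {\<omega>\<in>space M. R \<omega> = r} \<omega> * g r \<partial>M)"
      by (simp add: mult.commute)
  qed
  also have "\<dots> = emeasure M A * (\<integral>\<^sup>+r. (\<integral>\<^sup>+\<omega>. indicator {\<omega>\<in>space M. R \<omega> = r} \<omega> * g r \<partial>M) \<partial>count_space UNIV)"
    by (rule nn_integral_cmult) simp
  also have "(\<integral>\<^sup>+r. (\<integral>\<^sup>+\<omega>. indicator {\<omega>\<in>space M. R \<omega> = r} \<omega> * g r \<partial>M) \<partial>count_space UNIV) = (\<integral>\<^sup>+\<omega>. g (R \<omega>) \<partial>M)"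
    by (rule nn_integral_countable_partition[OF R, symmetric]) simp
  finally show ?thesis .
qed

end

section \<open>One step of the recursion given the past\<close>

context inar
begin

text \<open>Thinning sums a random number of counting variables. With the lags frozen at x this
  number is fixed, and the innovations that make up the value at time t form a finite family of
  independent variables, all belonging to time t.\<close>

definition innovation_index :: "int \<Rightarrow> nat list \<Rightarrow> ((nat \<times> int \<times> nat) + int) set" where
  "innovation_index t x = (SIGMA i:{1..p}. {t} \<times> {1..x ! (i - 1)}) <+> {t}"

definition innovation_sum :: "int \<Rightarrow> nat list \<Rightarrow> 'a \<Rightarrow> nat" where
  "innovation_sum t x \<omega> = (\<Sum>a\<in>innovation_index t x. innovations \<xi> \<epsilon> a \<omega>)"

lemma finite_innovation_index: "finite (innovation_index t x)"
  unfolding innovation_index_def by auto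

lemma sum_innovation_index:
  "(\<Sum>a\<in>innovation_index t x. f a) = (\<Sum>i=1..p. \<Sum>j=1..x ! (i - 1). f (Inl (i, t, j))) + f (Inr t)"
proof -
  have "(\<Sum>a\<in>innovation_index t x. f a)
      = (\<Sum>a\<in>(SIGMA i:{1..p}. {t} \<times> {1..x ! (i - 1)}). f (Inl a)) + f (Inr t)"
    unfolding innovation_index_def by (subst sum.Plus) (auto simp: o_def)
  also have "(\<Sum>a\<in>(SIGMA i:{1..p}. {t} \<times> {1..x ! (i - 1)}). f (Inl a))
      = (\<Sum>i=1..p. \<Sum>b\<in>{t} \<times> {1..x ! (i - 1)}. f (Inl (i, b)))"
    by (subst sum.Sigma) (auto intro!: sum.cong)
  also have "\<dots> = (\<Sum>i=1..p. \<Sum>j=1..x ! (i - 1). f (Inl (i, t, j)))"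
    by (intro sum.cong refl, rule sum.reindex_bij_witness[of _ "\<lambda>j. (t, j)" snd]) auto
  finally show ?thesis .
qed


abbreviation innovation_set :: "((nat \<times> int \<times> nat) + int) set" where
  "innovation_set \<equiv> ({1..p} \<times> UNIV \<times> {1..}) <+> UNIV"

text \<open>The coefficient belonging to each innovation. It is used twice: v = \<theta> gives the
  means and v = h the variances, and over \<open>innovation_index t x\<close> either one adds up to
  a linear form in the regressor.\<close>

definition innovation_mean :: "(nat \<Rightarrow> real) \<Rightarrow> (nat \<times> int \<times> nat) + int \<Rightarrow> real" where
  "innovation_mean v = case_sum (\<lambda>(i, t, j). v i) (\<lambda>_. v 0)"

lemma innovation_index_subset:
  "innovation_index t x \<subseteq> ({1..p} \<times> {t} \<times> {1..}) <+> {t}" "innovation_index t x \<subseteq> innovation_set"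
  unfolding innovation_index_def by auto

lemma sum_innovation_mean:
  "(\<Sum>a\<in>innovation_index t x. innovation_mean v a) = dotp p v (list_regressor x)"
  unfolding sum_innovation_index dotp_def sum_atMost_split innovation_mean_def
  by (simp add: list_regressor_def mult.commute)

lemma innovations_measurable: "a \<in> innovation_set \<Longrightarrow> innovations \<xi> \<epsilon> a \<in> M \<rightarrow>\<^sub>M count_space UNIV"
  using innov_indep unfolding indep_vars_def by blast

lemma innovations_moments:
  assumes "a \<in> innovation_set"
  shows "integrable M (\<lambda>\<omega>. (real (innovations \<xi> \<epsilon> a \<omega>))\<^sup>2)"
    "expectation (\<lambda>\<omega>. real (innovations \<xi> \<epsilon> a \<omega>)) = innovation_mean \<theta> a"
    "variance (\<lambda>\<omega>. real (innovations \<xi> \<epsilon> a \<omega>)) = innovation_mean h a"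
  using assms xi_square_integrable xi_mean xi_variance eps_square_integrable eps_mean eps_variance
  by (auto simp: innovations_def innovation_mean_def)

lemma innovations_integrable:
  assumes "a \<in> innovation_set"
  shows "integrable M (\<lambda>\<omega>. real (innovations \<xi> \<epsilon> a \<omega>))"
proof (rule square_integrable_imp_integrable)
  show "(\<lambda>\<omega>. real (innovations \<xi> \<epsilon> a \<omega>)) \<in> borel_measurable M"
    by (rule measurable_compose[OF innovations_measurable[OF assms]]) simp
qed (rule innovations_moments[OF assms])

lemma innovation_sum_measurable:
  assumes "\<And>a. a \<in> innovation_index t x \<Longrightarrow> innovations \<xi> \<epsilon> a \<in> N \<rightarrow>\<^sub>M count_space UNIV"
  shows "innovation_sum t x \<in> N \<rightarrow>\<^sub>M count_space UNIV"
proof -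
  obtain xs where xs: "set xs = innovation_index t x" "distinct xs"
    using finite_distinct_list[OF finite_innovation_index] by blast
  have "(\<lambda>\<omega>. map (\<lambda>a. innovations \<xi> \<epsilon> a \<omega>) xs) \<in> N \<rightarrow>\<^sub>M count_space UNIV"
    using assms xs(1) by (intro measurable_map_count_space) auto
  then have "(\<lambda>\<omega>. sum_list (map (\<lambda>a. innovations \<xi> \<epsilon> a \<omega>) xs)) \<in> N \<rightarrow>\<^sub>M count_space UNIV"
    by (rule measurable_compose) simp
  moreover have "innovation_sum t x = (\<lambda>\<omega>. sum_list (map (\<lambda>a. innovations \<xi> \<epsilon> a \<omega>) xs))"
    unfolding innovation_sum_def using xs by (auto simp: sum_list_distinct_conv_sum_set)
  ultimately show ?thesis by simp
qed

text \<open>The sum has finitely many independent terms once the lags are frozen. Means add up, and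
  after centring the mixed products have expectation 0, so variances add up too. These are the
  conditional moments before the observed lags are substituted.\<close>

lemma innovation_sum_moments:
  shows "integrable M (\<lambda>\<omega>. real (innovation_sum t x \<omega>))"
    "expectation (\<lambda>\<omega>. real (innovation_sum t x \<omega>)) = dotp p \<theta> (list_regressor x)"
    "integrable M (\<lambda>\<omega>. (real (innovation_sum t x \<omega>) - dotp p \<theta> (list_regressor x))\<^sup>2)"
    "expectation (\<lambda>\<omega>. (real (innovation_sum t x \<omega>) - dotp p \<theta> (list_regressor x))\<^sup>2) = dotp p h (list_regressor x)"
proof -
  let ?I = "innovation_index t x"
  let ?Z = "\<lambda>a \<omega>. real (innovations \<xi> \<epsilon> a \<omega>)"
  let ?Y = "\<lambda>a \<omega>. ?Z a \<omega> - innovation_mean \<theta> a"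
  have I: "a \<in> innovation_set" if "a \<in> ?I" for a using that innovation_index_subset(2) by blast
  note int = innovations_integrable[OF I] and mom = innovations_moments[OF I]
  have R: "real (innovation_sum t x \<omega>) = (\<Sum>a\<in>?I. ?Z a \<omega>)" for \<omega>
    unfolding innovation_sum_def by simp
  show "integrable M (\<lambda>\<omega>. real (innovation_sum t x \<omega>))"
    unfolding R using int by (intro Bochner_Integration.integrable_sum) auto
  show "expectation (\<lambda>\<omega>. real (innovation_sum t x \<omega>)) = dotp p \<theta> (list_regressor x)"
    unfolding R using int mom(2) by (simp add: Bochner_Integration.integral_sum sum_innovation_mean)
  have centred: "real (innovation_sum t x \<omega>) - dotp p \<theta> (list_regressor x) = (\<Sum>a\<in>?I. ?Y a \<omega>)" for \<omega>
    unfolding R sum_innovation_mean[of \<theta> t, symmetric] by (rule sum_subtractf[symmetric])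
  have intY: "integrable M (?Y a)" if "a \<in> ?I" for a using int[OF that] by simp
  have intY2: "integrable M (\<lambda>\<omega>. (?Y a \<omega>)\<^sup>2)" if "a \<in> ?I" for a
    using int[OF that] mom(1)[OF that] by (simp add: power2_diff)
  have intYY: "integrable M (\<lambda>\<omega>. ?Y a \<omega> * ?Y b \<omega>)" if "a \<in> ?I" "b \<in> ?I" for a b
  proof (rule Bochner_Integration.integrable_bound)
    show "integrable M (\<lambda>\<omega>. (?Y a \<omega>)\<^sup>2 + (?Y b \<omega>)\<^sup>2)" using that intY2 by simp
    show "(\<lambda>\<omega>. ?Y a \<omega> * ?Y b \<omega>) \<in> borel_measurable M"
      using that intY by (intro borel_measurable_times borel_measurable_integrable)
    have "\<bar>y * z\<bar> \<le> \<bar>y\<^sup>2 + z\<^sup>2\<bar>" for y z :: real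
    proof -
      have "0 \<le> \<bar>y\<bar> * \<bar>z\<bar>" by simp
      then have "\<bar>y\<bar> * \<bar>z\<bar> \<le> \<bar>y\<bar>\<^sup>2 + \<bar>z\<bar>\<^sup>2"
        using sum_squares_bound[of "\<bar>y\<bar>" "\<bar>z\<bar>"] by linarith
      then show ?thesis by (simp add: abs_mult)
    qed
    then show "AE \<omega> in M. norm (?Y a \<omega> * ?Y b \<omega>) \<le> norm ((?Y a \<omega>)\<^sup>2 + (?Y b \<omega>)\<^sup>2)" by simp
  qed
  show "integrable M (\<lambda>\<omega>. (real (innovation_sum t x \<omega>) - dotp p \<theta> (list_regressor x))\<^sup>2)"
    unfolding centred power2_eq_square sum_product using intYY
    by (intro Bochner_Integration.integrable_sum) auto
  have "expectation (\<lambda>\<omega>. ?Y a \<omega> * ?Y b \<omega>) = 0" if ab: "a \<in> ?I" "b \<in> ?I" "a \<noteq> b" for a b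
  proof -
    have "indep_vars (\<lambda>_. count_space UNIV) (innovations \<xi> \<epsilon>) {a, b}"
      using I ab by (intro indep_vars_subset[OF innov_indep]) auto
    then have "indep_vars (\<lambda>_. borel) ?Y {a, b}"
      by (rule indep_vars_compose2[where Y = "\<lambda>a z. real z - innovation_mean \<theta> a"]) simp
    then have "expectation (\<lambda>\<omega>. \<Prod>c\<in>{a, b}. ?Y c \<omega>) = (\<Prod>c\<in>{a, b}. expectation (?Y c))"
      using ab by (intro indep_vars_lebesgue_integral intY) auto
    moreover have "expectation (?Y a) = 0" using int[OF ab(1)] mom(2)[OF ab(1)] by (simp add: prob_space)
    ultimately show ?thesis using ab(3) by simp
  qed
  then have "expectation (\<lambda>\<omega>. (\<Sum>a\<in>?I. ?Y a \<omega>)\<^sup>2) = (\<Sum>a\<in>?I. expectation (\<lambda>\<omega>. (?Y a \<omega>)\<^sup>2))"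
    by (intro expectation_power2_sum_orthogonal intYY)
  also have "\<dots> = (\<Sum>a\<in>?I. innovation_mean h a)"
    by (intro sum.cong refl) (use mom(2,3) in simp)
  finally show "expectation (\<lambda>\<omega>. (real (innovation_sum t x \<omega>) - dotp p \<theta> (list_regressor x))\<^sup>2) = dotp p h (list_regressor x)"
    unfolding centred sum_innovation_mean .
qed

lemma recursion_innovation_sum:
  "AE \<omega> in M. X t \<omega> = innovation_sum t (lags p X (t - 1) \<omega>) \<omega>"
proof -
  have nth: "lags p X (t - 1) \<omega> ! (i - 1) = X (t - int i) \<omega>" if "i \<in> {1..p}" for i \<omega>
    using that by (auto simp: lags_def simp del: upt_Suc)
  have "(\<Sum>i=1..p. thinning (\<xi> i t) (X (t - int i)) \<omega>) + \<epsilon> t \<omega> = innovation_sum t (lags p X (t - 1) \<omega>) \<omega>" for \<omega>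
    unfolding innovation_sum_def sum_innovation_index thinning_def
    using nth by (auto simp: innovations_def intro!: sum.cong)
  then show ?thesis using recursion[of t] by simp
qed

text \<open>Given the past, the current value behaves like a fresh copy of the innovation sum with
  the observed lags. Split by the value x of the lags: the event that they equal x belongs to the
  past, and \<open>innovation_sum t x\<close> is a function of the innovations of time t alone, so
  \<open>innov_indep_past\<close> factorises each piece.\<close>

lemma nn_integral_past_innovation:
  fixes g :: "nat list \<Rightarrow> nat \<Rightarrow> ennreal"
  assumes A: "A \<in> sets (sigma_of M X {..t - 1})"
  shows "(\<integral>\<^sup>+\<omega>. indicator A \<omega> * g (lags p X (t - 1) \<omega>) (X t \<omega>) \<partial>M)
    = (\<integral>\<^sup>+\<omega>. indicator A \<omega> * (\<integral>\<^sup>+\<omega>'. g (lags p X (t - 1) \<omega>) (innovation_sum t (lags p X (t - 1) \<omega>) \<omega>') \<partial>M) \<partial>M)"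
proof -
  let ?L = "lags p X (t - 1)" and ?F = "sigma_of M X {..t - 1}"
  let ?B = "\<lambda>x. {\<omega>\<in>space M. ?L \<omega> = x}"
  have L: "?L \<in> M \<rightarrow>\<^sub>M count_space UNIV" by (intro lags_measurable X_measurable)
  have R[measurable]: "innovation_sum t x \<in> M \<rightarrow>\<^sub>M count_space UNIV" for x
    using innovation_index_subset(2) by (intro innovation_sum_measurable innovations_measurable) blast
  have A'[measurable]: "A \<in> events" using A subalgebra_X by (auto simp: subalgebra_def)
  have BF: "?B x \<in> sets ?F" for x
    using measurable_sets[OF lags_sigma_of, of "{x}" t] by (simp add: vimage_def Int_def conj_commute)
  have AB: "A \<inter> ?B x \<in> sets ?F" for x using A BF by auto
  have AB': "A \<inter> ?B x \<in> events" for x using AB[of x] subalgebra_X by (auto simp: subalgebra_def)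
  have past_eq: "{..<t} = {..t - 1}" by auto
  have "(\<integral>\<^sup>+\<omega>. indicator A \<omega> * g (?L \<omega>) (X t \<omega>) \<partial>M)
      = (\<integral>\<^sup>+\<omega>. indicator A \<omega> * g (?L \<omega>) (innovation_sum t (?L \<omega>) \<omega>) \<partial>M)"
    using recursion_innovation_sum[of t] by (intro nn_integral_cong_AE) (auto elim!: eventually_mono)
  also have "\<dots> = (\<integral>\<^sup>+x. (\<integral>\<^sup>+\<omega>. indicator (?B x) \<omega> * (indicator A \<omega> * g x (innovation_sum t x \<omega>)) \<partial>M) \<partial>count_space UNIV)"
    by (rule nn_integral_countable_partition[OF L]) simp
  also have "\<dots> = (\<integral>\<^sup>+x. (\<integral>\<^sup>+\<omega>. indicator (?B x) \<omega> * (indicator A \<omega> * (\<integral>\<^sup>+\<omega>'. g x (innovation_sum t x \<omega>') \<partial>M)) \<partial>M) \<partial>count_space UNIV)"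
  proof (rule nn_integral_cong)
    fix x
    have "(\<integral>\<^sup>+\<omega>. indicator (?B x) \<omega> * (indicator A \<omega> * g x (innovation_sum t x \<omega>)) \<partial>M)
        = (\<integral>\<^sup>+\<omega>. indicator (A \<inter> ?B x) \<omega> * g x (innovation_sum t x \<omega>) \<partial>M)"
      by (intro nn_integral_cong) (auto simp: indicator_def)
    also have "\<dots> = emeasure M (A \<inter> ?B x) * (\<integral>\<^sup>+\<omega>. g x (innovation_sum t x \<omega>) \<partial>M)"
    proof (rule nn_integral_indep_nat[OF R AB'])
      fix r
      let ?G = "sigma_of M (innovations \<xi> \<epsilon>) (({1..p} \<times> {t} \<times> {1..}) <+> {t})"
      have "innovation_sum t x \<in> ?G \<rightarrow>\<^sub>M count_space UNIV"
        using innovation_index_subset(1) by (intro innovation_sum_measurable measurable_sigma_of) blast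
      from measurable_sets[OF this, of "{r}"] have "{\<omega>\<in>space M. innovation_sum t x \<omega> = r} \<in> sets ?G"
        by (simp add: vimage_def Int_def conj_commute)
      from indep_setD[OF innov_indep_past this, of "A \<inter> ?B x"] AB[of x]
      show "prob (A \<inter> ?B x \<inter> {\<omega>\<in>space M. innovation_sum t x \<omega> = r})
          = prob (A \<inter> ?B x) * prob {\<omega>\<in>space M. innovation_sum t x \<omega> = r}"
        unfolding past_eq by (simp add: Int_commute mult.commute)
    qed
    also have "\<dots> = (\<integral>\<^sup>+\<omega>. (\<integral>\<^sup>+\<omega>'. g x (innovation_sum t x \<omega>') \<partial>M) * indicator (A \<inter> ?B x) \<omega> \<partial>M)"
      using AB' by (subst nn_integral_cmult_indicator) (auto simp: mult.commute)
    also have "\<dots> = (\<integral>\<^sup>+\<omega>. indicator (?B x) \<omega> * (indicator A \<omega> * (\<integral>\<^sup>+\<omega>'. g x (innovation_sum t x \<omega>') \<partial>M)) \<partial>M)"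
      by (intro nn_integral_cong) (auto simp: indicator_def)
    finally show "(\<integral>\<^sup>+\<omega>. indicator (?B x) \<omega> * (indicator A \<omega> * g x (innovation_sum t x \<omega>)) \<partial>M)
        = (\<integral>\<^sup>+\<omega>. indicator (?B x) \<omega> * (indicator A \<omega> * (\<integral>\<^sup>+\<omega>'. g x (innovation_sum t x \<omega>') \<partial>M)) \<partial>M)" .
  qed
  also have "\<dots> = (\<integral>\<^sup>+\<omega>. indicator A \<omega> * (\<integral>\<^sup>+\<omega>'. g (?L \<omega>) (innovation_sum t (?L \<omega>) \<omega>') \<partial>M) \<partial>M)"
    by (rule nn_integral_countable_partition[OF L, symmetric]) simp
  finally show ?thesis .
qed

lemma h_nonneg: "i \<le> p \<Longrightarrow> 0 \<le> h i"
proof (cases "i = 0")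
  case True
  have "0 \<le> variance (\<lambda>\<omega>. real (\<epsilon> 0 \<omega>))" by (rule integral_nonneg_AE) simp
  then show ?thesis using True eps_variance[of 0] by simp
next
  case False
  assume "i \<le> p"
  have "i \<in> {1..p}" using False \<open>i \<le> p\<close> by simp
  from xi_variance[OF this order.refl, of 0] show ?thesis
    by (rule subst) (rule integral_nonneg_AE, simp)
qed

text \<open>A nonnegative variable with mean 0 vanishes almost surely. Thus sparsity of \<theta>
  passes to h, and the score bound contains s where p would otherwise appear.\<close>

lemma variance_zero:
  assumes i: "i \<in> {1..p}" and z: "\<theta> i = 0"
  shows "h i = 0"
proof -
  let ?f = "\<lambda>\<omega>. real (\<xi> i 0 1 \<omega>)"
  have I: "Inl (i, 0, 1) \<in> innovation_set" using i by auto
  have int: "integrable M ?f" using innovations_integrable[OF I] by (simp add: innovations_def)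
  have e: "expectation ?f = 0" using xi_mean[OF i, of 1 0] z by simp
  then have "AE \<omega> in M. ?f \<omega> = 0" using integral_nonneg_eq_0_iff_AE[OF int] by simp
  then have "AE \<omega> in M. (?f \<omega> - expectation ?f)\<^sup>2 = 0" unfolding e by (auto elim!: eventually_mono)
  then have "variance ?f = 0" by (rule integral_eq_zero_AE)
  then show ?thesis using xi_variance[OF i, of 1 0] by simp
qed

end

lemma norm_inf_ge: "j \<le> p \<Longrightarrow> \<bar>v j\<bar> \<le> norm_inf p v"
  unfolding norm_inf_def by (rule Max_ge) auto

lemma norm_inf_nonneg: "0 \<le> norm_inf p v"
  using norm_inf_ge[of 0 p v] by (meson abs_ge_zero le0 order.trans)

lemma norm_inf_gt_iff: "x < norm_inf p v \<longleftrightarrow> (\<exists>j\<le>p. x < \<bar>v j\<bar>)"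
  unfolding norm_inf_def by (subst Max_gr_iff) auto

context inar
begin

text \<open>Nonnegativity of g makes it possible to test against past events by nonnegative
  integrals, where the freezing identity holds. The choices r and (r - \<theta>^T y)^2 for g give
  the conditional mean and the conditional variance.\<close>

lemma real_cond_exp_past_innovation:
  fixes g :: "nat list \<Rightarrow> nat \<Rightarrow> real"
  assumes g: "\<And>x r. 0 \<le> g x r"
    and int: "\<And>x. integrable M (\<lambda>\<omega>. g x (innovation_sum t x \<omega>))"
    and m: "\<And>x. expectation (\<lambda>\<omega>. g x (innovation_sum t x \<omega>)) = m x"
    and int_g: "integrable M (\<lambda>\<omega>. g (lags p X (t - 1) \<omega>) (X t \<omega>))"
    and int_m: "integrable M (\<lambda>\<omega>. m (lags p X (t - 1) \<omega>))"
  shows "AE \<omega> in M. real_cond_exp M (sigma_of M X {..t - 1}) (\<lambda>\<omega>. g (lags p X (t - 1) \<omega>) (X t \<omega>)) \<omega>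
    = m (lags p X (t - 1) \<omega>)"
proof -
  interpret F: finite_measure_subalgebra M "sigma_of M X {..t - 1}"
    by (rule finite_measure_subalgebra_X)
  let ?L = "lags p X (t - 1)"
  have m0: "0 \<le> m x" for x unfolding m[symmetric] using g by (intro integral_nonneg_AE) simp
  show ?thesis
  proof (rule F.real_cond_exp_charact[OF _ int_g int_m])
    show "(\<lambda>\<omega>. m (?L \<omega>)) \<in> borel_measurable (sigma_of M X {..t - 1})"
      by (rule measurable_compose[OF lags_sigma_of]) simp
    fix A assume A: "A \<in> sets (sigma_of M X {..t - 1})"
    then have A'[measurable]: "A \<in> events" using subalgebra_X by (auto simp: subalgebra_def)
    have "(\<integral>\<^sup>+\<omega>. ennreal (indicator A \<omega> *\<^sub>R g (?L \<omega>) (X t \<omega>)) \<partial>M)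
        = (\<integral>\<^sup>+\<omega>. indicator A \<omega> * ennreal (g (?L \<omega>) (X t \<omega>)) \<partial>M)"
      by (intro nn_integral_cong) (auto simp: indicator_def)
    also have "\<dots> = (\<integral>\<^sup>+\<omega>. indicator A \<omega> * (\<integral>\<^sup>+\<omega>'. ennreal (g (?L \<omega>) (innovation_sum t (?L \<omega>) \<omega>')) \<partial>M) \<partial>M)"
      by (rule nn_integral_past_innovation[OF A])
    also have "\<dots> = (\<integral>\<^sup>+\<omega>. ennreal (indicator A \<omega> *\<^sub>R m (?L \<omega>)) \<partial>M)"
    proof (rule nn_integral_cong)
      fix \<omega>
      have "(\<integral>\<^sup>+\<omega>'. ennreal (g (?L \<omega>) (innovation_sum t (?L \<omega>) \<omega>')) \<partial>M) = ennreal (m (?L \<omega>))"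
        unfolding m[symmetric] using g int by (intro nn_integral_eq_integral) auto
      then show "indicator A \<omega> * (\<integral>\<^sup>+\<omega>'. ennreal (g (?L \<omega>) (innovation_sum t (?L \<omega>) \<omega>')) \<partial>M)
          = ennreal (indicator A \<omega> *\<^sub>R m (?L \<omega>))"
        by (cases "\<omega> \<in> A") auto
    qed
    finally have eq: "(\<integral>\<^sup>+\<omega>. ennreal (indicator A \<omega> *\<^sub>R g (?L \<omega>) (X t \<omega>)) \<partial>M)
        = (\<integral>\<^sup>+\<omega>. ennreal (indicator A \<omega> *\<^sub>R m (?L \<omega>)) \<partial>M)" .
    show "(\<integral>\<omega>\<in>A. g (?L \<omega>) (X t \<omega>) \<partial>M) = (\<integral>\<omega>\<in>A. m (?L \<omega>) \<partial>M)"
      unfolding set_lebesgue_integral_def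
    proof (subst (1 2) integral_eq_nn_integral)
      show "(\<lambda>\<omega>. indicat_real A \<omega> *\<^sub>R g (?L \<omega>) (X t \<omega>)) \<in> borel_measurable M"
        using borel_measurable_integrable[OF int_g] by simp
      show "(\<lambda>\<omega>. indicat_real A \<omega> *\<^sub>R m (?L \<omega>)) \<in> borel_measurable M"
        using borel_measurable_integrable[OF int_m] by simp
    qed (use g m0 eq in auto)
  qed
qed

definition resid :: "int \<Rightarrow> 'a \<Rightarrow> real" where
  "resid t \<omega> = real (X t \<omega>) - dotp p \<theta> (regressor X (t - 1) \<omega>)"

lemma regressor_past:
  assumes "r < t"
  shows "(\<lambda>\<omega>. regressor X r \<omega> j) \<in> borel_measurable (sigma_of M X {..t - 1})"
proof (cases "j = 0")
  case True
  then show ?thesis by (simp add: regressor_def)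
next
  case False
  then have "X (r + 1 - int j) \<in> sigma_of M X {..t - 1} \<rightarrow>\<^sub>M count_space UNIV"
    using assms by (intro measurable_sigma_of) auto
  then have "(\<lambda>\<omega>. real (X (r + 1 - int j) \<omega>)) \<in> borel_measurable (sigma_of M X {..t - 1})"
    by (rule measurable_compose) simp
  then show ?thesis using False by (simp add: regressor_def)
qed

lemma resid_past:
  assumes "r < t"
  shows "resid r \<in> borel_measurable (sigma_of M X {..t - 1})"
proof -
  have "X r \<in> sigma_of M X {..t - 1} \<rightarrow>\<^sub>M count_space UNIV"
    using assms by (intro measurable_sigma_of) auto
  then have "(\<lambda>\<omega>. real (X r \<omega>)) \<in> borel_measurable (sigma_of M X {..t - 1})"
    by (rule measurable_compose) simp
  moreover have "(\<lambda>\<omega>. dotp p \<theta> (regressor X (r - 1) \<omega>)) \<in> borel_measurable (sigma_of M X {..t - 1})"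
    unfolding dotp_def using assms by (intro borel_measurable_sum borel_measurable_times regressor_past) auto
  ultimately show ?thesis unfolding resid_def[abs_def] by simp
qed

end

section \<open>The score as a martingale sum\<close>

context sub_poissonian_inar
begin

lemma all_moments_X: "all_moments (\<lambda>\<omega>. real (X t \<omega>))"
  unfolding all_moments_def using integrable_X_power by simp

lemma all_moments_regressor: "all_moments (\<lambda>\<omega>. regressor X t \<omega> j)"
  unfolding regressor_def by (cases "j = 0") (auto intro: all_moments_const all_moments_X)

lemma all_moments_dotp: "all_moments (\<lambda>\<omega>. dotp p v (regressor X t \<omega>))"
  unfolding dotp_def by (intro all_moments_sum all_moments_mult all_moments_const all_moments_regressor)

lemma all_moments_resid: "all_moments (resid t)"
  unfolding resid_def[abs_def] by (intro all_moments_diff all_moments_X all_moments_dotp)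

lemma cond_mean:
  "AE \<omega> in M. real_cond_exp M (sigma_of M X {..t - 1}) (\<lambda>\<omega>. real (X t \<omega>)) \<omega> = dotp p \<theta> (regressor X (t - 1) \<omega>)"
  unfolding dotp_regressor_lags
  by (rule real_cond_exp_past_innovation[where g = "\<lambda>x r. real r"])
    (auto simp: innovation_sum_moments dotp_regressor_lags[symmetric]
      intro: all_moments_integrable all_moments_X all_moments_dotp)

lemma cond_variance:
  "AE \<omega> in M. real_cond_exp M (sigma_of M X {..t - 1}) (\<lambda>\<omega>. (resid t \<omega>)\<^sup>2) \<omega> = dotp p h (regressor X (t - 1) \<omega>)"
proof -
  have r: "(\<lambda>\<omega>. (resid t \<omega>)\<^sup>2)
      = (\<lambda>\<omega>. (real (X t \<omega>) - dotp p \<theta> (list_regressor (lags p X (t - 1) \<omega>)))\<^sup>2)"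
    unfolding resid_def dotp_regressor_lags ..
  have i: "integrable M (\<lambda>\<omega>. (resid t \<omega>)\<^sup>2)"
    unfolding power2_eq_square by (intro all_moments_integrable all_moments_mult all_moments_resid)
  show ?thesis
    unfolding r dotp_regressor_lags[of p h]
    by (rule real_cond_exp_past_innovation[where g = "\<lambda>x r. (real r - dotp p \<theta> (list_regressor x))\<^sup>2"])
      (use i in \<open>auto simp: innovation_sum_moments r dotp_regressor_lags[symmetric]
        intro: all_moments_integrable all_moments_dotp\<close>)
qed

lemma expectation_mult_resid:
  assumes G: "all_moments G" "G \<in> borel_measurable (sigma_of M X {..t - 1})"
  shows "expectation (\<lambda>\<omega>. G \<omega> * resid t \<omega>) = 0"
proof -
  interpret F: finite_measure_subalgebra M "sigma_of M X {..t - 1}"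
    by (rule finite_measure_subalgebra_X)
  let ?m = "\<lambda>\<omega>. dotp p \<theta> (regressor X (t - 1) \<omega>)"
  have i1: "integrable M (\<lambda>\<omega>. G \<omega> * real (X t \<omega>))"
    by (intro all_moments_integrable all_moments_mult G all_moments_X)
  have i2: "integrable M (\<lambda>\<omega>. G \<omega> * ?m \<omega>)"
    by (intro all_moments_integrable all_moments_mult G all_moments_dotp)
  have "expectation (\<lambda>\<omega>. G \<omega> * real (X t \<omega>))
      = expectation (\<lambda>\<omega>. G \<omega> * real_cond_exp M (sigma_of M X {..t - 1}) (\<lambda>\<omega>. real (X t \<omega>)) \<omega>)"
    by (rule F.real_cond_exp_intg(2)[OF i1 G(2), symmetric]) simp
  also have "\<dots> = expectation (\<lambda>\<omega>. G \<omega> * ?m \<omega>)"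
    using cond_mean[of t] all_moments_measurable[OF G(1)]
    by (intro integral_cong_AE) (auto elim!: eventually_mono simp: measurable_from_subalg[OF F.subalg])
  finally show ?thesis
    unfolding resid_def right_diff_distrib using i1 i2 by simp
qed

lemma expectation_mult_resid_power2:
  assumes G: "all_moments G" "G \<in> borel_measurable (sigma_of M X {..t - 1})"
  shows "expectation (\<lambda>\<omega>. G \<omega> * (resid t \<omega>)\<^sup>2) = expectation (\<lambda>\<omega>. G \<omega> * dotp p h (regressor X (t - 1) \<omega>))"
proof -
  interpret F: finite_measure_subalgebra M "sigma_of M X {..t - 1}"
    by (rule finite_measure_subalgebra_X)
  have i1: "integrable M (\<lambda>\<omega>. G \<omega> * (resid t \<omega>)\<^sup>2)"
    unfolding power2_eq_square by (intro all_moments_integrable all_moments_mult G all_moments_resid)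
  have meas: "(\<lambda>\<omega>. (resid t \<omega>)\<^sup>2) \<in> borel_measurable M"
    using all_moments_measurable[OF all_moments_resid[of t]] by simp
  have "expectation (\<lambda>\<omega>. G \<omega> * (resid t \<omega>)\<^sup>2)
      = expectation (\<lambda>\<omega>. G \<omega> * real_cond_exp M (sigma_of M X {..t - 1}) (\<lambda>\<omega>. (resid t \<omega>)\<^sup>2) \<omega>)"
    by (rule F.real_cond_exp_intg(2)[OF i1 G(2) meas, symmetric])
  also have "\<dots> = expectation (\<lambda>\<omega>. G \<omega> * dotp p h (regressor X (t - 1) \<omega>))"
    using cond_variance[of t] all_moments_measurable[OF G(1)]
    by (intro integral_cong_AE) (auto elim!: eventually_mono simp: measurable_from_subalg[OF F.subalg])
  finally show ?thesis .
qed

lemma expectation_regressor_cube: "expectation (\<lambda>\<omega>. regressor X t \<omega> j ^ 3) \<le> 27 * K_X p \<theta> ^ 3"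
proof (cases "j = 0")
  case True
  have "(1 / 2) ^ 3 \<le> K_X p \<theta> ^ 3" using K_X_ge_half by (intro power_mono) auto
  then show ?thesis using True by (simp add: regressor_def prob_space power3_eq_cube)
next
  case False
  then show ?thesis
    using expectation_X_power_le[of 3 "t + 1 - int j"] by (simp add: regressor_def power_mult_distrib)
qed

text \<open>The mixed products are reduced to third moments by y^2 z \<le> y^3 + z^3. Each cube has
  mean at most (3 K)^3 = 27 K^3, which makes 54. Only indices below s contribute, since h vanishes
  with \<theta> beyond them.\<close>

lemma expectation_weighted_variance_le:
  assumes s: "1 \<le> s" "\<And>i. i \<le> p \<Longrightarrow> s \<le> i \<Longrightarrow> \<theta> i = 0"
  shows "expectation (\<lambda>\<omega>. (regressor X t \<omega> j)\<^sup>2 * dotp p h (regressor X t \<omega>)) \<le> real s * norm_inf p h * 54 * K_X p \<theta> ^ 3"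
proof -
  let ?Y = "regressor X t" and ?B = "54 * K_X p \<theta> ^ 3"
  have int: "integrable M (\<lambda>\<omega>. (?Y \<omega> j)\<^sup>2 * ?Y \<omega> i)" for i
    unfolding power2_eq_square by (intro all_moments_integrable all_moments_mult all_moments_regressor)
  have int3: "integrable M (\<lambda>\<omega>. ?Y \<omega> i ^ 3)" for i
    unfolding power3_eq_cube by (intro all_moments_integrable all_moments_mult all_moments_regressor)
  have young: "y\<^sup>2 * z \<le> y ^ 3 + z ^ 3" if "0 \<le> y" "0 \<le> z" for y z :: real
  proof (cases "y \<le> z")
    case True
    then have "y\<^sup>2 * z \<le> z\<^sup>2 * z" using that by (intro mult_right_mono power_mono) auto
    then show ?thesis using that by (simp add: power2_eq_square power3_eq_cube add_increasing)
  next
    case False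
    then have "y\<^sup>2 * z \<le> y\<^sup>2 * y" using that by (intro mult_left_mono) auto
    then show ?thesis using that by (simp add: power2_eq_square power3_eq_cube add_increasing2)
  qed
  have term_le: "expectation (\<lambda>\<omega>. (?Y \<omega> j)\<^sup>2 * ?Y \<omega> i) \<le> ?B" for i
  proof -
    have "expectation (\<lambda>\<omega>. (?Y \<omega> j)\<^sup>2 * ?Y \<omega> i) \<le> expectation (\<lambda>\<omega>. ?Y \<omega> j ^ 3 + ?Y \<omega> i ^ 3)"
      by (intro integral_mono int Bochner_Integration.integrable_add int3 young regressor_nonneg)
    also have "\<dots> = expectation (\<lambda>\<omega>. ?Y \<omega> j ^ 3) + expectation (\<lambda>\<omega>. ?Y \<omega> i ^ 3)"
      by (intro Bochner_Integration.integral_add int3)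
    finally show ?thesis using expectation_regressor_cube[of t j] expectation_regressor_cube[of t i] by linarith
  qed
  have K0: "0 \<le> ?B" using K_X_ge_half by simp
  have "expectation (\<lambda>\<omega>. (?Y \<omega> j)\<^sup>2 * dotp p h (?Y \<omega>)) = expectation (\<lambda>\<omega>. \<Sum>i\<le>p. h i * ((?Y \<omega> j)\<^sup>2 * ?Y \<omega> i))"
    unfolding dotp_def sum_distrib_left by (simp add: mult_ac)
  also have "\<dots> = (\<Sum>i\<le>p. h i * expectation (\<lambda>\<omega>. (?Y \<omega> j)\<^sup>2 * ?Y \<omega> i))"
    using int by (simp add: Bochner_Integration.integral_sum)
  also have "\<dots> \<le> (\<Sum>i\<le>p. if i < s then norm_inf p h * ?B else 0)"
  proof (intro sum_mono)
    fix i assume i: "i \<in> {..p}"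
    show "h i * expectation (\<lambda>\<omega>. (?Y \<omega> j)\<^sup>2 * ?Y \<omega> i) \<le> (if i < s then norm_inf p h * ?B else 0)"
    proof (cases "i < s")
      case True
      have "h i * expectation (\<lambda>\<omega>. (?Y \<omega> j)\<^sup>2 * ?Y \<omega> i) \<le> h i * ?B"
        using i h_nonneg by (intro mult_left_mono term_le) auto
      also have "\<dots> \<le> norm_inf p h * ?B"
        using norm_inf_ge[of i p h] i K0 by (intro mult_right_mono) auto
      finally show ?thesis using True by simp
    next
      case False
      then have "h i = 0" using i s by (intro variance_zero) auto
      then show ?thesis using False by simp
    qed
  qed
  also have "\<dots> = real (card ({..p} \<inter> {i. i < s})) * (norm_inf p h * ?B)"
    by (simp add: sum.If_cases)
  also have "\<dots> \<le> real s * (norm_inf p h * ?B)"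
  proof (intro mult_right_mono)
    have "card ({..p} \<inter> {i. i < s}) \<le> card {..<s}" by (intro card_mono) auto
    then show "real (card ({..p} \<inter> {i. i < s})) \<le> real s" by simp
    show "0 \<le> norm_inf p h * ?B" by (rule mult_nonneg_nonneg[OF norm_inf_nonneg K0])
  qed
  finally show ?thesis by (simp add: mult_ac)
qed

lemma expectation_psi1_power2:
  assumes s: "1 \<le> s" "\<And>i. i \<le> p \<Longrightarrow> s \<le> i \<Longrightarrow> \<theta> i = 0" and n: "1 \<le> n"
  shows "integrable M (\<lambda>\<omega>. (psi1 p n X \<theta> \<omega> j)\<^sup>2)"
    "expectation (\<lambda>\<omega>. (psi1 p n X \<theta> \<omega> j)\<^sup>2) \<le> real s * norm_inf p h * 54 * K_X p \<theta> ^ 3 / real n"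
proof -
  let ?W = "\<lambda>t::nat. \<lambda>\<omega>. regressor X (int t - 1) \<omega> j * resid (int t) \<omega>"
  let ?B = "real s * norm_inf p h * 54 * K_X p \<theta> ^ 3"
  have psi: "psi1 p n X \<theta> \<omega> j = 1 / real n * (\<Sum>t=1..n. ?W t \<omega>)" for \<omega>
    unfolding psi1_def resid_def ..
  have mW: "all_moments (?W t)" for t
    by (intro all_moments_mult all_moments_regressor all_moments_resid)
  have "all_moments (\<lambda>\<omega>. psi1 p n X \<theta> \<omega> j)"
    unfolding psi by (intro all_moments_mult all_moments_const all_moments_sum mW)
  then show "integrable M (\<lambda>\<omega>. (psi1 p n X \<theta> \<omega> j)\<^sup>2)"
    unfolding power2_eq_square by (intro all_moments_integrable all_moments_mult)
  have orth: "expectation (\<lambda>\<omega>. ?W r \<omega> * ?W t \<omega>) = 0" if "r < t" for r t :: nat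
  proof -
    \<comment> \<open>For r < t everything except the residual of time t is determined before t, so
      this residual averages out.\<close>
    have "expectation (\<lambda>\<omega>. (?W r \<omega> * regressor X (int t - 1) \<omega> j) * resid (int t) \<omega>) = 0"
      using that
      by (intro expectation_mult_resid all_moments_mult mW all_moments_regressor borel_measurable_times
          regressor_past resid_past) auto
    then show ?thesis by (simp only: mult.assoc)
  qed
  have "expectation (\<lambda>\<omega>. (\<Sum>t=1..n. ?W t \<omega>)\<^sup>2) = (\<Sum>t=1..n. expectation (\<lambda>\<omega>. (?W t \<omega>)\<^sup>2))"
  proof (rule expectation_power2_sum_orthogonal)
    show "integrable M (\<lambda>\<omega>. ?W r \<omega> * ?W t \<omega>)" for r t
      by (intro all_moments_integrable all_moments_mult[OF mW mW])
    fix r t :: nat assume "r \<noteq> t"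
    then consider "r < t" | "t < r" by linarith
    then show "expectation (\<lambda>\<omega>. ?W r \<omega> * ?W t \<omega>) = 0"
    proof cases
      case 1
      then show ?thesis by (rule orth)
    next
      case 2
      from orth[OF 2] show ?thesis by (simp only: mult.commute[of "?W r \<omega>" "?W t \<omega>" for \<omega>])
    qed
  qed
  also have "\<dots> \<le> (\<Sum>t=1..n. ?B)"
  proof (rule sum_mono)
    fix t
    have "expectation (\<lambda>\<omega>. (?W t \<omega>)\<^sup>2) = expectation (\<lambda>\<omega>. (regressor X (int t - 1) \<omega> j)\<^sup>2 * (resid (int t) \<omega>)\<^sup>2)"
      by (simp only: power_mult_distrib)
    also have "\<dots> = expectation (\<lambda>\<omega>. (regressor X (int t - 1) \<omega> j)\<^sup>2 * dotp p h (regressor X (int t - 1) \<omega>))"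
      unfolding power2_eq_square[of "regressor X (int t - 1) \<omega> j" for \<omega>]
      by (intro expectation_mult_resid_power2 all_moments_mult all_moments_regressor borel_measurable_times regressor_past) auto
    also have "\<dots> \<le> ?B" by (rule expectation_weighted_variance_le[OF s])
    finally show "expectation (\<lambda>\<omega>. (?W t \<omega>)\<^sup>2) \<le> ?B" .
  qed
  finally have main: "expectation (\<lambda>\<omega>. (\<Sum>t=1..n. ?W t \<omega>)\<^sup>2) \<le> real n * ?B" by simp
  have "expectation (\<lambda>\<omega>. (psi1 p n X \<theta> \<omega> j)\<^sup>2) = (1 / real n)\<^sup>2 * expectation (\<lambda>\<omega>. (\<Sum>t=1..n. ?W t \<omega>)\<^sup>2)"
    unfolding psi power_mult_distrib by simp
  also have "\<dots> \<le> (1 / real n)\<^sup>2 * (real n * ?B)" by (intro mult_left_mono main) simp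
  also have "\<dots> = ?B / real n" using n by (simp add: power2_eq_square)
  finally show "expectation (\<lambda>\<omega>. (psi1 p n X \<theta> \<omega> j)\<^sup>2) \<le> ?B / real n" .
qed

lemma psi1_tail_power2:
  assumes s: "1 \<le> s" "\<And>i. i \<le> p \<Longrightarrow> s \<le> i \<Longrightarrow> \<theta> i = 0" and n: "1 \<le> n" and lam: "0 < lam"
  shows "prob {\<omega>\<in>space M. lam < norm_inf p (psi1 p n X \<theta> \<omega>)}
    \<le> (real p + 1) * (real s * norm_inf p h * 54 * K_X p \<theta> ^ 3 / real n) / lam\<^sup>2"
proof -
  let ?B = "real s * norm_inf p h * 54 * K_X p \<theta> ^ 3 / real n"
  have meas[measurable]: "(\<lambda>\<omega>. psi1 p n X \<theta> \<omega> j) \<in> borel_measurable M" for j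
    unfolding psi1_def by measurable
  have one: "prob {\<omega>\<in>space M. lam < \<bar>psi1 p n X \<theta> \<omega> j\<bar>} \<le> ?B / lam\<^sup>2" for j
  proof -
    have "prob {\<omega>\<in>space M. lam < \<bar>psi1 p n X \<theta> \<omega> j\<bar>} \<le> prob {\<omega>\<in>space M. lam\<^sup>2 \<le> (psi1 p n X \<theta> \<omega> j)\<^sup>2}"
      using lam by (intro finite_measure_mono) (auto simp: abs_le_square_iff[symmetric])
    also have "\<dots> \<le> expectation (\<lambda>\<omega>. (psi1 p n X \<theta> \<omega> j)\<^sup>2) / lam\<^sup>2"
      using lam by (intro integral_Markov_inequality_measure[where A = "space M"] expectation_psi1_power2(1)[OF s n]) auto
    also have "\<dots> \<le> ?B / lam\<^sup>2"
      using lam by (intro divide_right_mono expectation_psi1_power2(2)[OF s n]) auto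
    finally show ?thesis .
  qed
  have "{\<omega>\<in>space M. lam < norm_inf p (psi1 p n X \<theta> \<omega>)} = (\<Union>j\<in>{..p}. {\<omega>\<in>space M. lam < \<bar>psi1 p n X \<theta> \<omega> j\<bar>})"
    by (auto simp: norm_inf_gt_iff)
  also have "prob \<dots> \<le> (\<Sum>j\<in>{..p}. prob {\<omega>\<in>space M. lam < \<bar>psi1 p n X \<theta> \<omega> j\<bar>})"
    by (intro finite_measure_subadditive_finite) auto
  also have "\<dots> \<le> (\<Sum>j\<in>{..p}. ?B / lam\<^sup>2)" by (intro sum_mono one)
  also have "\<dots> = (real p + 1) * ?B / lam\<^sup>2" by simp
  finally show ?thesis .
qed

lemma psi1_tail:
  assumes s: "1 \<le> s" "\<And>i. i \<le> p \<Longrightarrow> s \<le> i \<Longrightarrow> \<theta> i = 0" and n: "1 \<le> n" and lam: "0 < lam" and p: "1 \<le> p"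
  shows "prob {\<omega>\<in>space M. lam < norm_inf p (psi1 p n X \<theta> \<omega>)}
    \<le> 12 * sqrt 6 * norm_inf p h powr (1/2) * K_X p \<theta> powr (3/2) / lam
        * sqrt (real p * real s * ln (1 + real p) / real n)" (is "?P \<le> ?R")
proof -
  let ?H = "norm_inf p h" and ?K = "K_X p \<theta>"
  have K: "0 < ?K" using K_X_ge_half by linarith
  have H: "0 \<le> ?H" by (rule norm_inf_nonneg)
  have ln_half: "1 / 2 \<le> ln (1 + real p)"
  proof -
    have "1 / 2 \<le> 2 * real p / (2 + real p)" using p by (simp add: field_simps)
    also have "\<dots> \<le> ln (1 + real p)" by (rule two_mult_divide_le_ln) simp
    finally show ?thesis .
  qed
  have R0: "0 \<le> ?R" using lam ln_half by simp
  have "(?H powr (1/2))\<^sup>2 = ?H"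
    using H by (simp add: powr_half_sqrt)
  moreover have "(?K powr (3/2))\<^sup>2 = ?K ^ 3"
    using K by (simp add: power2_eq_square powr_add[symmetric] flip: powr_numeral)
  moreover have "(sqrt (real p * real s * ln (1 + real p) / real n))\<^sup>2 = real p * real s * ln (1 + real p) / real n"
    using ln_half by simp
  ultimately have R2: "?R\<^sup>2 = 864 * ?H * ?K ^ 3 / lam\<^sup>2 * (real p * real s * ln (1 + real p) / real n)"
    unfolding power_mult_distrib power_divide by simp
  have "?P \<le> (real p + 1) * (real s * ?H * 54 * ?K ^ 3 / real n) / lam\<^sup>2"
    by (rule psi1_tail_power2[OF s n lam])
  also have "\<dots> = 54 * (real p + 1) * (real s * ?H * ?K ^ 3 / real n / lam\<^sup>2)" by simp
  also have "\<dots> \<le> (864 * real p * ln (1 + real p)) * (real s * ?H * ?K ^ 3 / real n / lam\<^sup>2)"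
  proof (intro mult_right_mono)
    \<comment> \<open>The number 864 is the square of 12 sqrt 6, the constant of the claimed bound.
      For p \<ge> 1 the logarithm is at least 1/2 and p + 1 is at most 2 p, which leaves ample
      room.\<close>
    have "54 * (real p + 1) \<le> 864 * real p * (1 / 2)" using p by simp
    also have "\<dots> \<le> 864 * real p * ln (1 + real p)" using ln_half by (intro mult_left_mono) auto
    finally show "54 * (real p + 1) \<le> 864 * real p * ln (1 + real p)" .
  qed (use H K in simp)
  also have "\<dots> = ?R\<^sup>2" unfolding R2 by (simp add: mult_ac)
  finally have P2: "?P \<le> ?R\<^sup>2" .
  show ?thesis
  proof (cases "?R \<le> 1")
    case True
    have "?R\<^sup>2 \<le> ?R * 1" unfolding power2_eq_square using True R0 by (intro mult_left_mono)
    then show ?thesis using P2 by linarith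
  next
    case False
    then show ?thesis using prob_le_1[of "{\<omega>\<in>space M. lam < norm_inf p (psi1 p n X \<theta> \<omega>)}"] by linarith
  qed
qed

end

section \<open>The cone and the Gram matrix\<close>

lemma norm1_on_le_two:
  assumes "v \<in> sparse_cone p T" "T \<subseteq> {..p}"
  shows "(\<Sum>j\<le>p. \<bar>v j\<bar>) \<le> 2 * norm1_on T v"
proof -
  have "(\<Sum>j\<le>p. \<bar>v j\<bar>) = norm1_on ({..p} - T) v + norm1_on T v"
    unfolding norm1_on_def using assms(2) by (intro sum.subset_diff) auto
  then show ?thesis using assms(1) by (simp add: sparse_cone_def)
qed

lemma norm1_on_unit_sphere_le:
  assumes "v \<in> unit_sphere p" "T \<subseteq> {..p}"
  shows "norm1_on T v \<le> sqrt (real (card T))"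
proof -
  have "(\<Sum>j\<in>T. \<bar>v j\<bar>\<^sup>2) \<le> (\<Sum>j\<le>p. \<bar>v j\<bar>\<^sup>2)"
    using assms(2) by (intro sum_mono2) auto
  also have "\<dots> = 1"
    using assms(1) by (simp add: unit_sphere_def dotp_def power2_eq_square)
  finally have "(\<Sum>j\<in>T. \<bar>v j\<bar>\<^sup>2) * real (card T) \<le> 1 * real (card T)"
    by (rule mult_right_mono) simp
  then have "(norm1_on T v)\<^sup>2 \<le> real (card T)"
    unfolding norm1_on_def using sum_squared_le_sum_of_squares[of "\<lambda>j. \<bar>v j\<bar>" T] by linarith
  then show ?thesis by (rule real_le_rsqrt)
qed

lemma quad_form_cong:
  assumes "\<And>j k. j \<le> p \<Longrightarrow> k \<le> p \<Longrightarrow> A j k = B j k"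
  shows "quad_form p A v = quad_form p B v"
  unfolding quad_form_def using assms by (intro sum.cong) auto

lemma F_inf_cong:
  assumes "\<And>j k. j \<le> p \<Longrightarrow> k \<le> p \<Longrightarrow> A j k = B j k"
  shows "F_inf p T A = F_inf p T B"
  unfolding F_inf_def by (subst quad_form_cong[OF assms]) auto

text \<open>On the cone, \<open>\<parallel>v\<parallel>\<^sub>1\<^sup>2 \<le> 4 \<parallel>v\<^bsub>T\<^esub>\<parallel>\<^sub>1\<^sup>2 \<le> 4 |T| \<parallel>v\<^bsub>T\<^esub>\<parallel>\<^sub>1 \<parallel>v\<parallel>\<^sub>\<infinity>\<close>. The sum \<open>A + B\<close> occurs because
  \<open>V1\<close> estimates minus \<open>Vmat\<close>.\<close>

lemma F_inf_perturbation:
  assumes T: "T \<subseteq> {..p}" "T \<noteq> {}"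
    and close: "\<And>j k. j \<le> p \<Longrightarrow> k \<le> p \<Longrightarrow> \<bar>A j k + B j k\<bar> \<le> \<delta>"
  shows "F_inf p T B - 4 * real (card T) * \<delta> \<le> F_inf p T A"
proof -
  let ?R = "\<lambda>A v. \<bar>quad_form p A v\<bar> / (norm1_on T v * norm_inf p v)"
  have \<delta>: "0 \<le> \<delta>" using close[of 0 0] by (meson abs_ge_zero le0 order.trans)
  obtain j0 where j0: "j0 \<in> T" using T(2) by blast
  have ne: "sparse_cone p T - {\<lambda>_. 0} \<noteq> {}"
  proof -
    \<comment> \<open>A unit vector supported in T shows that the infimum is taken over a nonempty
      set, so that it can be bounded from below termwise.\<close>
    let ?v = "\<lambda>j. if j = j0 then 1 else 0 :: real"
    have "norm1_on ({..p} - T) ?v = 0" unfolding norm1_on_def using j0 by (intro sum.neutral) auto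
    moreover have "0 \<le> norm1_on T ?v" unfolding norm1_on_def by (intro sum_nonneg) auto
    moreover have "?v \<noteq> (\<lambda>_. 0)" by (auto simp: fun_eq_iff)
    ultimately have "?v \<in> sparse_cone p T - {\<lambda>_. 0}"
      using j0 T(1) by (auto simp: sparse_cone_def Rvec_def)
    then show ?thesis by blast
  qed
  \<comment> \<open>A nonzero vector of the cone cannot vanish on T, because its part on T dominates
    the rest. All quotients in the infimum therefore have positive denominators.\<close>
  have pos: "0 < norm1_on T v \<and> 0 < norm_inf p v" if v: "v \<in> sparse_cone p T - {\<lambda>_. 0}" for v
  proof -
    from v obtain j where j: "v j \<noteq> 0" by (auto simp: fun_eq_iff)
    with v have jp: "j \<le> p" unfolding sparse_cone_def Rvec_def by (auto simp: not_le[symmetric])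
    have "0 < \<bar>v j\<bar>" using j by simp
    also have "\<bar>v j\<bar> \<le> (\<Sum>j\<le>p. \<bar>v j\<bar>)" using jp by (intro member_le_sum) auto
    also have "\<dots> \<le> 2 * norm1_on T v" using v T(1) by (intro norm1_on_le_two) auto
    finally have "0 < norm1_on T v" by simp
    moreover have "0 < norm_inf p v" using norm_inf_ge[OF jp, of v] j by linarith
    ultimately show ?thesis by blast
  qed
  have bdd: "bdd_below (?R B ` (sparse_cone p T - {\<lambda>_. 0}))"
    by (rule bdd_belowI2[of _ 0]) (use pos in \<open>force intro: divide_nonneg_pos\<close>)
  show ?thesis
    unfolding F_inf_def[of p T A]
  proof (rule cINF_greatest[OF ne])
    fix v assume v: "v \<in> sparse_cone p T - {\<lambda>_. 0}"
    let ?N = "norm1_on T v" and ?m = "norm_inf p v"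
    have N: "0 < ?N" and m: "0 < ?m" using pos[OF v] by auto
    have sum0: "0 \<le> (\<Sum>j\<le>p. \<bar>v j\<bar>)" by (intro sum_nonneg) auto
    have "quad_form p A v + quad_form p B v = (\<Sum>j\<le>p. \<Sum>k\<le>p. v j * (A j k + B j k) * v k)"
      unfolding quad_form_def sum.distrib[symmetric] by (simp add: algebra_simps)
    also have "\<bar>\<dots>\<bar> \<le> (\<Sum>j\<le>p. \<Sum>k\<le>p. \<delta> * (\<bar>v j\<bar> * \<bar>v k\<bar>))"
    proof (intro order.trans[OF sum_abs] sum_mono)
      fix j k assume "j \<in> {..p}" "k \<in> {..p}"
      then have "\<bar>A j k + B j k\<bar> * (\<bar>v j\<bar> * \<bar>v k\<bar>) \<le> \<delta> * (\<bar>v j\<bar> * \<bar>v k\<bar>)"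
        by (intro mult_right_mono close) auto
      then show "\<bar>v j * (A j k + B j k) * v k\<bar> \<le> \<delta> * (\<bar>v j\<bar> * \<bar>v k\<bar>)"
        by (simp add: abs_mult mult_ac)
    qed
    also have "\<dots> = \<delta> * ((\<Sum>j\<le>p. \<bar>v j\<bar>) * (\<Sum>j\<le>p. \<bar>v j\<bar>))"
      by (subst sum_product) (simp only: sum_distrib_left)
    also have "\<dots> \<le> \<delta> * ((2 * ?N) * (2 * ?N))"
      using v T(1) \<delta> sum0 N by (intro mult_left_mono mult_mono norm1_on_le_two) auto
    also have "\<dots> \<le> \<delta> * ((2 * ?N) * (2 * (real (card T) * ?m)))"
    proof -
      have "?N \<le> real (card T) * ?m"
        unfolding norm1_on_def using T(1) by (intro sum_bounded_above norm_inf_ge) auto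
      then show ?thesis using \<delta> N by (intro mult_left_mono) auto
    qed
    also have "\<dots> = 4 * real (card T) * \<delta> * (?N * ?m)" by simp
    finally have "\<bar>quad_form p B v\<bar> - 4 * real (card T) * \<delta> * (?N * ?m) \<le> \<bar>quad_form p A v\<bar>" by linarith
    then have "(\<bar>quad_form p B v\<bar> - 4 * real (card T) * \<delta> * (?N * ?m)) / (?N * ?m) \<le> ?R A v"
      using N m by (intro divide_right_mono) auto
    then have "?R B v - 4 * real (card T) * \<delta> \<le> ?R A v"
      using N m by (simp add: diff_divide_distrib)
    moreover have "F_inf p T B \<le> ?R B v"
      unfolding F_inf_def by (rule cINF_lower[OF bdd v])
    ultimately show "F_inf p T B - 4 * real (card T) * \<delta> \<le> ?R A v" by linarith
  qed
qed

section \<open>Truncated entries of the Gram matrix\<close>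

definition component :: "nat \<Rightarrow> nat \<Rightarrow> real" where
  "component j x = (if j = 0 then 1 else real x)"

text \<open>Every coordinate, the constant one included, becomes a fixed function of a single lagged
  value. Entries of the Gram matrix then all have the two-factor form required by
  \<open>pair_tail\<close>.\<close>

lemma regressor_component: "regressor X (t - 1) \<omega> j = component j (X (t - int j) \<omega>)"
  by (simp add: regressor_def component_def)

lemma component_nonneg: "0 \<le> component j x"
  by (simp add: component_def)

lemma finite_range_truncated_component: "finite (range (\<lambda>x. min (component j x) (real N)))"
proof (rule finite_subset)
  show "range (\<lambda>x. min (component j x) (real N)) \<subseteq> insert (min 1 (real N)) (real ` {..N})"
    by (auto simp: component_def min_def)
qed simp

text \<open>If the truncation changes anything, the larger of the two numbers is at least N, so x y
  N^r is at most its power r + 2. The exponent r is free, which lets high moments turn a small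
  truncation level into any polynomial rate.\<close>

lemma truncation_error_le:
  fixes x y N :: real
  assumes "0 \<le> x" "0 \<le> y" "1 \<le> N"
  shows "0 \<le> x * y - min x N * min y N"
    "x * y - min x N * min y N \<le> (x ^ (r + 2) + y ^ (r + 2)) / N ^ r"
proof -
  show "0 \<le> x * y - min x N * min y N"
    using assms by (simp add: mult_mono)
  have big: "a * b \<le> (a ^ (r + 2) + b ^ (r + 2)) / N ^ r" if "0 \<le> b" "b \<le> a" "N \<le> a" for a b
  proof -
    have N: "0 < N ^ r" using assms by simp
    have "a * b * N ^ r \<le> a * a * a ^ r"
      using that assms by (intro mult_mono power_mono) auto
    also have "\<dots> \<le> a ^ (r + 2) + b ^ (r + 2)" using that by (simp add: power_add power2_eq_square)
    finally show ?thesis using N by (simp add: le_divide_eq)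
  qed
  show "x * y - min x N * min y N \<le> (x ^ (r + 2) + y ^ (r + 2)) / N ^ r"
  proof (cases "x \<le> N \<and> y \<le> N")
    case True
    then show ?thesis using assms by simp
  next
    case False
    have "x * y \<le> (x ^ (r + 2) + y ^ (r + 2)) / N ^ r"
    proof (cases "y \<le> x")
      case True
      then show ?thesis using big[of y x] False assms by auto
    next
      case y: False
      then show ?thesis using big[of x y] False assms by (auto simp: mult.commute add.commute)
    qed
    moreover have "0 \<le> min x N * min y N" using assms by simp
    ultimately show ?thesis by linarith
  qed
qed

context sub_poissonian_inar
begin

text \<open>The summand 1 in 1 + \<open>K_X\<close> accounts for the constant coordinate, since
  \<open>q * K_X\<close> alone may be below 1.\<close>

lemma nn_integral_regressor_powr_le:
  assumes q: "1 \<le> q"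
  shows "(\<integral>\<^sup>+\<omega>. ennreal (regressor X t \<omega> j powr q) \<partial>M) \<le> ennreal ((q * (1 + K_X p \<theta>)) powr q)"
proof (cases "j = 0")
  case True
  have "1 \<le> q * (1 + K_X p \<theta>)" using mult_mono[OF q, of 1 "1 + K_X p \<theta>"] K_X_ge_half q by simp
  then have "1 \<le> (q * (1 + K_X p \<theta>)) powr q" using q by (intro ge_one_powr_ge_zero) auto
  then show ?thesis using True by (simp add: regressor_def emeasure_space_1)
next
  case False
  then have "(\<integral>\<^sup>+\<omega>. ennreal (regressor X t \<omega> j powr q) \<partial>M) \<le> ennreal ((q * K_X p \<theta>) powr q)"
    using moment_le[OF q] by (simp add: regressor_def)
  also have "\<dots> \<le> ennreal ((q * (1 + K_X p \<theta>)) powr q)"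
    using q K_X_ge_half by (intro ennreal_leI powr_mono2 mult_left_mono) auto
  finally show ?thesis .
qed

lemma Lq_norm_dotp_le:
  assumes v: "v \<in> sparse_cone p T" "v \<in> unit_sphere p" and T: "T \<subseteq> {..p}" and q: "1 \<le> q"
  shows "Lq_norm M q (\<lambda>\<omega>. dotp p v (regressor X t \<omega>)) / ennreal q \<le> ennreal (2 * sqrt (real (card T)) * (1 + K_X p \<theta>))"
proof -
  let ?K = "1 + K_X p \<theta>" and ?C = "2 * sqrt (real (card T)) * (1 + K_X p \<theta>)"
  have K: "0 < ?K" using K_X_ge_half by linarith
  have C0: "0 \<le> ?C" using K by simp
  have "Lq_norm M q (\<lambda>\<omega>. dotp p v (regressor X t \<omega>)) \<le> ennreal (q * ?C)"
  proof (rule Lq_norm_leI)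
    show "0 < q" "0 \<le> q * ?C" using q C0 by auto
    have "(\<integral>\<^sup>+\<omega>. ennreal (\<bar>dotp p v (regressor X t \<omega>)\<bar> powr q) \<partial>M)
        \<le> (\<integral>\<^sup>+\<omega>. ennreal ((\<Sum>j\<le>p. \<bar>v j\<bar> * regressor X t \<omega> j) powr q) \<partial>M)"
    proof (intro nn_integral_mono ennreal_leI powr_mono2)
      fix \<omega>
      have "\<bar>dotp p v (regressor X t \<omega>)\<bar> \<le> (\<Sum>j\<le>p. \<bar>v j * regressor X t \<omega> j\<bar>)"
        unfolding dotp_def by (rule sum_abs)
      also have "\<dots> = (\<Sum>j\<le>p. \<bar>v j\<bar> * regressor X t \<omega> j)"
        by (simp only: abs_mult abs_of_nonneg[OF regressor_nonneg])
      finally show "\<bar>dotp p v (regressor X t \<omega>)\<bar> \<le> (\<Sum>j\<le>p. \<bar>v j\<bar> * regressor X t \<omega> j)" .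
    qed (use q in auto)
    also have "\<dots> \<le> ennreal ((\<Sum>j\<le>p. \<bar>v j\<bar> * (q * ?K)) powr q)"
      using q K by (intro nn_integral_powr_sum_le nn_integral_regressor_powr_le regressor_nonneg) auto
    also have "\<dots> \<le> ennreal ((q * ?C) powr q)"
    proof (intro ennreal_leI powr_mono2)
      have "(\<Sum>j\<le>p. \<bar>v j\<bar>) \<le> 2 * sqrt (real (card T))"
        using norm1_on_le_two[OF v(1) T] norm1_on_unit_sphere_le[OF v(2) T] by linarith
      then have "(\<Sum>j\<le>p. \<bar>v j\<bar>) * (q * ?K) \<le> 2 * sqrt (real (card T)) * (q * ?K)"
        using q K by (intro mult_right_mono) auto
      then show "(\<Sum>j\<le>p. \<bar>v j\<bar> * (q * ?K)) \<le> q * ?C"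
        unfolding sum_distrib_right[symmetric] by (simp add: mult_ac)
    qed (use q K in \<open>auto intro!: sum_nonneg mult_nonneg_nonneg\<close>)
    finally show "(\<integral>\<^sup>+\<omega>. ennreal (\<bar>dotp p v (regressor X t \<omega>)\<bar> powr q) \<partial>M) \<le> ennreal ((q * ?C) powr q)" .
  qed
  then have "Lq_norm M q (\<lambda>\<omega>. dotp p v (regressor X t \<omega>)) / ennreal q \<le> ennreal (q * ?C) / ennreal q"
    by (rule divide_right_mono_ennreal)
  also have "\<dots> = ennreal ?C" using q C0 by (subst divide_ennreal) auto
  finally show ?thesis .
qed

end

lemma sets_Collect_count_space:
  "Z \<in> M \<rightarrow>\<^sub>M count_space UNIV \<Longrightarrow> {\<omega>\<in>space M. P (Z \<omega>)} \<in> sets M"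
  using measurable_sets[of Z M "count_space UNIV" "{z. P z}"]
  by (simp add: vimage_def Int_def conj_commute)

context sub_poissonian_inar
begin

lemma all_moments_component: "all_moments (\<lambda>\<omega>. component j (X t \<omega>))"
  unfolding component_def by (cases "j = 0") (auto intro: all_moments_const all_moments_X)

text \<open>From m = 2 on, \<open>m * K_X\<close> is at least 1, so the moment bound for X also
  holds for the constant coordinate.\<close>

lemma component_power:
  assumes "2 \<le> m"
  shows "integrable M (\<lambda>\<omega>. component j (X t \<omega>) ^ m)"
    "expectation (\<lambda>\<omega>. component j (X t \<omega>) ^ m) \<le> (real m * K_X p \<theta>) ^ m"
proof -
  show "integrable M (\<lambda>\<omega>. component j (X t \<omega>) ^ m)"
    using integrable_X_power by (cases "j = 0") (auto simp: component_def)
  have "real 2 * (1 / 2) \<le> real m * K_X p \<theta>"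
    using assms K_X_ge_half by (intro mult_mono) auto
  then have "1 \<le> (real m * K_X p \<theta>) ^ m" by (intro one_le_power) simp
  then show "expectation (\<lambda>\<omega>. component j (X t \<omega>) ^ m) \<le> (real m * K_X p \<theta>) ^ m"
    using expectation_X_power_le[of m t] assms by (cases "j = 0") (auto simp: component_def prob_space)
qed

text \<open>With k \<le> j the factor of coordinate j is the earlier one; the first product starts
  at time 1 - j and the lag is j - k. The deviation \<delta> is split into three equal parts: the
  fluctuation of the truncated sum (again three times n \<delta> / 9, for \<open>pair_tail\<close>),
  the truncation error of the data, treated by Markov's inequality, and the truncation error of the
  mean, which is deterministic.\<close>

lemma V1_entry_tail_ordered:
  assumes kj: "k \<le> j" and n: "1 \<le> n" and N: "1 \<le> N" and l: "1 \<le> l"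
    and \<beta>: "beta_mix M X l \<le> ennreal \<beta>" "0 \<le> \<beta>"
    and u: "0 < u" "u * (real N)\<^sup>2 * (2 * real l) \<le> 1"
    and \<delta>: "0 < \<delta>" "2 * (real N)\<^sup>2 * \<beta> \<le> \<delta> / 9"
  shows "prob {\<omega>\<in>space M. \<delta> < \<bar>V1 n X \<omega> j k + Vmat M X j k\<bar>}
    \<le> 4 * tail_bound n l N \<beta> u (real n * \<delta> / 9) + 6 * (real (r + 2) * K_X p \<theta>) ^ (r + 2) / (real N ^ r * \<delta>)"
proof -
  define a where "a = 1 - int j"
  define d where "d = j - k"
  let ?f = "\<lambda>x. min (component j x) (real N)" and ?g = "\<lambda>x. min (component k x) (real N)"
  let ?Y = "\<lambda>i::nat. \<lambda>\<omega>. component j (X (a + int i) \<omega>) * component k (X (a + int i + int d) \<omega>)"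
  let ?Z = "\<lambda>i::nat. \<lambda>\<omega>. ?f (X (a + int i) \<omega>) * ?g (X (a + int i + int d) \<omega>)"
  define c where "c = expectation (\<lambda>\<omega>. ?f (X a \<omega>) * ?g (X (a + int d) \<omega>))"
  define \<epsilon> where "\<epsilon> = 2 * (real (r + 2) * K_X p \<theta>) ^ (r + 2) / real N ^ r"
  let ?V = "Vmat M X j k"
  let ?P = "prob {\<omega>\<in>space M. \<delta> < \<bar>V1 n X \<omega> j k + Vmat M X j k\<bar>}"
  have N1: "1 \<le> real N" using N by simp
  note [measurable] = measurable_compose[OF X_measurable, where g = "component i" for i, simplified]
  have V1_eq: "V1 n X \<omega> j k = - (1 / real n * (\<Sum>i<n. ?Y i \<omega>))" for \<omega>
  proof -
    have "(\<Sum>t=1..n. regressor X (int t - 1) \<omega> j * regressor X (int t - 1) \<omega> k) = (\<Sum>i<n. ?Y i \<omega>)"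
      unfolding One_nat_def sum.atLeast1_atMost_eq regressor_component a_def d_def
      using kj by (intro sum.cong refl) (simp add: of_nat_diff algebra_simps)
    then show ?thesis unfolding V1_def by simp
  qed
  have V_eq: "?V = expectation (?Y 0)"
    unfolding Vmat_def using regressor_component[of X 1] kj by (simp add: a_def d_def of_nat_diff algebra_simps)
  have intY: "integrable M (?Y i)" for i
    by (intro all_moments_integrable all_moments_mult all_moments_component)
  have intZ: "integrable M (?Z i)" for i
  proof (rule Bochner_Integration.integrable_bound[OF intY[of i]])
    show "AE \<omega> in M. norm (?Z i \<omega>) \<le> norm (?Y i \<omega>)"
      using component_nonneg by (auto simp: abs_mult intro!: mult_mono)
  qed measurable
  have err0: "0 \<le> ?Y i \<omega> - ?Z i \<omega>" for i \<omega>
    by (intro truncation_error_le component_nonneg N1)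
  have m: "2 \<le> r + 2" by simp
  have err: "expectation (\<lambda>\<omega>. ?Y i \<omega> - ?Z i \<omega>) \<le> \<epsilon>" for i
  proof -
    let ?U = "\<lambda>\<omega>. (component j (X (a + int i) \<omega>) ^ (r + 2) + component k (X (a + int i + int d) \<omega>) ^ (r + 2)) / real N ^ r"
    have iU: "integrable M ?U"
      by (intro integrable_divide Bochner_Integration.integrable_add component_power m)
    have "expectation (\<lambda>\<omega>. ?Y i \<omega> - ?Z i \<omega>) \<le> expectation ?U"
      by (intro integral_mono iU Bochner_Integration.integrable_diff intY intZ
          truncation_error_le component_nonneg N1)
    also have "\<dots> = (expectation (\<lambda>\<omega>. component j (X (a + int i) \<omega>) ^ (r + 2))
        + expectation (\<lambda>\<omega>. component k (X (a + int i + int d) \<omega>) ^ (r + 2))) / real N ^ r"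
      by (subst Bochner_Integration.integral_add[OF component_power(1)[OF m] component_power(1)[OF m], symmetric])
        (rule integral_divide_zero)
    also have "\<dots> \<le> ((real (r + 2) * K_X p \<theta>) ^ (r + 2) + (real (r + 2) * K_X p \<theta>) ^ (r + 2)) / real N ^ r"
      by (intro divide_right_mono add_mono component_power m) simp
    finally show ?thesis unfolding \<epsilon>_def mult_2 .
  qed
  have Vc: "\<bar>?V - c\<bar> \<le> \<epsilon>"
  proof -
    have "?V - c = expectation (\<lambda>\<omega>. ?Y 0 \<omega> - ?Z 0 \<omega>)"
      unfolding V_eq c_def using intY[of 0] intZ[of 0] by (subst Bochner_Integration.integral_diff) auto
    moreover have "0 \<le> expectation (\<lambda>\<omega>. ?Y 0 \<omega> - ?Z 0 \<omega>)" by (intro integral_nonneg_AE AE_I2 err0)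
    ultimately show ?thesis using err[of 0] by simp
  qed
  have tb: "0 \<le> tail_bound n l N \<beta> u (real n * \<delta> / 9)" unfolding tail_bound_def using \<beta>(2) u(1) by simp
  have eps: "6 * (real (r + 2) * K_X p \<theta>) ^ (r + 2) / (real N ^ r * \<delta>) = 3 * \<epsilon> / \<delta>"
    unfolding \<epsilon>_def by simp
  show ?thesis
    unfolding eps
  proof (cases "\<delta> < 3 * \<epsilon>")
    case True
    \<comment> \<open>If the truncation bias may exceed its share \<delta> / 3, the claimed bound is
      larger than 1 and holds trivially.\<close>
    then have "1 \<le> 3 * \<epsilon> / \<delta>" using \<delta>(1) by simp
    then show "?P \<le> 4 * tail_bound n l N \<beta> u (real n * \<delta> / 9) + 3 * \<epsilon> / \<delta>"
      using tb prob_le_1[of "{\<omega>\<in>space M. \<delta> < \<bar>V1 n X \<omega> j k + Vmat M X j k\<bar>}"] by linarith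
  next
    case False
    let ?A = "{\<omega>\<in>space M. 3 * (real n * \<delta> / 9) \<le> \<bar>\<Sum>i<n. (?Z i \<omega> - c)\<bar>}"
    let ?B = "{\<omega>\<in>space M. real n * \<delta> / 3 \<le> (\<Sum>i<n. (?Y i \<omega> - ?Z i \<omega>))}"
    have nd: "0 < real n * \<delta> / 3" using n \<delta>(1) by simp
    have "{\<omega>\<in>space M. \<delta> < \<bar>V1 n X \<omega> j k + Vmat M X j k\<bar>} \<subseteq> ?A \<union> ?B"
    proof safe
      fix \<omega> assume \<omega>: "\<omega> \<in> space M" and dev: "\<delta> < \<bar>V1 n X \<omega> j k + Vmat M X j k\<bar>"
        and nB: "\<not> real n * \<delta> / 3 \<le> (\<Sum>i<n. (?Y i \<omega> - ?Z i \<omega>))"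
      have "(\<Sum>i<n. ?Y i \<omega>) - real n * ?V = (\<Sum>i<n. (?Z i \<omega> - c)) + (\<Sum>i<n. (?Y i \<omega> - ?Z i \<omega>)) - real n * (?V - c)"
        by (simp add: sum_subtractf algebra_simps)
      moreover have "real n * \<delta> < \<bar>(\<Sum>i<n. ?Y i \<omega>) - real n * ?V\<bar>"
      proof -
        have "(\<Sum>i<n. ?Y i \<omega>) - real n * ?V = - (real n * (V1 n X \<omega> j k + ?V))"
          unfolding V1_eq using n by (simp add: algebra_simps)
        then have "\<bar>(\<Sum>i<n. ?Y i \<omega>) - real n * ?V\<bar> = real n * \<bar>V1 n X \<omega> j k + ?V\<bar>"
          by (simp only: abs_minus_cancel abs_mult abs_of_nat)
        then show ?thesis using dev n by simp
      qed
      moreover have "\<bar>real n * (?V - c)\<bar> \<le> real n * \<delta> / 3"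
      proof -
        have "\<bar>real n * (?V - c)\<bar> \<le> real n * \<epsilon>" using Vc by (simp add: abs_mult mult_left_mono)
        also have "\<dots> \<le> real n * (\<delta> / 3)" using False by (intro mult_left_mono) auto
        finally show ?thesis by simp
      qed
      moreover have "0 \<le> (\<Sum>i<n. (?Y i \<omega> - ?Z i \<omega>))" by (intro sum_nonneg err0)
      ultimately show "3 * (real n * \<delta> / 9) \<le> \<bar>\<Sum>i<n. (?Z i \<omega> - c)\<bar>" using nB by linarith
    qed
    moreover have AB: "?A \<in> events" "?B \<in> events" by measurable
    ultimately have "?P \<le> prob (?A \<union> ?B)"
      by (intro finite_measure_mono sets.Un)
    moreover have "prob (?A \<union> ?B) \<le> prob ?A + prob ?B" by (rule measure_Un_le[OF AB])
    ultimately have PAB: "?P \<le> prob ?A + prob ?B" by linarith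
    have PA: "prob ?A \<le> 4 * tail_bound n l N \<beta> u (real n * \<delta> / 9)"
      unfolding c_def
    proof (rule pair_tail[where \<phi>\<^sub>1 = ?f and \<phi>\<^sub>2 = ?g and a = a and d = d and n = n, OF _ _ _ _ l \<beta> u])
      show "finite (range ?f)" "finite (range ?g)" by (rule finite_range_truncated_component)+
      show "0 \<le> ?f x \<and> ?f x \<le> real N" "0 \<le> ?g x \<and> ?g x \<le> real N" for x
        using component_nonneg by auto
      show "0 \<le> real n * \<delta> / 9" using \<delta> by simp
      show "real n * (2 * (real N)\<^sup>2 * \<beta>) \<le> real n * \<delta> / 9"
        using mult_left_mono[OF \<delta>(2), of "real n"] by simp
    qed
    have PB: "prob ?B \<le> 3 * \<epsilon> / \<delta>"
    proof -
      have "prob ?B \<le> expectation (\<lambda>\<omega>. \<Sum>i<n. (?Y i \<omega> - ?Z i \<omega>)) / (real n * \<delta> / 3)"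
        by (intro integral_Markov_inequality_measure[where A = "space M"] Bochner_Integration.integrable_sum
            Bochner_Integration.integrable_diff intY intZ nd) (auto intro!: sum_nonneg err0)
      also have "\<dots> = (\<Sum>i<n. expectation (\<lambda>\<omega>. ?Y i \<omega> - ?Z i \<omega>)) / (real n * \<delta> / 3)"
        by (intro arg_cong2[where f = "(/)"] refl Bochner_Integration.integral_sum
            Bochner_Integration.integrable_diff intY intZ)
      also have "\<dots> \<le> (\<Sum>i<n. \<epsilon>) / (real n * \<delta> / 3)"
        using nd by (intro divide_right_mono sum_mono err) auto
      also have "\<dots> = 3 * \<epsilon> / \<delta>" using n by simp
      finally show ?thesis .
    qed
    show "?P \<le> 4 * tail_bound n l N \<beta> u (real n * \<delta> / 9) + 3 * \<epsilon> / \<delta>"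
      using PAB PA PB by linarith
  qed
qed

lemma V1_entry_tail:
  assumes "1 \<le> n" "1 \<le> N" "1 \<le> l" "beta_mix M X l \<le> ennreal \<beta>" "0 \<le> \<beta>"
    "0 < u" "u * (real N)\<^sup>2 * (2 * real l) \<le> 1" "0 < \<delta>" "2 * (real N)\<^sup>2 * \<beta> \<le> \<delta> / 9"
  shows "prob {\<omega>\<in>space M. \<delta> < \<bar>V1 n X \<omega> j k + Vmat M X j k\<bar>}
    \<le> 4 * tail_bound n l N \<beta> u (real n * \<delta> / 9) + 6 * (real (r + 2) * K_X p \<theta>) ^ (r + 2) / (real N ^ r * \<delta>)"
proof (cases "k \<le> j")
  case True
  then show ?thesis by (intro V1_entry_tail_ordered assms)
next
  case False
  have "V1 n X \<omega> j k = V1 n X \<omega> k j" "Vmat M X j k = Vmat M X k j" for \<omega>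
    unfolding V1_def Vmat_def by (simp_all add: mult.commute)
  then show ?thesis using V1_entry_tail_ordered[OF _ assms, of j k r] False by simp
qed

lemma V1_borel [measurable]: "(\<lambda>\<omega>. V1 n X \<omega> j k) \<in> borel_measurable M"
  unfolding V1_def by measurable

text \<open>The infimum runs over an uncountable cone, so measurability is not inherited from the
  individual quotients. But the value depends on \<omega> only through finitely many integer lags,
  collected in a list of lists of countable type, and every set of such lists is measurable.\<close>

lemma F_inf_V1_event:
  "{\<omega>\<in>space M. x < F_inf p T (V1 n X \<omega>)} \<in> events"
proof -
  let ?L = "\<lambda>\<omega>. map (\<lambda>t. lags p X (int t - 1) \<omega>) [1..<Suc n]"
  let ?G = "\<lambda>L j k. - (1 / real n * (\<Sum>t=1..n. list_regressor (L ! (t - 1)) j * list_regressor (L ! (t - 1)) k))"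
  have eq: "F_inf p T (V1 n X \<omega>) = F_inf p T (?G (?L \<omega>))" for \<omega>
  proof (rule F_inf_cong)
    fix j k assume jk: "j \<le> p" "k \<le> p"
    have "(\<Sum>t=1..n. regressor X (int t - 1) \<omega> j * regressor X (int t - 1) \<omega> k)
        = (\<Sum>t=1..n. list_regressor (?L \<omega> ! (t - 1)) j * list_regressor (?L \<omega> ! (t - 1)) k)"
    proof (rule sum.cong[OF refl])
      fix t assume "t \<in> {1..n}"
      then have "t - 1 < length [1..<Suc n]" "[1..<Suc n] ! (t - 1) = t"
        by (auto simp: nth_upt simp del: upt_Suc)
      then have e: "?L \<omega> ! (t - 1) = lags p X (int t - 1) \<omega>" by (simp only: nth_map)
      show "regressor X (int t - 1) \<omega> j * regressor X (int t - 1) \<omega> k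
          = list_regressor (?L \<omega> ! (t - 1)) j * list_regressor (?L \<omega> ! (t - 1)) k"
        unfolding e regressor_lags[OF jk(1)] regressor_lags[OF jk(2)] ..
    qed
    then show "V1 n X \<omega> j k = ?G (?L \<omega>) j k" unfolding V1_def by (simp only:)
  qed
  have "?L \<in> M \<rightarrow>\<^sub>M count_space UNIV"
    by (intro measurable_map_count_space lags_measurable X_measurable)
  then show ?thesis unfolding eq by (rule sets_Collect_count_space[where P = "\<lambda>L. x < F_inf p T (?G L)"])
qed

lemma F_inf_V1_tail:
  assumes asm: "1 \<le> n" "1 \<le> N" "1 \<le> l" "beta_mix M X l \<le> ennreal \<beta>" "0 \<le> \<beta>"
    "0 < u" "u * (real N)\<^sup>2 * (2 * real l) \<le> 1" "0 < \<delta>" "2 * (real N)\<^sup>2 * \<beta> \<le> \<delta> / 9"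
    and T: "T \<subseteq> {..p}" "T \<noteq> {}" and f: "f < F_inf p T (Vmat M X) - 4 * real (card T) * \<delta>"
  shows "1 - (real p + 1)\<^sup>2 * (4 * tail_bound n l N \<beta> u (real n * \<delta> / 9)
      + 6 * (real (r + 2) * K_X p \<theta>) ^ (r + 2) / (real N ^ r * \<delta>))
    \<le> prob {\<omega>\<in>space M. f < F_inf p T (V1 n X \<omega>)}" (is "1 - (real p + 1)\<^sup>2 * ?B \<le> prob ?E")
proof -
  have E: "?E \<in> events" by (rule F_inf_V1_event)
  let ?U = "\<Union>(j, k)\<in>{..p} \<times> {..p}. {\<omega>\<in>space M. \<delta> < \<bar>V1 n X \<omega> j k + Vmat M X j k\<bar>}"
  have "space M - ?E \<subseteq> ?U"
  proof
    fix \<omega> assume \<omega>: "\<omega> \<in> space M - ?E"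
    show "\<omega> \<in> ?U"
    proof (rule ccontr)
      assume "\<omega> \<notin> ?U"
      then have "\<And>j k. j \<le> p \<Longrightarrow> k \<le> p \<Longrightarrow> \<bar>V1 n X \<omega> j k + Vmat M X j k\<bar> \<le> \<delta>"
        using \<omega> by (auto simp: not_less)
      then have "F_inf p T (Vmat M X) - 4 * real (card T) * \<delta> \<le> F_inf p T (V1 n X \<omega>)"
        by (intro F_inf_perturbation[OF T])
      then show False using f \<omega> by auto
    qed
  qed
  then have "prob (space M - ?E) \<le> prob ?U"
    by (intro finite_measure_mono) auto
  also have "\<dots> \<le> (\<Sum>(j, k)\<in>{..p} \<times> {..p}. prob {\<omega>\<in>space M. \<delta> < \<bar>V1 n X \<omega> j k + Vmat M X j k\<bar>})"
    unfolding case_prod_unfold by (intro finite_measure_subadditive_finite) auto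
  also have "\<dots> \<le> (\<Sum>(j, k)\<in>{..p} \<times> {..p}. ?B)"
    unfolding case_prod_unfold by (intro sum_mono V1_entry_tail asm)
  also have "\<dots> = (real p + 1)\<^sup>2 * ?B" by (simp add: power2_eq_square algebra_simps)
  finally have "prob (space M - ?E) \<le> (real p + 1)\<^sup>2 * ?B" .
  then show ?thesis using prob_compl[OF E] by linarith
qed

end

section \<open>Rates\<close>

lemma eventually_powr_le:
  assumes "a < 0" "0 < (c::real)"
  shows "eventually (\<lambda>n::nat. b * real n powr a \<le> c) sequentially"
proof -
  have "(\<lambda>n::nat. b * real n powr a) \<longlonglongrightarrow> b * 0"
    using assms(1) by (intro tendsto_mult tendsto_const tendsto_neg_powr filterlim_real_sequentially)
  then show ?thesis
    using assms(2) by (auto dest!: order_tendstoD(2)[where a = c] elim!: eventually_mono)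
qed

text \<open>Half of the decaying exponent absorbs the power of n, the other half the growing
  exponent, which is of lower order.\<close>

lemma eventually_powr_exp_le:
  fixes A b B c p1 p2 :: real
  assumes "0 < p1" "p1 < p2" "0 < c" "0 < K"
  shows "eventually (\<lambda>n::nat. A * real n powr b * exp (B * real n powr p1 - c * real n powr p2) \<le> K) sequentially"
proof -
  have "(\<lambda>n::nat. real n powr b * exp (B * real n powr p1 - c * real n powr p2)) \<longlonglongrightarrow> 0"
  proof -
    have 1: "((\<lambda>x::real. x powr b * exp (- (c / 2) * x powr p2)) \<longlongrightarrow> 0) at_top"
      using assms by real_asymp
    have 2: "((\<lambda>x::real. exp (B * x powr p1 - c / 2 * x powr p2)) \<longlongrightarrow> 0) at_top"
      using assms by real_asymp
    have "((\<lambda>x::real. (x powr b * exp (- (c / 2) * x powr p2)) * exp (B * x powr p1 - c / 2 * x powr p2)) \<longlongrightarrow> 0 * 0) at_top"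
      by (intro tendsto_mult 1 2)
    moreover have "(\<lambda>x::real. (x powr b * exp (- (c / 2) * x powr p2)) * exp (B * x powr p1 - c / 2 * x powr p2))
        = (\<lambda>x. x powr b * exp (B * x powr p1 - c * x powr p2))"
    proof
      fix x :: real
      have "exp (- (c / 2) * x powr p2) * exp (B * x powr p1 - c / 2 * x powr p2)
          = exp (B * x powr p1 - c * x powr p2)"
        unfolding exp_add[symmetric] by (simp add: field_simps)
      then show "(x powr b * exp (- (c / 2) * x powr p2)) * exp (B * x powr p1 - c / 2 * x powr p2)
          = x powr b * exp (B * x powr p1 - c * x powr p2)"
        by (simp only: mult.assoc)
    qed
    ultimately have "((\<lambda>x::real. x powr b * exp (B * x powr p1 - c * x powr p2)) \<longlongrightarrow> 0) at_top"
      by (simp only: mult_zero_left)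
    from filterlim_compose[OF this filterlim_real_sequentially] show ?thesis .
  qed
  then have "(\<lambda>n::nat. A * (real n powr b * exp (B * real n powr p1 - c * real n powr p2))) \<longlonglongrightarrow> A * 0"
    by (intro tendsto_mult tendsto_const)
  then show ?thesis
    using assms(4) by (auto dest!: order_tendstoD(2)[where a = K] elim!: eventually_mono simp: mult.assoc)
qed

lemma nat_ceiling_powr_bounds:
  assumes "1 \<le> n" "0 \<le> (e::real)"
  shows "real n powr e \<le> real (nat \<lceil>real n powr e\<rceil>)" "real (nat \<lceil>real n powr e\<rceil>) \<le> 2 * real n powr e"
    "1 \<le> nat \<lceil>real n powr e\<rceil>"
proof -
  have "1 \<le> real n powr e" using assms by (intro ge_one_powr_ge_zero) auto
  then show "real n powr e \<le> real (nat \<lceil>real n powr e\<rceil>)" "real (nat \<lceil>real n powr e\<rceil>) \<le> 2 * real n powr e"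
    "1 \<le> nat \<lceil>real n powr e\<rceil>"
    by linarith+
qed

text \<open>Truncation at \<open>n\<^sup>e\<close>, mixing gap \<open>n\<^sup>\<kappa>\<close>, entrywise precision \<open>\<delta> = \<eta> / (4 s)\<close> and \<open>u\<close> chosen
  such that \<open>u n \<delta> / 9 = n\<^sup>e\<close>.\<close>

lemma eventually_rate_conditions:
  fixes e \<kappa> \<zeta> C a c \<eta> \<gamma>1 :: real and s N l :: "nat \<Rightarrow> nat" and \<delta> \<beta> u :: "nat \<Rightarrow> real"
  assumes e: "0 < e" and \<zeta>: "0 \<le> \<zeta>" and \<kappa>: "0 < \<kappa>" "\<kappa> + 6 * e + 2 * \<zeta> < 1" "3 * e + \<zeta> < \<kappa> * \<gamma>1" and \<gamma>1: "0 < \<gamma>1"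
    and pos: "0 < C" "0 < a" "0 < c" "0 < \<eta>"
    and s: "eventually (\<lambda>n. real (s n) \<le> C * real n powr \<zeta>) sequentially" "\<forall>n\<ge>1. 1 \<le> s n"
  defines "N \<equiv> (\<lambda>n. nat \<lceil>real n powr e\<rceil>)" and "l \<equiv> (\<lambda>n. nat \<lceil>real n powr \<kappa>\<rceil>)"
    and "\<delta> \<equiv> (\<lambda>n. \<eta> / (4 * real (s n)))" and "\<beta> \<equiv> (\<lambda>n. a * real (s n) * exp (- c * real (l n) powr \<gamma>1))"
    and "u \<equiv> (\<lambda>n. real n powr e / (real n * (\<delta> n / 9)))"
  shows "eventually (\<lambda>n. u n * (real (N n))\<^sup>2 * (2 * real (l n)) \<le> 1 \<and>
    6 * real (l n) * real n * (u n * (real (N n))\<^sup>2)\<^sup>2 \<le> 1 \<and>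
    2 * (real (N n))\<^sup>2 * \<beta> n \<le> \<delta> n / 9 \<and>
    real n * u n * (2 * exp (u n * (real n * (real (N n))\<^sup>2)) * (real (N n))\<^sup>2 * \<beta> n) \<le> 1 \<and>
    9 * (\<eta> / (36 * C)) * real n powr (- \<zeta>) \<le> \<delta> n) sequentially"
proof -
  \<comment> \<open>The largest constant with \<delta> / 9 \<ge> c1 n^(-\<zeta>) that follows from s
    \<le> C n^\<zeta>.\<close>
  define c1 where "c1 = \<eta> / (36 * C)"
  have c1: "0 < c1" using pos by (simp add: c1_def)
  \<comment> \<open>The four bounds \<open>h1\<close> to \<open>h4\<close> are the first four
    conditions after inserting N^2 \<le> 4 n^(2 e), l \<le> 2 n^\<kappa>, s \<le> C n^\<zeta> and u
    \<le> n^(e + \<zeta> - 1) / c1, together with n^\<kappa> \<le> l in the mixing exponential. For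
    example 192 = 6 * 2 * 4^2. In \<open>h3\<close> one \<zeta> comes from the factor s of the
    mixing bound and the other from \<delta>.\<close>
  have h1: "eventually (\<lambda>n. 16 / c1 * real n powr (\<kappa> + 3 * e + \<zeta> - 1) \<le> 1) sequentially"
    using e \<zeta> \<kappa> by (intro eventually_powr_le) auto
  have h2: "eventually (\<lambda>n. 192 / c1\<^sup>2 * real n powr (\<kappa> + 6 * e + 2 * \<zeta> - 1) \<le> 1) sequentially"
    using \<kappa> by (intro eventually_powr_le) auto
  have h3: "eventually (\<lambda>n. (8 * a * C) * real n powr (2 * e + 2 * \<zeta>) *
      exp (0 * real n powr (3 * e + \<zeta>) - c * real n powr (\<kappa> * \<gamma>1)) \<le> c1) sequentially"
    using e \<zeta> \<kappa> pos c1 by (intro eventually_powr_exp_le) auto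
  have h4: "eventually (\<lambda>n. (8 * a * C / c1) * real n powr (3 * e + 2 * \<zeta>) *
      exp (4 / c1 * real n powr (3 * e + \<zeta>) - c * real n powr (\<kappa> * \<gamma>1)) \<le> 1) sequentially"
    using e \<zeta> \<kappa> pos by (intro eventually_powr_exp_le) auto
  show ?thesis
    using s(1) eventually_ge_at_top[of 1] h1 h2 h3 h4 unfolding c1_def[symmetric]
  proof eventually_elim
    case (elim n)
    define X where "X = real n"
    have X: "1 \<le> X" using elim(2) by (simp add: X_def)
    have s1: "1 \<le> real (s n)" using s(2) elim(2) by simp
    have sC: "real (s n) \<le> C * X powr \<zeta>" using elim(1) by (simp add: X_def)
    have N_fold: "N n = nat \<lceil>X powr e\<rceil>" and l_fold: "l n = nat \<lceil>X powr \<kappa>\<rceil>"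
      by (simp_all add: N_def l_def X_def)
    note NX = nat_ceiling_powr_bounds[OF elim(2) less_imp_le[OF e], folded X_def, folded N_fold]
    note lX = nat_ceiling_powr_bounds[OF elim(2) less_imp_le[OF \<kappa>(1)], folded X_def, folded l_fold]
    have N0: "0 \<le> real (N n)" by simp
    have N2: "(real (N n))\<^sup>2 \<le> 4 * X powr (2 * e)"
    proof -
      have "(real (N n))\<^sup>2 \<le> (2 * X powr e)\<^sup>2" by (rule power_mono[OF NX(2) N0])
      also have "\<dots> = 4 * X powr (2 * e)"
        using X by (simp add: power_mult_distrib power2_eq_square powr_add[symmetric])
      finally show ?thesis .
    qed
    have ll: "real (l n) \<le> 2 * X powr \<kappa>" by (rule lX(2))
    have \<delta>: "c1 * X powr (- \<zeta>) \<le> \<delta> n / 9"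
    proof -
      have "\<eta> / (36 * (C * X powr \<zeta>)) \<le> \<eta> / (36 * real (s n))"
        using sC s1 pos by (intro divide_left_mono mult_left_mono mult_pos_pos) auto
      then show ?thesis unfolding c1_def \<delta>_def by (simp add: powr_minus field_simps)
    qed
    have d0: "0 < c1 * X powr (- \<zeta>)" using c1 X by simp
    then have \<delta>0: "0 < \<delta> n / 9" using \<delta> by linarith
    have u0: "0 \<le> u n" unfolding u_def using \<delta>0 by (intro divide_nonneg_nonneg mult_nonneg_nonneg) auto
    have u_le: "u n \<le> X powr (e + \<zeta> - 1) / c1"
    proof -
      have "u n \<le> X powr e / (X * (c1 * X powr (- \<zeta>)))"
        unfolding u_def X_def[symmetric] using \<delta> d0 \<delta>0 X c1 by (intro divide_left_mono mult_left_mono mult_pos_pos) auto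
      also have "\<dots> = X powr (e + \<zeta> - 1) / c1"
        using X c1 by (simp add: powr_add powr_diff powr_minus field_simps)
      finally show ?thesis .
    qed
    have uN: "u n * (real (N n))\<^sup>2 \<le> 4 / c1 * X powr (3 * e + \<zeta> - 1)"
    proof -
      have "u n * (real (N n))\<^sup>2 \<le> X powr (e + \<zeta> - 1) / c1 * (4 * X powr (2 * e))"
        by (rule mult_mono[OF u_le N2]) (use c1 in auto)
      also have "\<dots> = 4 / c1 * (X powr (e + \<zeta> - 1) * X powr (2 * e))" by simp
      also have "X powr (e + \<zeta> - 1) * X powr (2 * e) = X powr (3 * e + \<zeta> - 1)"
        unfolding powr_add[symmetric] by (intro arg_cong2[where f = "(powr)"] refl) simp
      finally show ?thesis .
    qed
    have uN0: "0 \<le> u n * (real (N n))\<^sup>2" using u0 by simp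
    have n1: "u n * (real (N n))\<^sup>2 * (2 * real (l n)) \<le> 1"
    proof -
      have "u n * (real (N n))\<^sup>2 * (2 * real (l n)) \<le> 4 / c1 * X powr (3 * e + \<zeta> - 1) * (2 * (2 * X powr \<kappa>))"
        by (rule mult_mono[OF uN]) (use ll c1 in auto)
      also have "\<dots> = 16 / c1 * (X powr (3 * e + \<zeta> - 1) * X powr \<kappa>)" by simp
      also have "X powr (3 * e + \<zeta> - 1) * X powr \<kappa> = X powr (\<kappa> + 3 * e + \<zeta> - 1)"
        unfolding powr_add[symmetric] by (intro arg_cong2[where f = "(powr)"] refl) simp
      finally show ?thesis using elim(3) by (simp add: X_def)
    qed
    have n2: "6 * real (l n) * real n * (u n * (real (N n))\<^sup>2)\<^sup>2 \<le> 1"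
    proof -
      have "(u n * (real (N n))\<^sup>2)\<^sup>2 \<le> (4 / c1 * X powr (3 * e + \<zeta> - 1))\<^sup>2"
        using uN uN0 by (intro power_mono) auto
      then have "6 * real (l n) * X * (u n * (real (N n))\<^sup>2)\<^sup>2
          \<le> 6 * (2 * X powr \<kappa>) * X * (4 / c1 * X powr (3 * e + \<zeta> - 1))\<^sup>2"
        using ll X by (intro mult_mono) auto
      also have "\<dots> = 192 / c1\<^sup>2 * (X powr \<kappa> * X powr 1 * (X powr (3 * e + \<zeta> - 1) * X powr (3 * e + \<zeta> - 1)))"
        using X by (simp add: power_mult_distrib power_divide power2_eq_square)
      also have "X powr \<kappa> * X powr 1 * (X powr (3 * e + \<zeta> - 1) * X powr (3 * e + \<zeta> - 1)) = X powr (\<kappa> + 6 * e + 2 * \<zeta> - 1)"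
        unfolding powr_add[symmetric] by (intro arg_cong2[where f = "(powr)"] refl) simp
      finally show ?thesis using elim(4) by (simp add: X_def)
    qed
    let ?E = "exp (- c * X powr (\<kappa> * \<gamma>1))"
    have \<beta>_le: "\<beta> n \<le> a * (C * X powr \<zeta>) * ?E"
    proof -
      have "(X powr \<kappa>) powr \<gamma>1 \<le> real (l n) powr \<gamma>1"
        using lX(1) \<gamma>1 by (intro powr_mono2) auto
      then have "exp (- c * real (l n) powr \<gamma>1) \<le> ?E"
        using pos by (simp add: powr_powr)
      then show ?thesis unfolding \<beta>_def
        using sC pos by (intro mult_mono mult_left_mono) auto
    qed
    have \<beta>0: "0 \<le> \<beta> n" unfolding \<beta>_def using pos by simp
    have n3: "2 * (real (N n))\<^sup>2 * \<beta> n \<le> \<delta> n / 9"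
    proof -
      have "2 * (real (N n))\<^sup>2 * \<beta> n \<le> 2 * (4 * X powr (2 * e)) * (a * (C * X powr \<zeta>) * ?E)"
        using N2 \<beta>_le \<beta>0 by (intro mult_mono) auto
      also have "\<dots> = 8 * a * C * (X powr (2 * e) * X powr \<zeta>) * ?E" by simp
      also have "\<dots> = (8 * a * C * X powr (2 * e + 2 * \<zeta>) * ?E) * X powr (- \<zeta>)"
      proof -
        have pe: "X powr (2 * e) * X powr \<zeta> = X powr (2 * e + 2 * \<zeta>) * X powr (- \<zeta>)"
          unfolding powr_add[symmetric] by (intro arg_cong2[where f = "(powr)"] refl) simp
        show ?thesis unfolding pe by (simp only: mult_ac)
      qed
      also have "\<dots> \<le> c1 * X powr (- \<zeta>)"
        using elim(5) by (intro mult_right_mono) (auto simp: X_def)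
      also have "\<dots> \<le> \<delta> n / 9" by (rule \<delta>)
      finally show ?thesis .
    qed
    have n4: "real n * u n * (2 * exp (u n * (real n * (real (N n))\<^sup>2)) * (real (N n))\<^sup>2 * \<beta> n) \<le> 1"
    proof -
      have XuN: "X * (u n * (real (N n))\<^sup>2) \<le> 4 / c1 * X powr (3 * e + \<zeta>)"
      proof -
        have "X * (u n * (real (N n))\<^sup>2) \<le> X * (4 / c1 * X powr (3 * e + \<zeta> - 1))"
          using uN X by (intro mult_left_mono) auto
        also have "\<dots> = 4 / c1 * X powr (3 * e + \<zeta>)"
          using X by (simp add: powr_diff)
        finally show ?thesis .
      qed
      have XuN0: "0 \<le> X * (u n * (real (N n))\<^sup>2)" using uN0 X by simp
      have p1: "2 * (X * (u n * (real (N n))\<^sup>2)) \<le> 2 * (4 / c1 * X powr (3 * e + \<zeta>))"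
        using XuN by simp
      have p2: "exp (X * (u n * (real (N n))\<^sup>2)) * \<beta> n
          \<le> exp (4 / c1 * X powr (3 * e + \<zeta>)) * (a * (C * X powr \<zeta>) * ?E)"
        by (rule mult_mono[OF _ \<beta>_le]) (use XuN \<beta>0 in auto)
      have "real n * u n * (2 * exp (u n * (real n * (real (N n))\<^sup>2)) * (real (N n))\<^sup>2 * \<beta> n)
          = 2 * (X * (u n * (real (N n))\<^sup>2)) * (exp (X * (u n * (real (N n))\<^sup>2)) * \<beta> n)"
        by (simp add: X_def mult_ac)
      also have "\<dots> \<le> 2 * (4 / c1 * X powr (3 * e + \<zeta>)) * (exp (4 / c1 * X powr (3 * e + \<zeta>)) * (a * (C * X powr \<zeta>) * ?E))"
        by (rule mult_mono[OF p1 p2]) (use \<beta>0 c1 in auto)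
      also have "\<dots> = (8 * a * C / c1) * (X powr (3 * e + \<zeta>) * X powr \<zeta>) * (exp (4 / c1 * X powr (3 * e + \<zeta>)) * ?E)"
        by simp
      also have "X powr (3 * e + \<zeta>) * X powr \<zeta> = X powr (3 * e + 2 * \<zeta>)"
        unfolding powr_add[symmetric] by (intro arg_cong2[where f = "(powr)"] refl) simp
      also have "exp (4 / c1 * X powr (3 * e + \<zeta>)) * ?E = exp (4 / c1 * X powr (3 * e + \<zeta>) - c * X powr (\<kappa> * \<gamma>1))"
        by (simp add: exp_add[symmetric])
      finally show ?thesis using elim(6) by (simp add: X_def)
    qed
    have n5: "9 * c1 * real n powr (- \<zeta>) \<le> \<delta> n" using \<delta> unfolding X_def by simp
    show ?case using n1 n2 n3 n4 n5 by blast
  qed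
qed

section \<open>Choice of the rates and conclusion\<close>

context sub_poissonian_inar
begin

text \<open>The choice of u turns the Chernoff factor into exp (- n^e), and the rate conditions
  bound the other two factors by e and 2, whence 8 e. The moment order r is so large that N^r \<ge>
  n^4. The truncation error is then of order n^(\<zeta> - 4), small enough to survive the union
  bound over at most 4 n^2 entries.\<close>

lemma F_inf_V1_tail_rate:
  assumes n: "1 \<le> n" and N: "real n powr e \<le> real N" "1 \<le> N" and l: "1 \<le> l"
    and \<beta>: "beta_mix M X l \<le> ennreal \<beta>" "0 \<le> \<beta>"
    and u: "u = real n powr e / (real n * (\<delta> / 9))"
    and rate: "u * (real N)\<^sup>2 * (2 * real l) \<le> 1" "6 * real l * real n * (u * (real N)\<^sup>2)\<^sup>2 \<le> 1"
      "2 * (real N)\<^sup>2 * \<beta> \<le> \<delta> / 9"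
      "real n * u * (2 * exp (u * (real n * (real N)\<^sup>2)) * (real N)\<^sup>2 * \<beta>) \<le> 1"
    and \<delta>: "0 < b" "b * real n powr (- \<zeta>) \<le> \<delta>" and r: "4 \<le> e * real r"
    and p: "real p + 1 \<le> 2 * real n" and K: "K_X p \<theta> \<le> K"
    and T: "T \<subseteq> {..p}" "T \<noteq> {}" and f: "f < F_inf p T (Vmat M X) - 4 * real (card T) * \<delta>"
  shows "1 - 4 * (real n)\<^sup>2 * (8 * exp 1 * exp (- (real n powr e))
      + 6 * (real (r + 2) * K) ^ (r + 2) / b * real n powr (\<zeta> - 4))
    \<le> prob {\<omega>\<in>space M. f < F_inf p T (V1 n X \<omega>)}"
proof -
  let ?X = "real n"
  have X: "1 \<le> ?X" using n by simp
  have b0: "0 < b * ?X powr (- \<zeta>)" using \<delta>(1) X by simp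
  then have \<delta>0: "0 < \<delta>" using \<delta>(2) by linarith
  have u0: "0 < u" unfolding u using \<delta>0 X by simp
  have uy: "u * (?X * \<delta> / 9) = ?X powr e" unfolding u using \<delta>0 X by simp
  have tb: "4 * tail_bound n l N \<beta> u (?X * \<delta> / 9) \<le> 8 * exp 1 * exp (- (?X powr e))"
  proof -
    have "exp (6 * real l * ?X * (u * (real N)\<^sup>2)\<^sup>2) * (1 + ?X * u * (2 * exp (u * (?X * (real N)\<^sup>2)) * (real N)\<^sup>2 * \<beta>))
        \<le> exp 1 * 2"
      by (rule mult_mono) (use rate u0 \<beta> in auto)
    then have "exp (- (u * (?X * \<delta> / 9))) * (exp (6 * real l * ?X * (u * (real N)\<^sup>2)\<^sup>2) *
        (1 + ?X * u * (2 * exp (u * (?X * (real N)\<^sup>2)) * (real N)\<^sup>2 * \<beta>)))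
        \<le> exp (- (u * (?X * \<delta> / 9))) * (exp 1 * 2)"
      by (intro mult_left_mono) auto
    then show ?thesis unfolding tail_bound_def uy by simp
  qed
  have tr: "6 * (real (r + 2) * K_X p \<theta>) ^ (r + 2) / (real N ^ r * \<delta>)
      \<le> 6 * (real (r + 2) * K) ^ (r + 2) / b * ?X powr (\<zeta> - 4)"
  proof -
    have "?X powr 4 \<le> ?X powr (e * real r)" using X r by (intro powr_mono) auto
    also have "\<dots> = (?X powr e) ^ r" using X by (simp add: powr_powr[symmetric] powr_realpow)
    also have "\<dots> \<le> real N ^ r" by (intro power_mono N) simp
    finally have Nr: "?X powr 4 \<le> real N ^ r" .
    have den: "?X powr 4 * (b * ?X powr (- \<zeta>)) \<le> real N ^ r * \<delta>"
      by (rule mult_mono[OF Nr \<delta>(2)]) (use b0 in auto)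
    have num: "6 * (real (r + 2) * K_X p \<theta>) ^ (r + 2) \<le> 6 * (real (r + 2) * K) ^ (r + 2)"
      using K K_X_ge_half by (intro mult_left_mono power_mono) auto
    have K0: "0 \<le> K" using K K_X_ge_half by linarith
    have dpos: "0 < ?X powr 4 * (b * ?X powr (- \<zeta>))" by (rule mult_pos_pos) (use X b0 in auto)
    have "6 * (real (r + 2) * K_X p \<theta>) ^ (r + 2) / (real N ^ r * \<delta>)
        \<le> 6 * (real (r + 2) * K) ^ (r + 2) / (?X powr 4 * (b * ?X powr (- \<zeta>)))"
      by (rule frac_le[OF _ num dpos den]) (use K0 in simp)
    also have "\<dots> = 6 * (real (r + 2) * K) ^ (r + 2) / b * ?X powr (\<zeta> - 4)"
    proof -
      have "?X powr (\<zeta> - 4) = 1 / (?X powr 4 * ?X powr (- \<zeta>))"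
        unfolding powr_add[symmetric] by (simp add: powr_minus_divide[symmetric])
      then show ?thesis by simp
    qed
    finally show ?thesis .
  qed
  have K0: "0 \<le> K" using K K_X_ge_half by linarith
  have "(real p + 1)\<^sup>2 \<le> (2 * ?X)\<^sup>2" using p by (intro power_mono) auto
  also have "\<dots> = 4 * ?X\<^sup>2" by (simp add: power_mult_distrib)
  finally have p2: "(real p + 1)\<^sup>2 \<le> 4 * ?X\<^sup>2" .
  have "(real p + 1)\<^sup>2 * (4 * tail_bound n l N \<beta> u (?X * \<delta> / 9)
      + 6 * (real (r + 2) * K_X p \<theta>) ^ (r + 2) / (real N ^ r * \<delta>))
    \<le> 4 * ?X\<^sup>2 * (8 * exp 1 * exp (- (?X powr e))
      + 6 * (real (r + 2) * K) ^ (r + 2) / b * ?X powr (\<zeta> - 4))"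
  proof (rule mult_mono[OF p2 add_mono[OF tb tr]])
    have "0 \<le> tail_bound n l N \<beta> u (?X * \<delta> / 9)" unfolding tail_bound_def using \<beta>(2) u0 by simp
    moreover have "0 \<le> 6 * (real (r + 2) * K_X p \<theta>) ^ (r + 2) / (real N ^ r * \<delta>)"
      using K_X_ge_half \<delta>0 by (intro divide_nonneg_nonneg mult_nonneg_nonneg zero_le_power) auto
    ultimately show "0 \<le> 4 * tail_bound n l N \<beta> u (?X * \<delta> / 9)
      + 6 * (real (r + 2) * K_X p \<theta>) ^ (r + 2) / (real N ^ r * \<delta>)" by linarith
  qed simp
  with F_inf_V1_tail[OF n N(2) l \<beta> u0 rate(1) \<delta>0 rate(3) T f, of r] show ?thesis by linarith
qed

end

lemma tail_rate_tendsto: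
  assumes "0 < (e::real)" "\<zeta> < 1"
  shows "(\<lambda>n::nat. 1 - 4 * (real n)\<^sup>2 * (A * exp (- (real n powr e)) + B * real n powr (\<zeta> - 4))) \<longlonglongrightarrow> 1"
proof -
  have 1: "((\<lambda>x::real. x\<^sup>2 * exp (- (x powr e))) \<longlongrightarrow> 0) at_top"
    using assms by real_asymp
  have 2: "((\<lambda>x::real. x\<^sup>2 * x powr (\<zeta> - 4)) \<longlongrightarrow> 0) at_top"
    using assms by real_asymp
  have "((\<lambda>x::real. 1 - (4 * A * (x\<^sup>2 * exp (- (x powr e))) + 4 * B * (x\<^sup>2 * x powr (\<zeta> - 4))))
      \<longlongrightarrow> 1 - (4 * A * 0 + 4 * B * 0)) at_top"
    by (intro tendsto_intros 1 2)
  then have "((\<lambda>x::real. 1 - 4 * x\<^sup>2 * (A * exp (- (x powr e)) + B * x powr (\<zeta> - 4))) \<longlongrightarrow> 1) at_top"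
    by (simp add: algebra_simps)
  from filterlim_compose[OF this filterlim_real_sequentially] show ?thesis .
qed

text \<open>For e = 0 the constraints confine \<kappa> to the interval from \<zeta> / \<gamma>1 to 1
  - 2 \<zeta>, whose length is g. The midpoint leaves slack g / 2 in one constraint and \<gamma>1 g
  / 2 in the other, and e is chosen to use at most half of each.\<close>

lemma exists_rate_exponents:
  assumes "0 < (\<gamma>1::real)" "0 \<le> \<zeta>" "\<zeta> * (1 / \<gamma>1 + 2) < 1"
  obtains e \<kappa> where "0 < e" "0 < \<kappa>" "\<kappa> + 6 * e + 2 * \<zeta> < 1" "3 * e + \<zeta> < \<kappa> * \<gamma>1"
proof -
  define g where "g = 1 - \<zeta> * (1 / \<gamma>1 + 2)"
  have g: "0 < g" using assms(3) by (simp add: g_def)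
  define \<kappa> where "\<kappa> = \<zeta> / \<gamma>1 + g / 2"
  define e where "e = min (g / 24) (\<gamma>1 * g / 12)"
  have e: "0 < e" "e \<le> g / 24" "e \<le> \<gamma>1 * g / 12" using g assms(1) by (auto simp: e_def)
  have "0 < \<kappa>" unfolding \<kappa>_def using g assms by (intro add_nonneg_pos) auto
  moreover have "\<kappa> + 2 * \<zeta> = 1 - g / 2" unfolding \<kappa>_def g_def by (simp add: algebra_simps)
  then have "\<kappa> + 6 * e + 2 * \<zeta> < 1" using e(2) g by linarith
  moreover have "\<kappa> * \<gamma>1 = \<zeta> + \<gamma>1 * g / 2" unfolding \<kappa>_def using assms(1) by (simp add: field_simps)
  then have "3 * e + \<zeta> < \<kappa> * \<gamma>1" using e(1,3) by linarith
  ultimately show thesis using that e(1) by blast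
qed

text \<open>Once p \<ge> 3 the logarithm of p is at least 1, so p is bounded by p s ln p and thus
  eventually by n. Dimensions up to 2, where the logarithm may be small or zero, are covered by n
  \<ge> 2.\<close>

lemma eventually_dimension_le:
  assumes "(\<lambda>n. real (p n) * real (s n) * ln (real (p n))) \<in> o(\<lambda>n. real n)" "\<forall>n\<ge>1. 1 \<le> s n"
  shows "eventually (\<lambda>n. real (p n) + 1 \<le> 2 * real n) sequentially"
proof -
  have "eventually (\<lambda>n. norm (real (p n) * real (s n) * ln (real (p n))) \<le> 1 * norm (real n)) sequentially"
    by (rule landau_o.smallD[OF assms(1)]) simp
  then show ?thesis
    using eventually_ge_at_top[of 2]
  proof eventually_elim
    case (elim n)
    have "real (p n) \<le> real n"
    proof (cases "p n \<le> 2")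
      case True
      then show ?thesis using elim(2) by simp
    next
      case False
      have "exp 1 \<le> (3::real)" using exp_le by simp
      then have "ln (exp 1) \<le> ln (real (p n))" using False by (subst ln_le_cancel_iff) auto
      then have "1 \<le> ln (real (p n))" by simp
      moreover have "1 \<le> real (s n)" using assms(2) elim(2) by simp
      ultimately have "1 \<le> real (s n) * ln (real (p n))"
        using mult_mono[of 1 "real (s n)" 1 "ln (real (p n))"] by simp
      then have "real (p n) * 1 \<le> real (p n) * (real (s n) * ln (real (p n)))" by (intro mult_left_mono) auto
      then show ?thesis using elim(1) by (simp add: mult.assoc)
    qed
    then show ?case using elim(2) by linarith
  qed
qed

text \<open>Since p and s may vary with the sample size, there is one model for each n \<ge> 1,
  possibly on its own probability space. Constancy of a, c and \<gamma>1 means that they are the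
  same for all n, and constancy of K_X is expressed by a bound uniform in n.\<close>

theorem proposition3p14:
  fixes M :: "nat \<Rightarrow> 'a measure"
    and p s :: "nat \<Rightarrow> nat"
    and \<theta>0 h0 :: "nat \<Rightarrow> nat \<Rightarrow> real"
    and \<xi> :: "nat \<Rightarrow> nat \<Rightarrow> int \<Rightarrow> nat \<Rightarrow> 'a \<Rightarrow> nat"
    and \<epsilon> X :: "nat \<Rightarrow> int \<Rightarrow> 'a \<Rightarrow> nat"
    and lam :: "nat \<Rightarrow> real"
    and a c \<gamma>1 \<gamma> \<zeta> f_inf :: real
  defines "T0 \<equiv> (\<lambda>n. supp_set (p n) (\<theta>0 n))"
    and "KX \<equiv> (\<lambda>n. K_X (p n) (\<theta>0 n))"
  assumes model: "\<And>n. 1 \<le> n \<Longrightarrow> inar (M n) (p n) (\<theta>0 n) (h0 n) (\<xi> n) (\<epsilon> n) (X n)"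
    and s_range: "\<And>n. 1 \<le> n \<Longrightarrow> 1 < s n \<and> s n \<le> p n + 1"
    and sparsity: "\<And>n j. 1 \<le> n \<Longrightarrow> j \<le> p n \<Longrightarrow> \<theta>0 n j \<noteq> 0 \<longleftrightarrow> j < s n"
    and lam_pos: "\<And>n. 1 \<le> n \<Longrightarrow> 0 < lam n"
    and mixing_consts: "0 < a" "0 < c" "0 < \<gamma>1" "\<gamma> = 1 / (1 / \<gamma>1 + 2)"
    and tau_mixing: "\<And>n l. 1 \<le> n \<Longrightarrow> 1 \<le> l \<Longrightarrow>
          tau_mix (M n) (X n) l \<le> ennreal (a * exp (- c * real l powr \<gamma>1))"
    and beta_mixing: "\<And>n l. 1 \<le> n \<Longrightarrow> 1 \<le> l \<Longrightarrow>
          beta_mix (M n) (X n) l \<le> ennreal (a * real (s n) * exp (- c * real l powr \<gamma>1))"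
    and KX_const: "\<exists>K. \<forall>n\<ge>1. KX n \<le> K"
    and a1: "\<And>n. 1 \<le> n \<Longrightarrow> (\<Sum>i = 1..p n. \<theta>0 n i) < 1"
    and a2: "\<And>n. 1 \<le> n \<Longrightarrow> cond_sub_poissonian (M n) (p n) (\<theta>0 n) (X n)"
    and b: "0 < f_inf" "\<And>n. 1 \<le> n \<Longrightarrow> f_inf < F_inf (p n) (T0 n) (Vmat (M n) (X n))"
    and c1: "\<And>n. 1 \<le> n \<Longrightarrow> invertible_on (T0 n) (Vmat (M n) (X n))"
    and c2: "\<And>n. 1 \<le> n \<Longrightarrow> Wmat_well_defined (M n) (T0 n) (h0 n) (X n)
               \<and> invertible_on (T0 n) (Wmat (M n) (T0 n) (h0 n) (X n))"
    and d1: "0 \<le> \<zeta>" "\<zeta> < min (2 / 11) (\<gamma> / (1 + \<gamma>))"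
    and d2: "(\<lambda>n. real (s n)) \<in> O(\<lambda>n. real n powr \<zeta>)"
    and d3: "(\<lambda>n. real (p n) * real (s n) * ln (real (p n))) \<in> o(\<lambda>n. real n)"
    and d4: "(\<lambda>n. 1 / lam n * sqrt (real (p n) * real (s n) * ln (real (p n)) / real n)) \<in> o(\<lambda>_. 1)"
  shows
    "(\<forall>n\<ge>1. \<forall>q\<ge>1. \<forall>t. Lq_norm (M n) q (\<lambda>\<omega>. real (X n t \<omega>)) \<le> ennreal (q * KX n))
     \<and> (\<forall>n\<ge>1. measure (M n) {\<omega> \<in> space (M n). lam n < norm_inf (p n) (psi1 (p n) n (X n) (\<theta>0 n) \<omega>)}
          \<le> 12 * sqrt 6 * norm_inf (p n) (h0 n) powr (1/2) * KX n powr (3/2) / lam n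
              * sqrt (real (p n) * real (s n) * ln (1 + real (p n)) / real n))
     \<and> (\<forall>n\<ge>1. \<forall>t. (SUP v \<in> sparse_cone (p n) (T0 n) \<inter> unit_sphere (p n). SUP q \<in> {1..}.
            Lq_norm (M n) q (\<lambda>\<omega>. dotp (p n) v (regressor (X n) (t - 1) \<omega>)) / ennreal q)
          \<le> ennreal (2 * sqrt (real (s n)) * (1 + KX n)))
     \<and> (\<forall>\<eta>. 0 < \<eta> \<and> \<eta> < f_inf / 2 \<longrightarrow>
          (\<lambda>n. measure (M n) {\<omega> \<in> space (M n). f_inf - 2 * \<eta> < F_inf (p n) (T0 n) (V1 n (X n) \<omega>)})
            \<longlonglongrightarrow> 1)"
proof -
  have loc: "sub_poissonian_inar (M n) (p n) (\<theta>0 n) (h0 n) (\<xi> n) (\<epsilon> n) (X n)" if "1 \<le> n" for n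
    using model[OF that] a1[OF that] a2[OF that]
    by (intro sub_poissonian_inar.intro sub_poissonian_inar_axioms.intro)
  have T: "T0 n = {..<s n}" if "1 \<le> n" for n
  proof -
    have "(j \<le> p n \<and> \<theta>0 n j \<noteq> 0) = (j < s n)" for j
      using sparsity[OF that, of j] s_range[OF that] by (cases "j \<le> p n") auto
    then show ?thesis unfolding T0_def supp_set_def by auto
  qed
  have T_sub: "T0 n \<subseteq> {..p n}" "T0 n \<noteq> {}" "card (T0 n) = s n" if "1 \<le> n" for n
    using T[OF that] s_range[OF that] by (auto simp: T0_def supp_set_def)
  have i: "Lq_norm (M n) q (\<lambda>\<omega>. real (X n t \<omega>)) \<le> ennreal (q * KX n)" if "1 \<le> n" "1 \<le> q" for n q t
    unfolding KX_def by (rule sub_poissonian_inar.Lq_norm_X_le[OF loc that(2)]) (rule that)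
  have i': "measure (M n) {\<omega> \<in> space (M n). lam n < norm_inf (p n) (psi1 (p n) n (X n) (\<theta>0 n) \<omega>)}
      \<le> 12 * sqrt 6 * norm_inf (p n) (h0 n) powr (1/2) * KX n powr (3/2) / lam n
        * sqrt (real (p n) * real (s n) * ln (1 + real (p n)) / real n)" if n: "1 \<le> n" for n
    unfolding KX_def
  proof (rule sub_poissonian_inar.psi1_tail[OF loc[OF n] _ _ n lam_pos[OF n]])
    show "1 \<le> s n" "1 \<le> p n" using s_range[OF n] by auto
    show "\<theta>0 n i = 0" if "i \<le> p n" "s n \<le> i" for i using sparsity[OF n that(1)] that(2) by auto
  qed
  have ii: "(SUP v \<in> sparse_cone (p n) (T0 n) \<inter> unit_sphere (p n). SUP q \<in> {1..}.
      Lq_norm (M n) q (\<lambda>\<omega>. dotp (p n) v (regressor (X n) (t - 1) \<omega>)) / ennreal q)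
      \<le> ennreal (2 * sqrt (real (s n)) * (1 + KX n))" if n: "1 \<le> n" for n t
  proof (intro SUP_least)
    fix v and q :: real
    assume v: "v \<in> sparse_cone (p n) (T0 n) \<inter> unit_sphere (p n)" and q: "q \<in> {1..}"
    show "Lq_norm (M n) q (\<lambda>\<omega>. dotp (p n) v (regressor (X n) (t - 1) \<omega>)) / ennreal q
        \<le> ennreal (2 * sqrt (real (s n)) * (1 + KX n))"
      using sub_poissonian_inar.Lq_norm_dotp_le[OF loc[OF n], of v "T0 n" q "t - 1"] v q T_sub[OF n]
      unfolding KX_def by auto
  qed
  have iii: "(\<lambda>n. measure (M n) {\<omega> \<in> space (M n). f_inf - 2 * \<eta> < F_inf (p n) (T0 n) (V1 n (X n) \<omega>)}) \<longlonglongrightarrow> 1"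
    if \<eta>: "0 < \<eta>" for \<eta>
  proof -
    have \<gamma>0: "0 < \<gamma>" using mixing_consts by (simp add: add_pos_pos)
    \<comment> \<open>Multiplied by 1 / \<gamma>1 + 2, this becomes the solvability condition for
      the rate exponents.\<close>
    have "\<zeta> < \<gamma>"
    proof -
      have "\<gamma> / (1 + \<gamma>) \<le> \<gamma> / 1" using \<gamma>0 by (intro divide_left_mono) auto
      then show ?thesis using d1(2) by simp
    qed
    then have "\<zeta> * (1 / \<gamma>1 + 2) < \<gamma> * (1 / \<gamma>1 + 2)"
      using mixing_consts(3) by (intro mult_strict_right_mono) (auto simp: add_pos_pos)
    also have "\<gamma> * (1 / \<gamma>1 + 2) = 1"
      unfolding mixing_consts(4) using mixing_consts(3) add_pos_pos[of "1 / \<gamma>1" 2] by simp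
    finally obtain e \<kappa> where e: "0 < e" and \<kappa>: "0 < \<kappa>" "\<kappa> + 6 * e + 2 * \<zeta> < 1" "3 * e + \<zeta> < \<kappa> * \<gamma>1"
      using exists_rate_exponents[OF mixing_consts(3) d1(1)] by blast
    obtain C where C: "0 < C" "eventually (\<lambda>n. norm (real (s n)) \<le> C * norm (real n powr \<zeta>)) sequentially"
      using landau_o.bigE[OF d2] by blast
    obtain K where K: "\<And>n. 1 \<le> n \<Longrightarrow> KX n \<le> K" using KX_const by blast
    define r where "r = nat \<lceil>4 / e\<rceil>"
    have "4 / e \<le> real r" unfolding r_def by linarith
    then have r: "4 \<le> e * real r" using e by (simp add: field_simps)
    have s1: "\<forall>n\<ge>1. 1 \<le> s n" using s_range by (meson less_imp_le)
    define b where "b = 9 * (\<eta> / (36 * C))"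
    have b0: "0 < b" using \<eta> C(1) by (simp add: b_def)
    let ?low = "\<lambda>n. 1 - 4 * (real n)\<^sup>2 * (8 * exp 1 * exp (- (real n powr e))
        + 6 * (real (r + 2) * K) ^ (r + 2) / b * real n powr (\<zeta> - 4))"
    let ?P = "\<lambda>n. measure (M n) {\<omega> \<in> space (M n). f_inf - 2 * \<eta> < F_inf (p n) (T0 n) (V1 n (X n) \<omega>)}"
    have sC: "eventually (\<lambda>n. real (s n) \<le> C * real n powr \<zeta>) sequentially" using C(2) by simp
    have low: "eventually (\<lambda>n. ?low n \<le> ?P n) sequentially"
      using eventually_rate_conditions[OF e d1(1) \<kappa> mixing_consts(3) C(1) mixing_consts(1,2) \<eta> sC s1]
        eventually_dimension_le[OF d3 s1] eventually_ge_at_top[of 1]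
    proof eventually_elim
      case (elim n)
      note n = elim(3)
      let ?l = "nat \<lceil>real n powr \<kappa>\<rceil>" and ?\<delta> = "\<eta> / (4 * real (s n))"
      let ?\<beta> = "a * real (s n) * exp (- c * real ?l powr \<gamma>1)"
      have l1: "1 \<le> ?l" by (rule nat_ceiling_powr_bounds(3)[OF n less_imp_le[OF \<kappa>(1)]])
      show ?case
      proof (rule sub_poissonian_inar.F_inf_V1_tail_rate[OF loc[OF n] n nat_ceiling_powr_bounds(1,3)[OF n less_imp_le[OF e]]
            l1 beta_mixing[OF n l1] _ refl, where \<delta> = ?\<delta> and b = b and \<zeta> = \<zeta> and r = r and K = K])
        show "0 \<le> ?\<beta>" using mixing_consts(1) by simp
        \<comment> \<open>The perturbation of the cone constant thus costs exactly \<eta>. The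
          second \<eta> in the claim is slack that makes the inequality strict.\<close>
        have "4 * real (card (T0 n)) * ?\<delta> = \<eta>" using T_sub(3)[OF n] s_range[OF n] by simp
        then show "f_inf - 2 * \<eta> < F_inf (p n) (T0 n) (Vmat (M n) (X n)) - 4 * real (card (T0 n)) * ?\<delta>"
          using b(2)[OF n] \<eta> by linarith
        show "K_X (p n) (\<theta>0 n) \<le> K" using K[OF n] unfolding KX_def .
      qed (use elim(1,2) b0 r T_sub(1,2)[OF n] in \<open>auto simp: b_def\<close>)
    qed
    \<comment> \<open>The model is assumed for n \<ge> 1 only, so the space at n = 0 need not be a
      probability space and the bound by 1 is stated eventually.\<close>
    have up: "eventually (\<lambda>n. ?P n \<le> 1) sequentially"
      using eventually_ge_at_top[of 1]
    proof eventually_elim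
      case (elim n)
      interpret sub_poissonian_inar "M n" "p n" "\<theta>0 n" "h0 n" "\<xi> n" "\<epsilon> n" "X n" by (rule loc[OF elim])
      show ?case by (rule prob_le_1)
    qed
    have "?low \<longlonglongrightarrow> 1" using e d1(2) by (intro tail_rate_tendsto) auto
    then show ?thesis by (rule tendsto_sandwich[OF low up _ tendsto_const])
  qed
  show ?thesis using i i' ii iii by blast
qed

end
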